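(* Let $\mu_0$ be a probability measure whose support is contained in a smooth compact non-closed curve $K$ in $\mathbb{C}$. Let $u_0(z)=\int_{\mathbb{C}}\log|z-a|\,d\mu_0(a)$ be its logarithmic potential and assume that $u_0$ is Hölder continuous on $K$. Let $\alpha>0$ be a constant. Then there is a constant $A=A(K,\mu_0,\alpha)>0$, depending only on $K,\mu_0,\alpha$, with the following property. Let $n\geq 1$ be an integer, consider a probability measure on the set $\mathcal{P}_0^n$ of all monic complex polynomials of degree $n$, and let $c_n\geq 1$ be a constant such that the expectation of $|Q(z)|^\alpha$ for $Q\in\mathcal{P}_0^n$ satisfies $$\mathbb{E}(|Q(z)|^\alpha)\leq c_n e^{\alpha n u_0(z)}\quad\text{for all } z\in K.$$ Then for every $\delta>0$ $$\mathrm{Prob}\big\{Q\in\mathcal{P}_0^n:\ \mathrm{dist}(\mu_Q,\mu_0)\geq\delta\big\}\leq A n^A c_n e^{-A^{-1}\delta n}.$$ The constant $A$ is independent of $n$, $c_n$ and $\delta$.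
   Context: A smooth compact non-closed curve in $\mathbb{C}$ is a set parametrised by a $C^\infty$ injective map from $[0,1]$ to $\mathbb{C}$ with non-vanishing derivative. $\mathcal{P}_0^n$ is the set of all monic complex polynomials of one variable and degree $n$. For a polynomial $Q$ of degree $n$ with zeros $a_1,\dots,a_n$ (counted with multiplicity), $\mu_Q:=\frac1n\sum_{k=1}^n\delta_{a_k}$, where $\delta_a$ is the Dirac mass at $a$. For a probability measure $\mu$ with compact support in $\mathbb{C}$, its logarithmic potential is $u(z)=\int_{\mathbb{C}}\log|z-a|\,d\mu(a)$. For two such measures $\mu,\mu'$ with potentials $u,u'$, $\mathrm{dist}(\mu,\mu'):=\int_{\mathbb{P}^1}|u-u'|\,\omega_{FS}$, where $\mathbb{P}^1=\mathbb{C}\cup\{\infty\}$, $\omega_{FS}=dd^c\log(1+|z|^2)^{1/2}$ is the Fubini-Study form (viewed as a measure), and $dd^c=\frac{i}{\pi}\partial\overline\partial$. *)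

theory Defs
  imports "HOL-Probability.Probability" "HOL-Computational_Algebra.Computational_Algebra"
begin

text \<open>On \<open>S = {0..1}\<close> the derivatives at the two end points are one-sided.\<close>

definition smooth_on :: "real set \<Rightarrow> (real \<Rightarrow> complex) \<Rightarrow> bool" where
  "smooth_on S \<gamma> \<longleftrightarrow> (\<exists>D :: nat \<Rightarrow> real \<Rightarrow> complex. D 0 = \<gamma> \<and>
     (\<forall>k. \<forall>t\<in>S. (D k has_vector_derivative D (Suc k) t) (at t within S)))"

definition smooth_nonclosed_curve :: "complex set \<Rightarrow> bool" where
  "smooth_nonclosed_curve K \<longleftrightarrow> (\<exists>\<gamma>. smooth_on {0..1} \<gamma> \<and> inj_on \<gamma> {0..1} \<and>
     (\<forall>t\<in>{0..1}. vector_derivative \<gamma> (at t within {0..1}) \<noteq> 0) \<and> K = \<gamma> ` {0..1})"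

definition measure_support :: "'a::topological_space measure \<Rightarrow> 'a set" where
  "measure_support \<mu> = {x. \<forall>U. open U \<and> x \<in> U \<longrightarrow> emeasure \<mu> U > 0}"

definition holder_continuous_on :: "'a::metric_space set \<Rightarrow> ('a \<Rightarrow> 'b::metric_space) \<Rightarrow> bool" where
  "holder_continuous_on S f \<longleftrightarrow>
     (\<exists>C \<beta>. 0 < \<beta> \<and> \<beta> \<le> 1 \<and> (\<forall>x\<in>S. \<forall>y\<in>S. dist (f x) (f y) \<le> C * dist x y powr \<beta>))"

text \<open>The library has \<open>ln 0 = 0\<close>, and its Bochner integral of a non-integrable function is \<open>0\<close>.
  The logarithm and the logarithmic potential are therefore taken with values in \<open>ereal\<close>:
  \<open>log 0 = -\<infinity>\<close>, and the integral is that of the positive part minus that of the negative part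
  (\<open>e2ennreal\<close> truncates at \<open>0\<close>). For a finite measure of compact support the first of these
  integrals is finite, so the difference is meaningful, with values in \<open>[-\<infinity>, \<infinity>)\<close>.\<close>

definition elog :: "real \<Rightarrow> ereal" where
  "elog r = (if r = 0 then -\<infinity> else ereal (ln r))"

definition log_potential :: "complex measure \<Rightarrow> complex \<Rightarrow> ereal" where
  "log_potential \<mu> z =
     enn2ereal (\<integral>\<^sup>+ a. e2ennreal (elog (cmod (z - a))) \<partial>\<mu>) -
     enn2ereal (\<integral>\<^sup>+ a. e2ennreal (- elog (cmod (z - a))) \<partial>\<mu>)"

definition partial_x :: "(complex \<Rightarrow> complex) \<Rightarrow> complex \<Rightarrow> complex" where
  "partial_x f z = vector_derivative (\<lambda>t. f (z + of_real t)) (at 0)"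

definition partial_y :: "(complex \<Rightarrow> complex) \<Rightarrow> complex \<Rightarrow> complex" where
  "partial_y f z = vector_derivative (\<lambda>t. f (z + \<i> * of_real t)) (at 0)"

definition del :: "(complex \<Rightarrow> complex) \<Rightarrow> complex \<Rightarrow> complex" where
  "del f z = (partial_x f z - \<i> * partial_y f z) / 2"

definition delbar :: "(complex \<Rightarrow> complex) \<Rightarrow> complex \<Rightarrow> complex" where
  "delbar f z = (partial_x f z + \<i> * partial_y f z) / 2"

text \<open>With \<open>dd\<^sup>c = (i/\<pi>) \<partial>\<partial>bar\<close> and \<open>dz \<and> dzbar = -2i dx \<and> dy\<close>, the form \<open>dd\<^sup>c f\<close> is
  \<open>(2/\<pi>) f\<^sub>z\<^sub>z\<^sub>b\<^sub>a\<^sub>r dx \<and> dy\<close>; the following is this Lebesgue density.\<close>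

definition ddc_density :: "(complex \<Rightarrow> real) \<Rightarrow> complex \<Rightarrow> real" where
  "ddc_density f z = Re (2 / of_real pi * del (delbar (\<lambda>w. of_real (f w))) z)"

text \<open>The Fubini-Study form on the projective line is smooth, so as a measure it does not charge
  the point at infinity. It is represented by its restriction to the affine chart.\<close>

definition fubini_study :: "complex measure" where
  "fubini_study = density lborel
     (\<lambda>z. ennreal (ddc_density (\<lambda>w. ln ((1 + (cmod w)\<^sup>2) powr (1/2))) z))"

text \<open>Potentials of finite measures of compact support are \<open>-\<infinity>\<close> only on a Lebesgue null set, so the
  value of \<open>-\<infinity> - (-\<infinity>)\<close> in \<open>ereal\<close> is immaterial.\<close>

definition potential_dist :: "complex measure \<Rightarrow> complex measure \<Rightarrow> ennreal" where
  "potential_dist \<mu> \<mu>' =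
     (\<integral>\<^sup>+ z. e2ennreal \<bar>log_potential \<mu> z - log_potential \<mu>' z\<bar> \<partial>fubini_study)"

definition root_measure :: "complex poly \<Rightarrow> complex measure" where
  "root_measure Q = measure_of UNIV (sets borel)
     (\<lambda>B. (\<Sum>a\<in>#proots Q. indicator B a) / of_nat (degree Q))"

definition monic_polys :: "nat \<Rightarrow> complex poly set" where
  "monic_polys n = {Q. degree Q = n \<and> lead_coeff Q = 1}"

text \<open>Identifying \<open>monic_polys n\<close> with the \<open>n\<close>-dimensional complex affine space by means of the
  coefficients, this is the Borel \<open>\<sigma>\<close>-algebra. Only the measurable structure is used.\<close>

definition monic_poly_space :: "nat \<Rightarrow> complex poly measure" where
  "monic_poly_space n = sigma (monic_polys n)
     {{Q \<in> monic_polys n. coeff Q k \<in> B} | k B. B \<in> sets borel}"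

lemma space_monic_poly_space [simp]: "space (monic_poly_space n) = monic_polys n"
  unfolding monic_poly_space_def by (rule space_measure_of) auto

lemma measurable_coeff_monic_poly_space [measurable]:
  "(\<lambda>Q. coeff Q k) \<in> borel_measurable (monic_poly_space n)"
proof (rule measurableI)
  fix B :: "complex set" assume B: "B \<in> sets borel"
  have "(\<lambda>Q. coeff Q k) -` B \<inter> space (monic_poly_space n) = {Q \<in> monic_polys n. coeff Q k \<in> B}"
    by auto
  moreover have "{Q \<in> monic_polys n. coeff Q k \<in> B} \<in> sets (monic_poly_space n)"
    unfolding monic_poly_space_def by (subst sets_measure_of) (use B in auto)
  ultimately show "(\<lambda>Q. coeff Q k) -` B \<inter> space (monic_poly_space n) \<in> sets (monic_poly_space n)"
    by simp
qed auto

lemma measurable_poly_monic_poly_space: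
  "(\<lambda>(Q, z). poly Q z) \<in> borel_measurable (monic_poly_space n \<Otimes>\<^sub>M borel)"
proof -
  have "(\<lambda>x. \<Sum>i\<le>n. coeff (fst x) i * snd x ^ i) \<in> borel_measurable (monic_poly_space n \<Otimes>\<^sub>M borel)"
    by measurable
  moreover have "(\<Sum>i\<le>n. coeff (fst x) i * snd x ^ i) = (case x of (Q, z) \<Rightarrow> poly Q z)"
    if "x \<in> space (monic_poly_space n \<Otimes>\<^sub>M borel)" for x
    using that by (auto simp: space_pair_measure poly_altdef monic_polys_def)
  ultimately show ?thesis
    by (subst (asm) measurable_cong) auto
qed

lemma sum_mset_eq_sum_count:
  fixes f :: "'a \<Rightarrow> 'b::comm_semiring_1"
  shows "(\<Sum>a\<in>#M. f a) = (\<Sum>a\<in>set_mset M. of_nat (count M a) * f a)"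
proof (induction M)
  case (add x M)
  have "(\<Sum>a\<in>set_mset (add_mset x M). of_nat (count (add_mset x M) a) * f a) =
        (\<Sum>a\<in>insert x (set_mset M). (if a = x then f a else 0) + of_nat (count M a) * f a)"
    by (intro sum.cong) (auto simp: algebra_simps)
  also have "\<dots> = f x + (\<Sum>a\<in>insert x (set_mset M). of_nat (count M a) * f a)"
    by (subst sum.distrib) (simp add: sum.delta)
  also have "(\<Sum>a\<in>insert x (set_mset M). of_nat (count M a) * f a) =
             (\<Sum>a\<in>set_mset M. of_nat (count M a) * f a)"
    by (intro sum.mono_neutral_right) (auto simp: not_in_iff)
  finally show ?case using add.IH by simp
qed simp

lemma root_measure_eq_distr:
  assumes "degree Q > 0"
  shows "root_measure Q = distr (point_measure {a. poly Q a = 0}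
           (\<lambda>a. of_nat (order a Q) / of_nat (degree Q))) borel (\<lambda>a. a)"
    (is "_ = ?N")
proof -
  have Q: "Q \<noteq> 0" using assms by auto
  hence fin: "finite {a. poly Q a = 0}" by (rule poly_roots_finite)
  have eq: "(\<Sum>a\<in>#proots Q. indicator B a) / of_nat (degree Q) = emeasure ?N B"
    if B: "B \<in> sets borel" for B :: "complex set"
  proof -
    have "emeasure ?N B = (\<Sum>a | poly Q a = 0 \<and> a \<in> B. of_nat (order a Q) / of_nat (degree Q))"
      using B fin
      by (subst emeasure_distr)
         (auto simp: emeasure_point_measure_finite space_point_measure sets_point_measure
            measurable_def intro!: sum.cong)
    also have "\<dots> = (\<Sum>a | poly Q a = 0. indicator B a * of_nat (order a Q) / of_nat (degree Q))"
      using fin by (intro sum.mono_neutral_cong_left) (auto simp: indicator_def)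
    also have "\<dots> = (\<Sum>a | poly Q a = 0. indicator B a * of_nat (order a Q)) / of_nat (degree Q)"
      by (simp add: sum_distrib_right divide_ennreal_def)
    also have "(\<Sum>a | poly Q a = 0. indicator B a * of_nat (order a Q)) = (\<Sum>a\<in>#proots Q. indicator B a :: ennreal)"
      using Q by (simp add: sum_mset_eq_sum_count mult.commute)
    finally show ?thesis by simp
  qed
  have "root_measure Q = measure_of UNIV (sets borel) (emeasure ?N)"
    unfolding root_measure_def
    by (rule measure_of_eq) (use eq sets.sigma_sets_eq[of "borel :: complex measure"] in auto)
  also have "\<dots> = ?N"
    using measure_of_of_measure[of ?N] by simp
  finally show ?thesis .
qed

lemma nn_integral_root_measure:
  assumes "degree Q > 0" "f \<in> borel_measurable borel"
  shows "(\<integral>\<^sup>+ a. f a \<partial>root_measure Q) =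
    (\<Sum>a | poly Q a = 0. of_nat (order a Q) / of_nat (degree Q) * f a)"
proof -
  have "finite {a. poly Q a = 0}" using assms(1) by (intro poly_roots_finite) auto
  thus ?thesis
    using assms(2)
    by (simp add: root_measure_eq_distr[OF assms(1)] nn_integral_distr nn_integral_point_measure_finite)
qed

lemma sets_root_measure [simp]: "sets (root_measure Q) = sets borel"
  unfolding root_measure_def
  using sets.sigma_sets_eq[of "borel :: complex measure"] by (subst sets_measure_of) auto

lemma prob_space_root_measure:
  assumes "degree Q > 0"
  shows "prob_space (root_measure Q)"
proof
  have Q: "Q \<noteq> 0" using assms by auto
  have "emeasure (root_measure Q) (space (root_measure Q)) = (\<integral>\<^sup>+ a. 1 \<partial>root_measure Q)"
    by simp
  also have "\<dots> = (\<Sum>a | poly Q a = 0. of_nat (order a Q)) / of_nat (degree Q)"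
    by (subst nn_integral_root_measure[OF assms]) (auto simp: sum_distrib_right divide_ennreal_def)
  also have "(\<Sum>a | poly Q a = 0. of_nat (order a Q)) = (of_nat (size (proots Q)) :: ennreal)"
    using Q by (simp add: size_multiset_overloaded_eq)
  also have "\<dots> / of_nat (degree Q) = 1"
    using assms by (simp add: size_proots_complex ennreal_of_nat_eq_real_of_nat divide_ennreal)
  finally show "emeasure (root_measure Q) (space (root_measure Q)) = 1" .
qed

lemma measurable_elog [measurable]: "elog \<in> borel_measurable borel"
  unfolding elog_def by measurable

lemma log_potential_root_measure:
  assumes "degree Q > 0" "lead_coeff Q = 1"
  shows "log_potential (root_measure Q) z =
    (if poly Q z = 0 then - \<infinity> else ereal (ln (cmod (poly Q z)) / real (degree Q)))"
proof -
  define n where "n = real (degree Q)"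
  have n: "n > 0" using assms by (simp add: n_def)
  have Q: "Q \<noteq> 0" using assms by auto
  define R where "R = {a. poly Q a = 0}"
  have fin: "finite R" unfolding R_def using Q by (rule poly_roots_finite)
  define w where "w = (\<lambda>a. real (order a Q) / n)"
  have w: "of_nat (order a Q) / of_nat (degree Q) = ennreal (w a)" for a
    using n unfolding w_def n_def by (simp add: divide_ennreal ennreal_of_nat_eq_real_of_nat)
  have w0: "w a \<ge> 0" for a using n by (simp add: w_def)
  define P where "P = (\<integral>\<^sup>+ a. e2ennreal (elog (cmod (z - a))) \<partial>root_measure Q)"
  define N where "N = (\<integral>\<^sup>+ a. e2ennreal (- elog (cmod (z - a))) \<partial>root_measure Q)"
  have P: "P = (\<Sum>a\<in>R. ennreal (w a) * e2ennreal (elog (cmod (z - a))))"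
    unfolding P_def R_def w[symmetric] by (rule nn_integral_root_measure[OF assms(1)]) measurable
  have N: "N = (\<Sum>a\<in>R. ennreal (w a) * e2ennreal (- elog (cmod (z - a))))"
    unfolding N_def R_def w[symmetric] by (rule nn_integral_root_measure[OF assms(1)]) measurable
  have pos: "e2ennreal (elog (cmod (z - a))) = ennreal (if a = z then 0 else max 0 (ln (cmod (z - a))))" for a
    by (auto simp: elog_def max_def e2ennreal_neg ennreal_neg)
  have P': "P = ennreal (\<Sum>a\<in>R. w a * (if a = z then 0 else max 0 (ln (cmod (z - a)))))"
    unfolding P pos using w0 by (subst sum_ennreal[symmetric]) (auto simp: ennreal_mult)
  have P0: "(\<Sum>a\<in>R. w a * (if a = z then 0 else max 0 (ln (cmod (z - a))))) \<ge> 0"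
    using w0 by (intro sum_nonneg) auto
  have u: "log_potential (root_measure Q) z = enn2ereal P - enn2ereal N"
    by (simp add: log_potential_def P_def N_def)
  show ?thesis
  proof (cases "poly Q z = 0")
    case True
    hence z: "z \<in> R" by (simp add: R_def)
    have "w z > 0" using True Q n by (simp add: w_def order_root)
    hence "ennreal (w z) * e2ennreal (- elog (cmod (z - z))) = \<infinity>"
      by (simp add: elog_def ennreal_mult_eq_top_iff)
    hence "N = \<infinity>"
      unfolding N using z fin by (simp add: sum.remove)
    thus ?thesis using True P0 by (simp add: u P' enn2ereal_ennreal)
  next
    case False
    hence z: "z \<notin> R" by (simp add: R_def)
    have neg: "e2ennreal (- elog (cmod (z - a))) = ennreal (max 0 (- ln (cmod (z - a))))" if "a \<in> R" for a
      using z that by (auto simp: elog_def max_def e2ennreal_neg ennreal_neg)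
    have N': "N = ennreal (\<Sum>a\<in>R. w a * max 0 (- ln (cmod (z - a))))"
      unfolding N using w0 neg by (subst sum_ennreal[symmetric]) (auto simp: ennreal_mult)
    have N0: "(\<Sum>a\<in>R. w a * max 0 (- ln (cmod (z - a)))) \<ge> 0"
      using w0 by (intro sum_nonneg) auto
    have "enn2ereal P - enn2ereal N = ereal ((\<Sum>a\<in>R. w a * (if a = z then 0 else max 0 (ln (cmod (z - a))))) -
        (\<Sum>a\<in>R. w a * max 0 (- ln (cmod (z - a)))))"
      using P0 N0 by (simp add: P' N' enn2ereal_ennreal)
    also have "(\<Sum>a\<in>R. w a * (if a = z then 0 else max 0 (ln (cmod (z - a))))) -
        (\<Sum>a\<in>R. w a * max 0 (- ln (cmod (z - a)))) = (\<Sum>a\<in>R. w a * ln (cmod (z - a)))"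
      unfolding sum_subtractf[symmetric] using z by (intro sum.cong) (auto simp: max_def)
    also have "\<dots> = (\<Sum>a\<in>R. ln (cmod (z - a) ^ order a Q)) / n"
      unfolding sum_divide_distrib using z
      by (intro sum.cong refl) (auto simp: w_def ln_realpow)
    also have "(\<Sum>a\<in>R. ln (cmod (z - a) ^ order a Q)) = ln (\<Prod>a\<in>R. cmod (z - a) ^ order a Q)"
      using fin z by (subst ln_prod) auto
    also have "(\<Prod>a\<in>R. cmod (z - a) ^ order a Q) = cmod (poly Q z)"
      using arg_cong[OF complex_poly_decompose[of Q], of "\<lambda>p. cmod (poly p z)"] assms(2)
      by (simp add: R_def poly_prod prod_norm[symmetric] norm_power)
    finally show ?thesis using False by (simp add: u n_def)
  qed
qed

lemma ddc_density_fubini_study: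
  "ddc_density (\<lambda>w. ln ((1 + (cmod w)\<^sup>2) powr (1/2))) z = 1 / (pi * (1 + (cmod z)\<^sup>2)\<^sup>2)"
proof -
  let ?f = "\<lambda>w. complex_of_real (ln ((1 + (cmod w)\<^sup>2) powr (1/2)))"
  have p: "1 + (x\<^sup>2 + y\<^sup>2) > 0" for x y :: real by (smt (verit) zero_le_power2)
  have f: "?f w = complex_of_real (1/2 * ln (1 + ((Re w)\<^sup>2 + (Im w)\<^sup>2)))" for w
    using p[of "Re w" "Im w"] by (simp add: cmod_power2 ln_powr)
  have fx: "partial_x ?f w = of_real (Re w / (1 + ((Re w)\<^sup>2 + (Im w)\<^sup>2)))" for w
    unfolding partial_x_def f
    by (rule vector_derivative_at, rule has_vector_derivative_of_real)
       (use p[of "Re w" "Im w"] in \<open>auto intro!: derivative_eq_intros simp: field_simps\<close>)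
  have fy: "partial_y ?f w = of_real (Im w / (1 + ((Re w)\<^sup>2 + (Im w)\<^sup>2)))" for w
    unfolding partial_y_def f
    by (rule vector_derivative_at, rule has_vector_derivative_of_real)
       (use p[of "Re w" "Im w"] in \<open>auto intro!: derivative_eq_intros simp: field_simps\<close>)
  let ?g = "\<lambda>w. of_real (Re w / (2 * (1 + ((Re w)\<^sup>2 + (Im w)\<^sup>2)))) +
                \<i> * of_real (Im w / (2 * (1 + ((Re w)\<^sup>2 + (Im w)\<^sup>2))))"
  have g: "delbar ?f = ?g"
  proof
    fix w
    have half: "x / (2 * y) = x / y / 2" for x y :: real by simp
    show "delbar ?f w = ?g w"
      by (simp only: delbar_def fx fy half of_real_divide[of _ 2] add_divide_distrib
          times_divide_eq_right of_real_numeral)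
  qed
  define s where "s = 1 + ((Re z)\<^sup>2 + (Im z)\<^sup>2)"
  have s: "s > 0" using p by (simp add: s_def)
  have d1: "((\<lambda>t. (x + t) / (2 * (1 + ((x + t)\<^sup>2 + y\<^sup>2)))) has_real_derivative
              (r - 2 * x\<^sup>2) / (2 * r\<^sup>2)) (at 0)"
    and d2: "((\<lambda>t. y / (2 * (1 + ((x + t)\<^sup>2 + y\<^sup>2)))) has_real_derivative
              - (x * y) / r\<^sup>2) (at 0)"
    if r: "r = 1 + (x\<^sup>2 + y\<^sup>2)" for r x y :: real
  proof -
    have r0: "2 * r \<noteq> 0" using p[of x y] r by simp
    have d: "((\<lambda>t. 2 * (1 + ((x + t)\<^sup>2 + y\<^sup>2))) has_real_derivative 4 * x) (at 0)"
      by (auto intro!: derivative_eq_intros)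
    have nz: "2 * (1 + ((x + 0)\<^sup>2 + y\<^sup>2)) \<noteq> 0" using r0 r by simp
    have e: "2 * (1 + ((x + 0)\<^sup>2 + y\<^sup>2)) = 2 * r" by (simp add: r)
    have i: "((\<lambda>t. x + t) has_real_derivative 1) (at 0)" by (auto intro!: derivative_eq_intros)
    show "((\<lambda>t. (x + t) / (2 * (1 + ((x + t)\<^sup>2 + y\<^sup>2)))) has_real_derivative
              (r - 2 * x\<^sup>2) / (2 * r\<^sup>2)) (at 0)"
      by (rule DERIV_cong[OF DERIV_divide[OF i d nz]], unfold e)
         (use r0 in \<open>simp add: field_simps power2_eq_square\<close>)
    show "((\<lambda>t. y / (2 * (1 + ((x + t)\<^sup>2 + y\<^sup>2)))) has_real_derivative - (x * y) / r\<^sup>2) (at 0)"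
      by (rule DERIV_cong[OF DERIV_divide[OF DERIV_const d nz]], unfold e)
         (use r0 in \<open>simp add: field_simps power2_eq_square\<close>)
  qed
  have gx: "partial_x ?g z = of_real ((s - 2 * (Re z)\<^sup>2) / (2 * s\<^sup>2)) + \<i> * of_real (- (Re z * Im z) / s\<^sup>2)"
    unfolding partial_x_def
    by (rule vector_derivative_at, intro has_vector_derivative_add has_vector_derivative_mult_right
          has_vector_derivative_of_real)
       (use d1[OF s_def] d2[OF s_def] in simp_all)
  have s': "s = 1 + ((Im z)\<^sup>2 + (Re z)\<^sup>2)" by (simp add: s_def)
  have gy: "partial_y ?g z = of_real (- (Im z * Re z) / s\<^sup>2) + \<i> * of_real ((s - 2 * (Im z)\<^sup>2) / (2 * s\<^sup>2))"
    unfolding partial_y_def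
    by (rule vector_derivative_at, intro has_vector_derivative_add has_vector_derivative_mult_right
          has_vector_derivative_of_real)
       (use d1[OF s'] d2[OF s'] in \<open>simp_all add: add.commute[of "(Re z)\<^sup>2"]\<close>)
  have re: "Re (2 / of_real pi * ((of_real a + \<i> * of_real b - \<i> * (of_real c + \<i> * of_real d)) / 2)) = (a + d) / pi"
    for a b c d :: real
    by (simp add: field_simps)
  have "ddc_density (\<lambda>w. ln ((1 + (cmod w)\<^sup>2) powr (1/2))) z =
        ((s - 2 * (Re z)\<^sup>2) / (2 * s\<^sup>2) + (s - 2 * (Im z)\<^sup>2) / (2 * s\<^sup>2)) / pi"
    unfolding ddc_density_def g del_def gx gy by (rule re)
  also have "\<dots> = (s - ((Re z)\<^sup>2 + (Im z)\<^sup>2)) / s\<^sup>2 / pi"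
    using s by (simp add: field_simps)
  also have "s - ((Re z)\<^sup>2 + (Im z)\<^sup>2) = 1" by (simp add: s_def)
  finally show ?thesis by (simp add: s_def cmod_power2 mult.commute)
qed

lemma fubini_study_eq:
  "fubini_study = density lborel (\<lambda>z. ennreal (1 / (pi * (1 + (cmod z)\<^sup>2)\<^sup>2)))"
  by (simp only: fubini_study_def ddc_density_fubini_study)

lemma measurable_log_potential:
  assumes "prob_space \<mu>" "sets \<mu> = sets borel"
  shows "log_potential \<mu> \<in> borel_measurable borel"
proof -
  interpret prob_space \<mu> by fact
  note [measurable_cong] = assms(2)
  show ?thesis unfolding log_potential_def[abs_def] by measurable
qed

text \<open>Hence \<open>potential_dist (root_measure Q) \<mu> \<ge> \<delta>\<close> defines an event; \<open>measure\<close> would be \<open>0\<close> on a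
  non-measurable set.\<close>

lemma measurable_potential_dist_root_measure:
  assumes "n \<ge> 1" "prob_space \<mu>" "sets \<mu> = sets borel"
  shows "(\<lambda>Q. potential_dist (root_measure Q) \<mu>) \<in> borel_measurable (monic_poly_space n)"
proof -
  note [measurable] = measurable_poly_monic_poly_space measurable_log_potential[OF assms(2,3)]
  define F where "F = (\<lambda>(Q, z). if poly Q z = 0 then - \<infinity> else ereal (ln (cmod (poly Q z)) / real n))"
  have F [measurable]: "F \<in> borel_measurable (monic_poly_space n \<Otimes>\<^sub>M borel)"
  proof -
    have "F = (\<lambda>x. if (case x of (Q, z) \<Rightarrow> poly Q z) = 0 then - \<infinity>
                else ereal (ln (cmod (case x of (Q, z) \<Rightarrow> poly Q z)) / real n))"
      by (auto simp: F_def fun_eq_iff)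
    also have "\<dots> \<in> borel_measurable (monic_poly_space n \<Otimes>\<^sub>M borel)" by measurable
    finally show ?thesis .
  qed
  have "(\<lambda>Q. \<integral>\<^sup>+ z. ennreal (1 / (pi * (1 + (cmod z)\<^sup>2)\<^sup>2)) * e2ennreal \<bar>F (Q, z) - log_potential \<mu> z\<bar> \<partial>lborel)
        \<in> borel_measurable (monic_poly_space n)"
    by measurable
  moreover have "potential_dist (root_measure Q) \<mu> =
      (\<integral>\<^sup>+ z. ennreal (1 / (pi * (1 + (cmod z)\<^sup>2)\<^sup>2)) * e2ennreal \<bar>F (Q, z) - log_potential \<mu> z\<bar> \<partial>lborel)"
    if "Q \<in> space (monic_poly_space n)" for Q
  proof -
    from that have Q: "degree Q = n" "lead_coeff Q = 1" by (auto simp: monic_polys_def)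
    have u: "log_potential (root_measure Q) z = F (Q, z)" for z
      using Q assms(1) by (simp add: log_potential_root_measure F_def)
    have [measurable]: "(\<lambda>z. F (Q, z)) \<in> borel_measurable borel"
      using F that by measurable
    show ?thesis unfolding potential_dist_def fubini_study_eq u
      by (subst nn_integral_density) auto
  qed
  ultimately show ?thesis by (subst measurable_cong) auto
qed

end

theory Submission
  imports Defs "HOL-Complex_Analysis.Complex_Analysis"
begin

text \<open>Write \<open>U\<close> for the logarithmic potential of \<open>\<mu>\<^sub>0\<close> and \<open>w = ln |Q| / n - U\<close> for the difference of the
  two potentials; the distance is the integral of \<open>|w|\<close> against the Fubini-Study measure. Three facts
  combine. All constants below depend on \<open>K\<close>, \<open>\<mu>\<^sub>0\<close> and \<open>\<alpha>\<close> only.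

  (1) \<^emph>\<open>A bound for \<open>w\<close> on \<open>K\<close> bounds the distance linearly\<close> (\<open>potential_dist_root_measure_le\<close>). If
  \<open>w \<le> \<eta>\<close> on \<open>K\<close>, then \<open>w \<le> \<eta>\<close> everywhere by the maximum principle, because \<open>w\<close> is subharmonic off \<open>K\<close>
  and vanishes at infinity. So \<open>v = \<eta> - w\<close> is nonnegative, superharmonic off \<open>K\<close>, and takes the value
  \<open>\<eta>\<close> at infinity, and it remains to see that the Fubini-Study integral of such a function is at most a
  constant times \<open>\<eta>\<close>. This is a Harnack argument that starts at infinity and spreads by the inequality
  ``circle mean \<open>\<le>\<close> value at the centre'' through the connected complement of \<open>K\<close>. To reach \<open>K\<close> itself
  with a uniform constant one uses the circles that nearly touch \<open>K\<close>: a smooth arc has positive reach,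
  so a point at distance \<open>\<epsilon>\<close> from \<open>K\<close> lies on circles of a fixed size avoiding \<open>K\<close> for a proportion
  \<open>\<surd>\<epsilon>\<close> of the directions, and the weight \<open>(dist(a, K) - s) powr (-1/2)\<close> on circles of centre \<open>a\<close> and
  radius \<open>s\<close>, which is integrable in \<open>s\<close>, compensates for exactly this factor.

  (2) \<^emph>\<open>\<open>U\<close> is Hoelder continuous on the whole plane\<close> (\<open>smooth_arc_potential_holder\<close>), although this
  is assumed on \<open>K\<close> only. Comparing \<open>U(x)\<close>, for \<open>x\<close> in \<open>K\<close>, with the mean of \<open>U\<close> over a piece of \<open>K\<close> of
  size \<open>R\<close> around \<open>x\<close> shows that \<open>\<mu>\<^sub>0\<close> has little mass near \<open>x\<close>: the Hoelder condition forces
  \<open>\<mu>\<^sub>0(B(x, s)) = O(s powr \<kappa>)\<close> for some \<open>\<kappa> > 0\<close>. This makes the Riesz potentials of \<open>\<mu>\<^sub>0\<close> of small order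
  bounded, and the regularity of \<open>U\<close> follows.

  (3) \<^emph>\<open>A Bernstein-Markov inequality\<close> (\<open>bernstein_markov_arc\<close>). If \<open>M\<close> is the maximum of \<open>w\<close> on \<open>K\<close>,
  then \<open>|Q| \<le> exp (n (U + M))\<close> in the plane; with (2) and Cauchy's estimate this keeps \<open>|Q| exp (-n U)\<close>
  comparable to its maximum \<open>exp (n M)\<close> on a piece of \<open>K\<close> whose length is a negative power of \<open>n\<close>. So the
  mean of \<open>|Q| powr \<alpha> * exp (-\<alpha> n U)\<close> along \<open>K\<close> is at least a negative power of \<open>n\<close> times
  \<open>exp (\<alpha> n M)\<close>. The expectation of that mean is at most \<open>c\<close> by hypothesis, and Markov's inequality
  shows that \<open>M > \<eta>\<close> has probability at most a power of \<open>n\<close> times \<open>c exp (-\<alpha> n \<eta>)\<close>. By (1) the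
  distance can exceed \<open>\<delta>\<close> only if \<open>M > \<eta>\<close> with \<open>\<eta>\<close> a fixed multiple of \<open>\<delta>\<close>.\<close>

section \<open>Geometry of a smooth arc\<close>

text \<open>The parametrisation is bi-Lipschitz: close parameters are separated by Taylor's formula and
  the non-vanishing derivative, distant ones by injectivity and compactness. It is extended to the
  real line by constants, which makes it continuous, hence Borel, everywhere.\<close>

lemma smooth_nonclosed_curve_parametrisation:
  assumes "smooth_nonclosed_curve K"
  obtains \<gamma> :: "real \<Rightarrow> complex" and \<gamma>' :: "real \<Rightarrow> complex" and L M :: real
  where "K = \<gamma> ` {0..1}" "continuous_on UNIV \<gamma>" "inj_on \<gamma> {0..1}" "L \<ge> 1" "M > 0"
    "\<And>t. t \<in> {0..1} \<Longrightarrow> (\<gamma> has_vector_derivative \<gamma>' t) (at t within {0..1})"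
    "\<And>s t. s \<in> {0..1} \<Longrightarrow> t \<in> {0..1} \<Longrightarrow> cmod (\<gamma> s - \<gamma> t) \<le> L * \<bar>s - t\<bar>"
    "\<And>s t. s \<in> {0..1} \<Longrightarrow> t \<in> {0..1} \<Longrightarrow> \<bar>s - t\<bar> \<le> L * cmod (\<gamma> s - \<gamma> t)"
    "\<And>s t. s \<in> {0..1} \<Longrightarrow> t \<in> {0..1} \<Longrightarrow> cmod (\<gamma> t - \<gamma> s - (t - s) *\<^sub>R \<gamma>' s) \<le> M * (t - s)\<^sup>2"
proof -
  from assms obtain \<gamma> where sm: "smooth_on {0..1} \<gamma>" and inj: "inj_on \<gamma> {0..1}"
    and nz: "\<forall>t\<in>{0..1}. vector_derivative \<gamma> (at t within {0..1}) \<noteq> 0" and K: "K = \<gamma> ` {0..1}"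
    unfolding smooth_nonclosed_curve_def by blast
  from sm obtain D where D0: "D 0 = \<gamma>"
    and D: "\<And>k t. t \<in> {0..1} \<Longrightarrow> (D k has_vector_derivative D (Suc k) t) (at t within {0..1})"
    unfolding smooth_on_def by blast
  have cont: "continuous_on {0..1} (D k)" for k
    using D by (meson continuous_on_eq_continuous_within has_vector_derivative_continuous)
  have bound: "\<exists>B>0. \<forall>t\<in>{0..1}. cmod (D k t) \<le> B" for k
  proof -
    have "bounded (D k ` {0..1})" using cont by (intro compact_imp_bounded compact_continuous_image) auto
    thus ?thesis by (auto simp: bounded_pos)
  qed
  obtain B1 where B1: "B1 > 0" "\<And>t. t \<in> {0..1} \<Longrightarrow> cmod (D 1 t) \<le> B1" using bound[of 1] by blast
  obtain M where M: "M > 0" "\<And>t. t \<in> {0..1} \<Longrightarrow> cmod (D 2 t) \<le> M" using bound[of 2] by blast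
  have lip: "cmod (D k s - D k t) \<le> B * \<bar>s - t\<bar>"
    if "\<And>t. t \<in> {0..1} \<Longrightarrow> cmod (D (Suc k) t) \<le> B" "s \<in> {0..1}" "t \<in> {0..1}" for k B s t
  proof -
    have "onorm (\<lambda>h. h *\<^sub>R D (Suc k) t) \<le> B" if "t \<in> {0..1}" for t
      using \<open>\<And>t. t \<in> {0..1} \<Longrightarrow> cmod (D (Suc k) t) \<le> B\<close>[OF that]
      by (intro onorm_le) (simp add: mult.commute[of B] mult_left_mono)
    thus ?thesis
      using differentiable_bound[of "{0..1}" "D k" "\<lambda>t h. h *\<^sub>R D (Suc k) t" B s t] that(2,3) D[of _ k]
      by (auto simp: has_vector_derivative_def)
  qed
  have tay: "cmod (\<gamma> t - \<gamma> s - (t - s) *\<^sub>R D 1 s) \<le> M * (t - s)\<^sup>2" if st: "s \<in> {0..1}" "t \<in> {0..1}" for s t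
  proof -
    have seg: "closed_segment s t \<subseteq> {0..1}" using st by (simp add: closed_segment_subset)
    have "cmod (\<gamma> t - \<gamma> s - (t - s) *\<^sub>R D 1 s) \<le> norm (t - s) * (M * \<bar>t - s\<bar>)"
    proof (rule vector_differentiable_bound_linearization[where S = "closed_segment s t"])
      show "(\<gamma> has_vector_derivative D 1 x) (at x within closed_segment s t)" if "x \<in> closed_segment s t" for x
        by (rule has_vector_derivative_within_subset[OF _ seg]) (use D[of x 0] D0 seg that in auto)
      show "cmod (D 1 x - D 1 s) \<le> M * \<bar>t - s\<bar>" if "x \<in> closed_segment s t" for x
      proof -
        have "cmod (D 1 x - D 1 s) \<le> M * \<bar>x - s\<bar>"
          using lip[of 1 M x s] M(2) seg that st by (auto simp: numeral_2_eq_2)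
        also have "\<bar>x - s\<bar> \<le> \<bar>t - s\<bar>"
          using that by (auto simp: closed_segment_eq_real_ivl split: if_splits)
        finally show ?thesis using M(1) by simp
      qed
    qed auto
    thus ?thesis by (simp add: power2_eq_square abs_mult_self_eq algebra_simps)
  qed
  obtain m where m: "m > 0" "\<And>t. t \<in> {0..1} \<Longrightarrow> m \<le> cmod (D 1 t)"
  proof -
    have "continuous_on {0..1} (\<lambda>t. cmod (D 1 t))" by (intro continuous_intros cont)
    then obtain t0 where t0: "t0 \<in> {0..1}" "\<And>t. t \<in> {0..1} \<Longrightarrow> cmod (D 1 t0) \<le> cmod (D 1 t)"
      using continuous_attains_inf[of "{0..1::real}" "\<lambda>t. cmod (D 1 t)"] by auto
    have "vector_derivative \<gamma> (at t0 within {0..1}) = D 1 t0"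
      using vector_derivative_within_cbox[of 0 1 t0 \<gamma> "D 1 t0"] D[of t0 0] D0 t0(1) by auto
    hence "cmod (D 1 t0) > 0" using nz t0(1) by auto
    with t0 show ?thesis using that by blast
  qed
  have near: "\<bar>s - t\<bar> \<le> 2 / m * cmod (\<gamma> s - \<gamma> t)"
    if st: "s \<in> {0..1}" "t \<in> {0..1}" and h: "\<bar>s - t\<bar> \<le> m / (2 * M)" for s t
  proof -
    have "m * \<bar>t - s\<bar> \<le> cmod ((t - s) *\<^sub>R D 1 s)"
      using mult_left_mono[OF m(2)[OF st(1)], of "\<bar>t - s\<bar>"] by (simp add: mult.commute[of m])
    also have "\<dots> \<le> cmod (\<gamma> t - \<gamma> s) + cmod (\<gamma> t - \<gamma> s - (t - s) *\<^sub>R D 1 s)"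
      by (smt (verit) norm_minus_commute norm_triangle_sub)
    also have "cmod (\<gamma> t - \<gamma> s - (t - s) *\<^sub>R D 1 s) \<le> M * \<bar>t - s\<bar> * \<bar>t - s\<bar>"
      using tay[OF st] by (simp add: power2_eq_square)
    also have "M * \<bar>t - s\<bar> * \<bar>t - s\<bar> \<le> m / 2 * \<bar>t - s\<bar>"
      using h M(1) by (intro mult_right_mono) (auto simp: field_simps abs_minus_commute)
    finally show ?thesis using m(1) by (simp add: field_simps norm_minus_commute abs_minus_commute)
  qed
  obtain c where c: "c > 0"
    "\<And>s t. s \<in> {0..1} \<Longrightarrow> t \<in> {0..1} \<Longrightarrow> \<bar>s - t\<bar> \<ge> m / (2 * M) \<Longrightarrow> c \<le> cmod (\<gamma> s - \<gamma> t)"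
  proof -
    define P where "P = {p \<in> {0..1} \<times> {0..1::real}. \<bar>fst p - snd p\<bar> \<ge> m / (2 * M)}"
    have cP: "compact P"
    proof -
      have "P = ({0..1} \<times> {0..1}) \<inter> {p. \<bar>fst p - snd p\<bar> \<ge> m / (2 * M)}" by (auto simp: P_def)
      moreover have "closed {p::real\<times>real. \<bar>fst p - snd p\<bar> \<ge> m / (2 * M)}"
        by (intro closed_Collect_le continuous_intros)
      ultimately show ?thesis by (auto intro!: compact_Int_closed compact_Times)
    qed
    have cf: "continuous_on P (\<lambda>p. cmod (\<gamma> (fst p) - \<gamma> (snd p)))"
      using cont[of 0] D0
      by (intro continuous_intros continuous_on_compose2[where g = \<gamma> and f = fst]
            continuous_on_compose2[where g = \<gamma> and f = snd]) (auto simp: P_def)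
    show ?thesis
    proof (cases "P = {}")
      case True
      thus ?thesis using that[of 1] by (auto simp: P_def)
    next
      case False
      then obtain p where p: "p \<in> P" "\<And>q. q \<in> P \<Longrightarrow> cmod (\<gamma> (fst p) - \<gamma> (snd p)) \<le> cmod (\<gamma> (fst q) - \<gamma> (snd q))"
        using continuous_attains_inf[OF cP False cf] by auto
      have "m / (2 * M) > 0" using m(1) M(1) by simp
      moreover have "\<bar>fst p - snd p\<bar> \<ge> m / (2 * M)" using p(1) by (simp add: P_def)
      ultimately have "fst p \<noteq> snd p" by force
      moreover have "fst p \<in> {0..1}" "snd p \<in> {0..1}" using p(1) by (auto simp: P_def)
      ultimately have "\<gamma> (fst p) \<noteq> \<gamma> (snd p)" using inj by (meson inj_onD)
      hence "cmod (\<gamma> (fst p) - \<gamma> (snd p)) > 0" by simp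
      moreover have "cmod (\<gamma> (fst p) - \<gamma> (snd p)) \<le> cmod (\<gamma> s - \<gamma> t)"
        if "s \<in> {0..1}" "t \<in> {0..1}" "\<bar>s - t\<bar> \<ge> m / (2 * M)" for s t
        using p(2)[of "(s, t)"] that by (simp add: P_def)
      ultimately show ?thesis by (rule that)
    qed
  qed
  define L where "L = max (max 1 B1) (max (2 / m) (1 / c))"
  have L: "L \<ge> 1" "L \<ge> B1" "L \<ge> 2 / m" "L \<ge> 1 / c" by (auto simp: L_def)
  have upper: "cmod (\<gamma> s - \<gamma> t) \<le> L * \<bar>s - t\<bar>" if "s \<in> {0..1}" "t \<in> {0..1}" for s t
  proof -
    have "cmod (\<gamma> s - \<gamma> t) \<le> B1 * \<bar>s - t\<bar>" using lip[of 0 B1 s t] B1(2) D0 that by simp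
    also have "\<dots> \<le> L * \<bar>s - t\<bar>" using L(2) by (intro mult_right_mono) auto
    finally show ?thesis .
  qed
  have lower: "\<bar>s - t\<bar> \<le> L * cmod (\<gamma> s - \<gamma> t)" if st: "s \<in> {0..1}" "t \<in> {0..1}" for s t
  proof (cases "\<bar>s - t\<bar> \<le> m / (2 * M)")
    case True
    have "\<bar>s - t\<bar> \<le> 2 / m * cmod (\<gamma> s - \<gamma> t)" by (rule near[OF st True])
    also have "\<dots> \<le> L * cmod (\<gamma> s - \<gamma> t)" using L(3) by (intro mult_right_mono) auto
    finally show ?thesis .
  next
    case False
    have "\<bar>s - t\<bar> \<le> 1 / c * c" using st c(1) by auto
    also have "\<dots> \<le> L * cmod (\<gamma> s - \<gamma> t)"
      using L(1,4) c False st by (intro mult_mono) auto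
    finally show ?thesis .
  qed
  \<comment> \<open>the constant extension beyond the end points\<close>
  define \<gamma>e where "\<gamma>e = (\<lambda>t. \<gamma> (max 0 (min 1 t)))"
  have e: "\<gamma>e t = \<gamma> t" if "t \<in> {0..1}" for t using that by (simp add: \<gamma>e_def)
  show ?thesis
  proof (rule that[of \<gamma>e L M "D 1"])
    show "K = \<gamma>e ` {0..1}" unfolding K by (rule image_cong) (auto simp: e)
    show "continuous_on UNIV \<gamma>e" unfolding \<gamma>e_def
      by (rule continuous_on_compose2[of "{0..1}" \<gamma>])
         (use cont[of 0] D0 in \<open>auto intro!: continuous_intros\<close>)
    show "inj_on \<gamma>e {0..1}" using inj e by (simp add: inj_on_def)
    show "(\<gamma>e has_vector_derivative D 1 t) (at t within {0..1})" if "t \<in> {0..1}" for t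
      by (rule has_vector_derivative_transform[OF that e]) (use D[OF that, of 0] D0 in auto)
  qed (use L(1) M(1) upper lower tay e in simp_all)
qed

text \<open>Federer's inequality for sets of reach at least \<open>1 / (2 C)\<close>: a point \<open>z\<close> whose nearest point
  in \<open>K\<close> is \<open>x\<close> sees \<open>K\<close> bend towards it at most quadratically.\<close>

definition reach_bound :: "'a::real_inner set \<Rightarrow> real \<Rightarrow> bool" where
  "reach_bound K C \<longleftrightarrow> (\<forall>z. \<forall>x\<in>K. \<forall>y\<in>K. (\<forall>y'\<in>K. norm (z - x) \<le> norm (z - y')) \<longrightarrow>
      (y - x) \<bullet> (z - x) \<le> C * norm (z - x) * (norm (y - x))\<^sup>2)"

text \<open>The first derivative of the squared distance from \<open>z\<close> at a minimiser \<open>s\<close> is nonnegative in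
  every direction in which the parameter may move; at an end point of the arc only one sign of
  \<open>t - s\<close> occurs, so that interior points and end points are treated alike.\<close>

lemma nearest_point_first_order:
  fixes \<gamma> :: "real \<Rightarrow> complex"
  assumes d: "(\<gamma> has_vector_derivative v) (at s within {0..1})" and s: "s \<in> {0..1}" and t: "t \<in> {0..1}"
    and near: "\<And>t. t \<in> {0..1} \<Longrightarrow> cmod (z - \<gamma> s) \<le> cmod (z - \<gamma> t)"
  shows "(t - s) * (v \<bullet> (z - \<gamma> s)) \<le> 0"
proof (rule ccontr)
  assume "\<not> ?thesis"
  hence pos: "(t - s) * (v \<bullet> (z - \<gamma> s)) > 0" by simp
  hence ts: "t \<noteq> s" by auto
  \<comment> \<open>the squared distance along the segment of parameters from \<open>s\<close> to \<open>t\<close>\<close>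
  define h where "h = (\<lambda>\<tau>. (z - \<gamma> (s + \<tau> * (t - s))) \<bullet> (z - \<gamma> (s + \<tau> * (t - s))))"
  have in01: "s + \<tau> * (t - s) \<in> {0..1}" if "\<tau> \<in> {0..1}" for \<tau>
    using convexD_alt[of "{0..1::real}" s t \<tau>] s t that by (simp add: algebra_simps)
  have g: "((\<lambda>\<tau>. \<gamma> (s + \<tau> * (t - s))) has_vector_derivative (t - s) *\<^sub>R v) (at 0 within {0..1})"
  proof -
    have "((\<lambda>\<tau>. s + \<tau> * (t - s)) has_vector_derivative (t - s)) (at 0 within {0..1})"
      by (auto intro!: derivative_eq_intros simp: has_real_derivative_iff_has_vector_derivative[symmetric])
    moreover have "(\<gamma> has_vector_derivative v) (at (s + 0 * (t - s)) within (\<lambda>\<tau>. s + \<tau> * (t - s)) ` {0..1})"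
      using d in01 by (auto intro: has_vector_derivative_within_subset)
    ultimately show ?thesis using vector_diff_chain_within by (force simp: o_def)
  qed
  have "(h has_real_derivative - 2 * ((t - s) * (v \<bullet> (z - \<gamma> s)))) (at 0 within {0..1})"
  proof -
    have "((\<lambda>\<tau>. z - \<gamma> (s + \<tau> * (t - s))) has_derivative (\<lambda>\<tau>. - (\<tau> *\<^sub>R (t - s) *\<^sub>R v))) (at 0 within {0..1})"
      using has_derivative_diff[OF has_derivative_const g[unfolded has_vector_derivative_def], of z] by simp
    from has_derivative_inner[OF this this]
    show ?thesis unfolding h_def has_field_derivative_def
      by (rule has_derivative_eq_rhs) (auto simp: fun_eq_iff inner_commute algebra_simps)
  qed
  hence "\<exists>d>0. \<forall>\<tau>>0. 0 + \<tau> \<in> {0..1} \<longrightarrow> \<tau> < d \<longrightarrow> h 0 > h (0 + \<tau>)"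
    by (rule has_real_derivative_neg_dec_right) (use pos in simp)
  then obtain d where d: "d > 0" "\<And>\<tau>. 0 < \<tau> \<Longrightarrow> \<tau> \<in> {0..1} \<Longrightarrow> \<tau> < d \<Longrightarrow> h 0 > h \<tau>" by auto
  define \<tau> where "\<tau> = min 1 (d / 2)"
  have \<tau>: "0 < \<tau>" "\<tau> \<in> {0..1}" "\<tau> < d" using d(1) by (auto simp: \<tau>_def)
  have "(cmod (z - \<gamma> (s + \<tau> * (t - s))))\<^sup>2 < (cmod (z - \<gamma> s))\<^sup>2"
    using d(2)[OF \<tau>] by (simp add: h_def dot_square_norm)
  moreover have "(cmod (z - \<gamma> s))\<^sup>2 \<le> (cmod (z - \<gamma> (s + \<tau> * (t - s))))\<^sup>2"
    using near[OF in01[OF \<tau>(2)]] by (simp add: power_mono)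
  ultimately show False by simp
qed

text \<open>In \<open>y - x\<close> the first order part along the tangent pairs non-positively with \<open>z - x\<close> by the
  first order condition, and the remainder is quadratic in \<open>t - s\<close>, hence in \<open>|y - x|\<close>.\<close>

lemma smooth_nonclosed_curve_reach:
  assumes "smooth_nonclosed_curve K"
  obtains C where "C > 0" "reach_bound K C"
proof -
  from smooth_nonclosed_curve_parametrisation[OF assms] obtain \<gamma> \<gamma>' L M
    where K: "K = \<gamma> ` {0..1}" and L: "L \<ge> 1" and M: "M > 0"
    and d: "\<And>t. t \<in> {0..1} \<Longrightarrow> (\<gamma> has_vector_derivative \<gamma>' t) (at t within {0..1})"
    and inv: "\<And>s t. s \<in> {0..1} \<Longrightarrow> t \<in> {0..1} \<Longrightarrow> \<bar>s - t\<bar> \<le> L * cmod (\<gamma> s - \<gamma> t)"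
    and tay: "\<And>s t. s \<in> {0..1} \<Longrightarrow> t \<in> {0..1} \<Longrightarrow> cmod (\<gamma> t - \<gamma> s - (t - s) *\<^sub>R \<gamma>' s) \<le> M * (t - s)\<^sup>2"
    by metis
  have "reach_bound K (M * L\<^sup>2)" unfolding reach_bound_def
  proof (intro allI ballI impI)
    fix z x y assume x: "x \<in> K" and y: "y \<in> K" and near: "\<forall>y'\<in>K. cmod (z - x) \<le> cmod (z - y')"
    from x y obtain s t where s: "s \<in> {0..1}" "x = \<gamma> s" and t: "t \<in> {0..1}" "y = \<gamma> t" by (auto simp: K)
    have fo: "(t - s) * (\<gamma>' s \<bullet> (z - x)) \<le> 0"
      unfolding s(2) using near by (intro nearest_point_first_order[OF d[OF s(1)] s(1) t(1)]) (auto simp: K s(2))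
    have "(y - x) \<bullet> (z - x) = (y - x - (t - s) *\<^sub>R \<gamma>' s) \<bullet> (z - x) + (t - s) * (\<gamma>' s \<bullet> (z - x))"
      by (simp add: inner_diff_left)
    also have "\<dots> \<le> cmod (y - x - (t - s) *\<^sub>R \<gamma>' s) * cmod (z - x)"
      using fo norm_cauchy_schwarz[of "y - x - (t - s) *\<^sub>R \<gamma>' s" "z - x"] by simp
    also have "\<dots> \<le> M * (t - s)\<^sup>2 * cmod (z - x)"
      using tay[OF s(1) t(1)] s t by (intro mult_right_mono) auto
    also have "(t - s)\<^sup>2 \<le> (L * cmod (y - x))\<^sup>2"
      using inv[OF t(1) s(1)] s t by (metis abs_ge_zero power2_abs power_mono)
    finally show "(y - x) \<bullet> (z - x) \<le> M * L\<^sup>2 * cmod (z - x) * (cmod (y - x))\<^sup>2"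
      using M by (simp add: power_mult_distrib mult_ac mult_left_mono mult_right_mono)
  qed
  thus ?thesis using that[of "M * L\<^sup>2"] M L by simp
qed

lemma smooth_nonclosed_curve_topology:
  assumes "smooth_nonclosed_curve K"
  shows "compact K" "K \<noteq> {}" "connected (- K)" "negligible K"
proof -
  from smooth_nonclosed_curve_parametrisation[OF assms] obtain \<gamma> \<gamma>'
    where K: "K = \<gamma> ` {0..1}" and "continuous_on UNIV \<gamma>" and inj: "inj_on \<gamma> {0..1}"
    and d: "\<And>t. t \<in> {0..1} \<Longrightarrow> (\<gamma> has_vector_derivative \<gamma>' t) (at t within {0..1})"
    by metis
  hence cont: "continuous_on {0..1} \<gamma>" using continuous_on_subset by blast
  thus "compact K" "K \<noteq> {}" by (auto simp: K intro!: compact_continuous_image)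
  have "arc \<gamma>" using cont inj by (simp add: arc_def path_def)
  thus "connected (- K)"
    using connected_arc_complement[of \<gamma>] by (simp add: K path_image_def)
  have "\<gamma> differentiable_on {0..1}"
    unfolding differentiable_on_def by (blast intro: differentiableI_vector d)
  thus "negligible K" unfolding K by (intro negligible_differentiable_image_lowdim) auto
qed

section \<open>Circle means of logarithms\<close>

lemma circlepath_shift: "circlepath a s t - b = circlepath 0 s t - (b - a)"
  by (simp add: circlepath)

text \<open>Mean value property of the holomorphic function \<open>Ln (1 - u / c)\<close>, \<open>c = b - a\<close>, on the disc of
  radius \<open>s < |c|\<close>, where \<open>1 - u / c\<close> stays in the right half plane.\<close>

lemma has_integral_ln_circle_outside:
  assumes "s > 0" "s < cmod (a - b)"
  shows "((\<lambda>t. ln (cmod (circlepath a s t - b))) has_integral ln (cmod (a - b))) {0..1}"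
proof -
  define c where "c = b - a"
  have c: "s < cmod c" "c \<noteq> 0" using assms by (auto simp: c_def norm_minus_commute)
  have re: "Re (1 - u / c) > 0" if "cmod u \<le> s" for u
  proof -
    have "cmod (u / c) < 1" using that c by (simp add: norm_divide)
    thus ?thesis using abs_Re_le_cmod[of "u / c"] by simp
  qed
  have hol: "(\<lambda>u. Ln (1 - u / c)) holomorphic_on cball 0 s"
    using re c by (intro holomorphic_intros) (auto simp: complex_nonpos_Reals_iff not_le less_imp_le dest!: re)
  have "((\<lambda>u. Ln (1 - u / c) / (u - 0)) has_contour_integral 2 * of_real pi * \<i> * Ln (1 - 0 / c)) (circlepath 0 s)"
    by (rule Cauchy_integral_circlepath_simple[OF hol]) (use assms in simp)
  hence "((\<lambda>t. Ln (1 - circlepath 0 s t / c) / circlepath 0 s t * vector_derivative (circlepath 0 s) (at t))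
            has_integral 0) {0..1}"
    by (simp add: has_contour_integral)
  moreover have "Ln (1 - circlepath 0 s t / c) / circlepath 0 s t * vector_derivative (circlepath 0 s) (at t)
                   = 2 * of_real pi * \<i> * Ln (1 - circlepath 0 s t / c)" for t
    unfolding vector_derivative_circlepath using assms(1) by (simp add: circlepath)
  ultimately have "((\<lambda>t. 2 * of_real pi * \<i> * Ln (1 - circlepath 0 s t / c)) has_integral 0) {0..1}"
    by simp
  from has_integral_mult_right[OF this, of "1 / (2 * of_real pi * \<i>)"]
  have "((\<lambda>t. Ln (1 - circlepath 0 s t / c)) has_integral 0) {0..1}" by simp
  from has_integral_Re[OF this]
  have "((\<lambda>t. Re (Ln (1 - circlepath 0 s t / c)) + ln (cmod c)) has_integral (0 + ln (cmod c))) {0..1}"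
    using has_integral_const_real[of "ln (cmod c)" 0 1] by (intro has_integral_add) auto
  moreover have "Re (Ln (1 - circlepath 0 s t / c)) + ln (cmod c) = ln (cmod (circlepath a s t - b))" for t
  proof -
    have n: "cmod (circlepath 0 s t) \<le> s" using assms(1) by (simp add: circlepath norm_mult)
    hence nz: "1 - circlepath 0 s t / c \<noteq> 0" using re[OF n] by auto
    have "Re (Ln (1 - circlepath 0 s t / c)) + ln (cmod c) = ln (cmod (1 - circlepath 0 s t / c) * cmod c)"
      using nz c by (simp add: ln_mult)
    also have "cmod (1 - circlepath 0 s t / c) * cmod c = cmod (c - circlepath 0 s t)"
      using c by (simp add: norm_mult[symmetric] algebra_simps)
    finally show ?thesis by (simp add: circlepath_shift[of a s t b] c_def norm_minus_commute)
  qed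
  ultimately show ?thesis by (simp add: c_def norm_minus_commute)
qed

text \<open>Reflection in the circle reduces this to the case of an exterior point: for \<open>|e| = 1\<close> the
  number \<open>|s e - (b - a)|\<close> equals \<open>|c| |e - s / c|\<close> with \<open>c = cnj (b - a)\<close>, and \<open>|s / c| > 1\<close>.\<close>

lemma has_integral_ln_circle_inside:
  assumes "cmod (a - b) < s"
  shows "((\<lambda>t. ln (cmod (circlepath a s t - b))) has_integral ln s) {0..1}"
proof (cases "a = b")
  case True
  have s: "s > 0" using assms by (smt (verit) norm_ge_zero)
  show ?thesis using True s has_integral_const_real[of "ln s" 0 1] by (simp add: circlepath norm_mult)
next
  case False
  have s: "s > 0" using assms by (smt (verit) norm_ge_zero)
  define c where "c = cnj (b - a)"
  have c: "c \<noteq> 0" "cmod c < s" using False assms by (auto simp: c_def norm_minus_commute simp del: complex_cnj_diff)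
  have "((\<lambda>t. ln (cmod (circlepath 0 1 t - of_real s / c)) + ln (cmod c)) has_integral
          (ln (cmod (0 - of_real s / c)) + ln (cmod c))) {0..1}"
    using has_integral_const_real[of "ln (cmod c)" 0 1] c s
    by (intro has_integral_add has_integral_ln_circle_outside) (auto simp: norm_divide)
  moreover have "ln (cmod (0 - of_real s / c)) + ln (cmod c) = ln s"
    using c s by (simp add: norm_divide ln_div)
  moreover have "ln (cmod (circlepath 0 1 t - of_real s / c)) + ln (cmod c) = ln (cmod (circlepath a s t - b))" for t
  proof -
    define e where "e = circlepath 0 1 t"
    have e: "cmod e = 1" by (simp add: e_def circlepath)
    hence ee: "cnj e * e = 1" by (simp add: complex_norm_square[symmetric] mult.commute)
    have "e - of_real s / c \<noteq> 0"
    proof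
      assume "e - of_real s / c = 0"
      hence "cmod e = s / cmod c" using s by (simp add: norm_divide)
      thus False using e c by (simp add: field_simps)
    qed
    hence "ln (cmod (e - of_real s / c)) + ln (cmod c) = ln (cmod ((e - of_real s / c) * c))"
      using c by (simp add: norm_mult ln_mult)
    also have "(e - of_real s / c) * c = e * c - of_real s" using c by (simp add: algebra_simps)
    also have "cmod (e * c - of_real s) = cmod (cnj (e * c - of_real s))" by (simp only: complex_mod_cnj)
    also have "cnj (e * c - of_real s) = cnj e * (b - a - of_real s * e)"
      using ee by (simp add: c_def algebra_simps)
    also have "cmod \<dots> = cmod (b - a - of_real s * e)" using e by (simp add: norm_mult)
    also have "b - a - of_real s * e = - (circlepath a s t - b)" by (simp add: e_def circlepath)
    also have "cmod (- (circlepath a s t - b)) = cmod (circlepath a s t - b)" by (rule norm_minus_cancel)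
    finally show ?thesis by (simp add: e_def)
  qed
  ultimately show ?thesis by simp
qed

lemma has_integral_ln_circle:
  assumes "s > 0" "cmod (a - b) \<noteq> s"
  shows "((\<lambda>t. ln (cmod (circlepath a s t - b))) has_integral ln (max s (cmod (a - b)))) {0..1}"
  using assms has_integral_ln_circle_inside[of a b s] has_integral_ln_circle_outside[of s a b]
  by (auto simp: max_def not_le not_less)

lemma ln_norm_poly_eq:
  fixes Q :: "complex poly"
  assumes "lead_coeff Q = 1" "poly Q z \<noteq> 0"
  shows "ln (cmod (poly Q z)) = (\<Sum>b\<in>#proots Q. ln (cmod (z - b)))"
proof -
  have Q: "Q \<noteq> 0" using assms(2) by auto
  have "poly Q z = poly (\<Prod>b\<in>#proots Q. [:- b, 1:]) z"
    using complex_poly_decompose_multiset[of Q] assms(1) by simp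
  also have "\<dots> = (\<Prod>b\<in>#proots Q. z - b)" by (simp add: poly_prod_mset multiset.map_comp o_def)
  finally have e: "poly Q z = (\<Prod>b\<in>#proots Q. z - b)" .
  have "ln (cmod (\<Prod>b\<in>#M. z - b)) = (\<Sum>b\<in>#M. ln (cmod (z - b)))" if "z \<notin># M" for M
    using that
  proof (induction M)
    case (add b M)
    hence "z - b \<noteq> 0" "(\<Prod>b\<in>#M. z - b) \<noteq> 0" by auto
    thus ?case using add by (simp add: norm_mult ln_mult)
  qed simp
  thus ?thesis using assms(2) Q by (simp add: e)
qed

text \<open>By Jensen's formula this is the mean of \<open>ln |Q|\<close>, for monic \<open>Q\<close>, over the circle of centre
  \<open>a\<close> and radius \<open>s\<close>.\<close>

definition jensen_mean :: "complex poly \<Rightarrow> complex \<Rightarrow> real \<Rightarrow> real" where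
  "jensen_mean Q a s = (\<Sum>b\<in>#proots Q. ln (max s (cmod (a - b))))"

lemma has_integral_ln_poly_circle:
  fixes Q :: "complex poly"
  assumes "lead_coeff Q = 1" "s > 0" and nr: "\<And>b. poly Q b = 0 \<Longrightarrow> cmod (a - b) \<noteq> s"
  shows "((\<lambda>t. ln (cmod (poly Q (circlepath a s t)))) has_integral
           jensen_mean Q a s) {0..1}"
proof -
  have Q: "Q \<noteq> 0" using assms(1) by auto
  have "((\<lambda>t. \<Sum>b\<in>#M. ln (cmod (circlepath a s t - b))) has_integral
           (\<Sum>b\<in>#M. ln (max s (cmod (a - b))))) {0..1}" if "\<And>b. b \<in># M \<Longrightarrow> cmod (a - b) \<noteq> s" for M
    using that
  proof (induction M)
    case (add b M)
    thus ?case using has_integral_add[OF has_integral_ln_circle[OF assms(2), of a b] add.IH] by simp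
  qed simp
  from this[of "proots Q"]
  have "((\<lambda>t. \<Sum>b\<in>#proots Q. ln (cmod (circlepath a s t - b))) has_integral
           (\<Sum>b\<in>#proots Q. ln (max s (cmod (a - b))))) {0..1}" using nr Q by simp
  moreover have "ln (cmod (poly Q (circlepath a s t))) = (\<Sum>b\<in>#proots Q. ln (cmod (circlepath a s t - b)))" for t
    using nr[of "circlepath a s t"] assms(2)
    by (intro ln_norm_poly_eq assms) (auto simp: circlepath norm_mult)
  ultimately show ?thesis by (simp add: jensen_mean_def)
qed

lemma ln_norm_poly_le_circle_mean:
  fixes Q :: "complex poly"
  assumes "lead_coeff Q = 1" "poly Q a \<noteq> 0" "s > 0"
  shows "ln (cmod (poly Q a)) \<le> jensen_mean Q a s"
proof -
  have Q: "Q \<noteq> 0" using assms(1) by auto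
  show ?thesis unfolding ln_norm_poly_eq[OF assms(1,2)] jensen_mean_def
    using assms(2,3) Q by (intro sum_mset_mono ln_mono) auto
qed

lemma degree_ln_le_circle_mean:
  fixes Q :: "complex poly"
  assumes "s > 0"
  shows "degree Q * ln s \<le> jensen_mean Q a s"
proof -
  have "(\<Sum>b\<in>#proots Q. ln s) \<le> jensen_mean Q a s"
    unfolding jensen_mean_def using assms by (intro sum_mset_mono ln_mono) auto
  thus ?thesis by (simp add: size_proots_complex)
qed

text \<open>The logarithmic potential as a real number. It agrees with \<open>log_potential\<close> where the
  logarithm is integrable and \<open>\<mu>\<close> has no atom at \<open>z\<close>; both hold everywhere for the measures
  considered here.\<close>

definition rpot :: "complex measure \<Rightarrow> complex \<Rightarrow> real" where
  "rpot \<mu> z = (\<integral>a. ln (cmod (z - a)) \<partial>\<mu>)"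

text \<open>Fubini for the logarithmic kernel, which is bounded on a circle that stays away from \<open>K\<close>.\<close>

lemma has_integral_rpot_circle:
  assumes "prob_space \<mu>" and sets: "sets \<mu> = sets borel" and K: "closed K" "bounded K" and AE: "AE a in \<mu>. a \<in> K"
    and [measurable]: "g \<in> borel_measurable borel"
    and e: "e > 0" "\<And>t b. b \<in> K \<Longrightarrow> e \<le> cmod (circlepath a s t - b)"
    and g: "\<And>b. b \<in> K \<Longrightarrow> ((\<lambda>t. ln (cmod (circlepath a s t - b))) has_integral g b) {0..1}"
  shows "((\<lambda>t. rpot \<mu> (circlepath a s t)) has_integral (\<integral>b. g b \<partial>\<mu>)) {0..1}"
proof -
  interpret prob_space \<mu> by fact
  note [measurable_cong] = sets
  have [measurable]: "K \<in> sets borel" using K by simp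
  have [measurable]: "circlepath a s \<in> borel_measurable borel"
    by (intro borel_measurable_continuous_onI) (auto simp: circlepath intro!: continuous_intros)
  obtain B0 where B0: "\<And>b. b \<in> K \<Longrightarrow> cmod b \<le> B0" using K(2) by (auto simp: bounded_iff)
  define B where "B = \<bar>ln e\<bar> + \<bar>ln (cmod a + \<bar>s\<bar> + \<bar>B0\<bar> + 1)\<bar>"
  \<comment> \<open>cut off to \<open>K\<close>, the integrand is bounded everywhere and not only almost everywhere\<close>
  define f where "f = (\<lambda>(t, b). indicator {0..1} t * (indicator K b * ln (cmod (circlepath a s t - b))))"
  have fm [measurable]: "f \<in> borel_measurable (lborel \<Otimes>\<^sub>M \<mu>)" unfolding f_def by measurable
  have bd: "\<bar>ln (cmod (circlepath a s t - b))\<bar> \<le> B" if b: "b \<in> K" for t b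
  proof -
    have l: "ln e \<le> ln (cmod (circlepath a s t - b))" using e(2)[OF b, of t] e(1) by (intro ln_mono) auto
    have pos: "0 < cmod (circlepath a s t - b)" using e(2)[OF b, of t] e(1) by linarith
    have "cmod (circlepath a s t - b) \<le> cmod a + \<bar>s\<bar> + \<bar>B0\<bar> + 1"
    proof -
      have "cmod (circlepath a s t) \<le> cmod a + \<bar>s\<bar>"
        unfolding circlepath by (rule order.trans[OF norm_triangle_ineq]) (simp add: norm_mult)
      thus ?thesis using norm_triangle_ineq4[of "circlepath a s t" b] B0[OF b] by linarith
    qed
    hence u: "ln (cmod (circlepath a s t - b)) \<le> ln (cmod a + \<bar>s\<bar> + \<bar>B0\<bar> + 1)"
      using pos by (intro ln_mono) auto
    show ?thesis unfolding B_def using l u by linarith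
  qed
  interpret pair_sigma_finite lborel \<mu> ..
  have "emeasure (lborel \<Otimes>\<^sub>M \<mu>) ({0..1::real} \<times> space \<mu>) = emeasure lborel {0..1::real} * emeasure \<mu> (space \<mu>)"
    by (rule sigma_finite_measure.emeasure_pair_measure_Times[OF prob_space_imp_sigma_finite[OF assms(1)]]) auto
  hence "emeasure (lborel \<Otimes>\<^sub>M \<mu>) ({0..1::real} \<times> space \<mu>) < \<infinity>" by (simp add: emeasure_space_1)
  hence "integrable (lborel \<Otimes>\<^sub>M \<mu>) (\<lambda>x. B * indicator ({0..1::real} \<times> space \<mu>) x)"
    by (intro integrable_mult_right integrable_real_indicator) auto
  hence int: "integrable (lborel \<Otimes>\<^sub>M \<mu>) f"
  proof (rule Bochner_Integration.integrable_bound)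
    show "AE x in lborel \<Otimes>\<^sub>M \<mu>. norm (f x) \<le> norm (B * indicator ({0..1::real} \<times> space \<mu>) x)"
    proof (rule AE_I2)
      fix x :: "real \<times> complex" assume "x \<in> space (lborel \<Otimes>\<^sub>M \<mu>)"
      hence "snd x \<in> space \<mu>" by (auto simp: space_pair_measure)
      thus "norm (f x) \<le> norm (B * indicator ({0..1::real} \<times> space \<mu>) x)"
        using bd[of "snd x" "fst x"] by (auto simp: f_def indicator_def split: prod.splits)
    qed
  qed measurable
  have U: "rpot \<mu> z = (\<integral>b. indicator K b * ln (cmod (z - b)) \<partial>\<mu>)" for z
  proof -
    have [measurable]: "(\<lambda>b. indicator K b * ln (cmod (z - b))) \<in> borel_measurable \<mu>"
      "(\<lambda>b. ln (cmod (z - b))) \<in> borel_measurable \<mu>" by measurable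
    show ?thesis unfolding rpot_def using AE by (intro integral_cong_AE) auto
  qed
  have 1: "integrable lborel (\<lambda>t. \<integral>b. f (t, b) \<partial>\<mu>)" using integrable_fst[of "\<lambda>t b. f (t, b)"] int by simp
  have 2: "(\<lambda>t. \<integral>b. f (t, b) \<partial>\<mu>) = (\<lambda>t. if t \<in> {0..1} then rpot \<mu> (circlepath a s t) else 0)"
    by (auto simp: f_def U fun_eq_iff indicator_def)
  have 3: "(\<integral>t. f (t, b) \<partial>lborel) = g b" if "b \<in> K" for b
  proof -
    have "integrable lborel (\<lambda>t. f (t, b))"
    proof (rule Bochner_Integration.integrable_bound)
      show "integrable lborel (\<lambda>t. B * indicator {0..1::real} t)" by simp
      show "AE t in lborel. norm (f (t, b)) \<le> norm (B * indicator {0..1::real} t)"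
      proof (rule AE_I2)
        fix t :: real
        have "B \<ge> 0" by (simp add: B_def)
        thus "norm (f (t, b)) \<le> norm (B * indicator {0..1::real} t)"
          using bd[OF that, of t] that by (auto simp: f_def indicator_def)
      qed
      show "(\<lambda>t. f (t, b)) \<in> borel_measurable lborel" unfolding f_def split by measurable
    qed
    from has_integral_integral_lborel[OF this]
    have "((\<lambda>t. if t \<in> {0..1} then ln (cmod (circlepath a s t - b)) else 0) has_integral (\<integral>t. f (t, b) \<partial>lborel)) UNIV"
      by (rule has_integral_eq[rotated]) (use that in \<open>auto simp: f_def\<close>)
    hence "((\<lambda>t. ln (cmod (circlepath a s t - b))) has_integral (\<integral>t. f (t, b) \<partial>lborel)) {0..1}"
      by (simp only: has_integral_restrict_UNIV)
    thus ?thesis using g[OF that] by (rule has_integral_unique)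
  qed
  have "((\<lambda>t. if t \<in> {0..1} then rpot \<mu> (circlepath a s t) else 0) has_integral (\<integral>t. (\<integral>b. f (t, b) \<partial>\<mu>) \<partial>lborel)) UNIV"
    using has_integral_integral_lborel[OF 1] unfolding 2 .
  also have "(\<integral>t. (\<integral>b. f (t, b) \<partial>\<mu>) \<partial>lborel) = (\<integral>b. (\<integral>t. f (t, b) \<partial>lborel) \<partial>\<mu>)"
    by (rule Fubini_integral[of "\<lambda>t b. f (t, b)", symmetric]) (use int in simp)
  also have "\<dots> = (\<integral>b. g b \<partial>\<mu>)"
  proof -
    have "(\<lambda>b. \<integral>t. f (t, b) \<partial>lborel) \<in> borel_measurable \<mu>" "g \<in> borel_measurable \<mu>" by measurable
    thus ?thesis using 3 AE by (intro integral_cong_AE) auto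
  qed
  finally show ?thesis by (simp only: has_integral_restrict_UNIV)
qed

section \<open>Averaging over circles\<close>

definition circle_mean :: "(complex \<Rightarrow> ennreal) \<Rightarrow> complex \<Rightarrow> real \<Rightarrow> ennreal" where
  "circle_mean v a s = (\<integral>\<^sup>+t\<in>{0..1}. v (circlepath a s t) \<partial>lborel)"

text \<open>The density at \<open>z\<close> that results when circles of centre \<open>a\<close> and radius \<open>s\<close> are superposed with
  weight \<open>k a s\<close>: the centres of the circles of radius \<open>s\<close> through \<open>z\<close> are the points
  \<open>z - circlepath 0 s t\<close>.\<close>

definition circle_weight :: "(complex \<Rightarrow> real \<Rightarrow> ennreal) \<Rightarrow> complex \<Rightarrow> ennreal" where
  "circle_weight k z = (\<integral>\<^sup>+s. (\<integral>\<^sup>+t\<in>{0..1}. k (z - circlepath 0 s t) s \<partial>lborel) \<partial>lborel)"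

lemma borel_measurable_circlepath [measurable]:
  assumes [measurable]: "f \<in> borel_measurable M" "g \<in> borel_measurable M" "h \<in> borel_measurable M"
  shows "(\<lambda>x. circlepath (f x) (g x) (h x)) \<in> borel_measurable M"
proof -
  have [measurable]: "(exp :: complex \<Rightarrow> complex) \<in> borel_measurable borel"
    by (intro borel_measurable_continuous_onI continuous_intros)
  show ?thesis unfolding circlepath by measurable
qed

lemma borel_measurable_infdist [measurable]:
  fixes K :: "complex set"
  assumes "f \<in> borel_measurable M"
  shows "(\<lambda>x. infdist (f x) K) \<in> borel_measurable M"
  by (rule borel_measurable_continuous_on[OF _ assms]) (intro continuous_intros)

text \<open>Tonelli's theorem and, for fixed \<open>s\<close> and \<open>t\<close>, translation of the centre. Integrating over the
  centres as well turns circle means into area integrals without a change to polar coordinates.\<close>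

lemma nn_integral_circle_mean_swap:
  fixes v :: "complex \<Rightarrow> ennreal"
  assumes [measurable]: "v \<in> borel_measurable borel"
    and [measurable]: "(\<lambda>(a, s). k a s) \<in> borel_measurable (borel \<Otimes>\<^sub>M borel)"
  shows "(\<integral>\<^sup>+a. \<integral>\<^sup>+s. k a s * circle_mean v a s \<partial>lborel \<partial>lborel) =
    (\<integral>\<^sup>+z. v z * circle_weight k z \<partial>lborel)"
proof -
  have [measurable]: "(\<lambda>x. k (f x) (g x)) \<in> borel_measurable M"
    if [measurable]: "f \<in> borel_measurable M" "g \<in> borel_measurable M" for f g and M :: "'a measure"
    using measurable_compose[OF measurable_Pair[OF that] assms(2)] by simp
  have shift: "(\<integral>\<^sup>+a. f a \<partial>lborel) = (\<integral>\<^sup>+z. f (z - c) \<partial>lborel)"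
    if [measurable]: "f \<in> borel_measurable borel" for f :: "complex \<Rightarrow> ennreal" and c
  proof -
    have "(\<integral>\<^sup>+a. f a \<partial>lborel) = (\<integral>\<^sup>+a. f a \<partial>distr lborel borel ((+) (- c)))"
      by (simp add: lborel_distr_plus)
    also have "\<dots> = (\<integral>\<^sup>+z. f (z - c) \<partial>lborel)" by (subst nn_integral_distr) auto
    finally show ?thesis .
  qed
  have cp: "circlepath (z - circlepath 0 s t) s t = z" for z s t by (simp add: circlepath)
  have "(\<integral>\<^sup>+a. \<integral>\<^sup>+s. k a s * circle_mean v a s \<partial>lborel \<partial>lborel) =
        (\<integral>\<^sup>+a. \<integral>\<^sup>+s. \<integral>\<^sup>+t. k a s * (v (circlepath a s t) * indicator {0..1} t) \<partial>lborel \<partial>lborel \<partial>lborel)"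
    unfolding circle_mean_def by (intro nn_integral_cong nn_integral_cmult[symmetric]) measurable
  also have "\<dots> = (\<integral>\<^sup>+s. \<integral>\<^sup>+a. \<integral>\<^sup>+t. k a s * (v (circlepath a s t) * indicator {0..1} t) \<partial>lborel \<partial>lborel \<partial>lborel)"
    by (rule lborel_pair.Fubini'[symmetric]) measurable
  also have "\<dots> = (\<integral>\<^sup>+s. \<integral>\<^sup>+t. \<integral>\<^sup>+a. k a s * (v (circlepath a s t) * indicator {0..1} t) \<partial>lborel \<partial>lborel \<partial>lborel)"
    by (intro nn_integral_cong lborel_pair.Fubini'[symmetric]) measurable
  also have "\<dots> = (\<integral>\<^sup>+s. \<integral>\<^sup>+t. \<integral>\<^sup>+z. k (z - circlepath 0 s t) s * (v z * indicator {0..1} t) \<partial>lborel \<partial>lborel \<partial>lborel)"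
  proof (rule nn_integral_cong, rule nn_integral_cong)
    fix s t :: real
    show "(\<integral>\<^sup>+a. k a s * (v (circlepath a s t) * indicator {0..1} t) \<partial>lborel) =
          (\<integral>\<^sup>+z. k (z - circlepath 0 s t) s * (v z * indicator {0..1} t) \<partial>lborel)"
      using shift[of "\<lambda>a. k a s * (v (circlepath a s t) * indicator {0..1} t)" "circlepath 0 s t"]
      by (simp add: cp)
  qed
  also have "\<dots> = (\<integral>\<^sup>+s. \<integral>\<^sup>+z. \<integral>\<^sup>+t. k (z - circlepath 0 s t) s * (v z * indicator {0..1} t) \<partial>lborel \<partial>lborel \<partial>lborel)"
    by (intro nn_integral_cong lborel_pair.Fubini'[symmetric]) measurable
  also have "\<dots> = (\<integral>\<^sup>+z. \<integral>\<^sup>+s. \<integral>\<^sup>+t. k (z - circlepath 0 s t) s * (v z * indicator {0..1} t) \<partial>lborel \<partial>lborel \<partial>lborel)"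
    by (rule lborel_pair.Fubini') measurable
  also have "\<dots> = (\<integral>\<^sup>+z. v z * circle_weight k z \<partial>lborel)"
    unfolding circle_weight_def by (simp add: nn_integral_cmult[symmetric] mult_ac)
  finally show ?thesis .
qed

lemma nn_integral_circle_mean_bound:
  fixes v :: "complex \<Rightarrow> ennreal"
  assumes [measurable]: "v \<in> borel_measurable borel" "m \<in> borel_measurable borel"
    and [measurable]: "(\<lambda>(a, s). k a s) \<in> borel_measurable (borel \<Otimes>\<^sub>M borel)"
    and "AE a in lborel. AE s in lborel. k a s \<noteq> 0 \<longrightarrow> circle_mean v a s \<le> m a"
  shows "(\<integral>\<^sup>+z. v z * circle_weight k z \<partial>lborel) \<le>
         (\<integral>\<^sup>+a. m a * (\<integral>\<^sup>+s. k a s \<partial>lborel) \<partial>lborel)"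
proof -
  have "(\<integral>\<^sup>+a. \<integral>\<^sup>+s. k a s * circle_mean v a s \<partial>lborel \<partial>lborel) \<le> (\<integral>\<^sup>+a. \<integral>\<^sup>+s. k a s * m a \<partial>lborel \<partial>lborel)"
  proof (rule nn_integral_mono_AE, rule eventually_mono[OF assms(4)])
    fix a assume a: "AE s in lborel. k a s \<noteq> 0 \<longrightarrow> circle_mean v a s \<le> m a"
    show "(\<integral>\<^sup>+s. k a s * circle_mean v a s \<partial>lborel) \<le> (\<integral>\<^sup>+s. k a s * m a \<partial>lborel)"
    proof (rule nn_integral_mono_AE, rule eventually_mono[OF a])
      fix s assume "k a s \<noteq> 0 \<longrightarrow> circle_mean v a s \<le> m a"
      thus "k a s * circle_mean v a s \<le> k a s * m a" by (cases "k a s = 0") (auto intro: mult_left_mono)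
    qed
  qed
  also have "\<dots> = (\<integral>\<^sup>+a. m a * (\<integral>\<^sup>+s. k a s \<partial>lborel) \<partial>lborel)"
  proof (intro nn_integral_cong)
    fix a :: complex
    have "(\<lambda>s. k a s) \<in> borel_measurable borel"
      using measurable_compose[OF measurable_Pair1' assms(3), of a] by simp
    thus "(\<integral>\<^sup>+s. k a s * m a \<partial>lborel) = m a * (\<integral>\<^sup>+s. k a s \<partial>lborel)"
      by (subst mult.commute, subst nn_integral_cmult[symmetric]) (auto simp: mult.commute)
  qed
  finally show ?thesis by (simp add: nn_integral_circle_mean_swap)
qed

text \<open>Within distance \<open>l\<close> of the singularity, either side contributes \<open>2 * sqrt l\<close>; farther away
  the integrand is at most \<open>1 / sqrt l\<close>.\<close>

lemma nn_integral_inverse_sqrt_dist: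
  fixes s c l :: real
  assumes l: "l > 0"
  shows "(\<integral>\<^sup>+t\<in>{c..c+l}. ennreal (\<bar>t - s\<bar> powr (- 1 / 2)) \<partial>lborel) \<le> ennreal (5 * sqrt l)"
proof -
  define g where "g = (\<lambda>x. ennreal (x powr (- 1 / 2)) * indicator {0..l} x)"
  have [measurable]: "g \<in> borel_measurable borel" unfolding g_def by measurable
  have g: "(\<integral>\<^sup>+x. g x \<partial>lborel) = ennreal (2 * sqrt l)"
  proof -
    have "(\<integral>\<^sup>+x\<in>{0..l}. ennreal (x powr (- 1 / 2)) \<partial>lborel) = ennreal (l powr (- 1 / 2 + 1) / (- 1 / 2 + 1))"
      by (rule nn_integral_has_integral_lebesgue'[OF _ has_integral_powr_from_0]) (use l in auto)
    thus ?thesis using l by (simp add: powr_half_sqrt g_def)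
  qed
  have g1: "(\<integral>\<^sup>+t. g (t - s) \<partial>lborel) = ennreal (2 * sqrt l)"
    using nn_integral_real_affine[of g 1 "- s"] g by simp
  have g2: "(\<integral>\<^sup>+t. g (s - t) \<partial>lborel) = ennreal (2 * sqrt l)"
    using nn_integral_real_affine[of g "-1" s] g by simp
  have "(\<integral>\<^sup>+t\<in>{c..c+l}. ennreal (\<bar>t - s\<bar> powr (- 1 / 2)) \<partial>lborel) \<le>
        (\<integral>\<^sup>+t. g (t - s) + (g (s - t) + ennreal (1 / sqrt l) * indicator {c..c+l} t) \<partial>lborel)"
  proof (rule nn_integral_mono)
    fix t :: real
    consider "t \<ge> s" "t - s \<le> l" | "t \<le> s" "s - t \<le> l" | "\<bar>t - s\<bar> > l" by linarith
    thus "ennreal (\<bar>t - s\<bar> powr (- 1 / 2)) * indicator {c..c+l} t \<le>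
      g (t - s) + (g (s - t) + ennreal (1 / sqrt l) * indicator {c..c+l} t)"
    proof cases
      case 1
      have "ennreal (\<bar>t - s\<bar> powr (- 1 / 2)) * indicator {c..c+l} t \<le> g (t - s)"
        using 1 by (auto simp: g_def indicator_def)
      thus ?thesis by (rule order.trans) (simp add: add_increasing2)
    next
      case 2
      have "ennreal (\<bar>t - s\<bar> powr (- 1 / 2)) * indicator {c..c+l} t \<le> g (s - t)"
        using 2 by (auto simp: g_def indicator_def)
      thus ?thesis by (rule order.trans) (simp add: add_increasing add_increasing2)
    next
      case 3
      have "\<bar>t - s\<bar> powr (- 1 / 2) \<le> l powr (- 1 / 2)" using 3 l by (intro powr_mono2') auto
      also have "l powr (- 1 / 2) = 1 / sqrt l" using l by (simp add: powr_minus_divide powr_half_sqrt)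
      finally have "ennreal (\<bar>t - s\<bar> powr (- 1 / 2)) * indicator {c..c+l} t \<le> ennreal (1 / sqrt l) * indicator {c..c+l} t"
        by (intro mult_right_mono ennreal_leI) auto
      thus ?thesis by (rule order.trans) (simp add: add_increasing)
    qed
  qed
  also have "\<dots> = ennreal (2 * sqrt l) + (ennreal (2 * sqrt l) + ennreal (1 / sqrt l) * ennreal l)"
  proof -
    have "(\<integral>\<^sup>+t. g (s - t) + ennreal (1 / sqrt l) * indicator {c..c+l} t \<partial>lborel) =
        (\<integral>\<^sup>+t. g (s - t) \<partial>lborel) + (\<integral>\<^sup>+t. ennreal (1 / sqrt l) * indicator {c..c+l} t \<partial>lborel)"
      by (rule nn_integral_add) measurable
    moreover have "(\<integral>\<^sup>+t. ennreal (1 / sqrt l) * indicator {c..c+l} t \<partial>lborel) = ennreal (1 / sqrt l) * ennreal l"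
      using l by (subst nn_integral_cmult_indicator) auto
    moreover have "(\<integral>\<^sup>+t. g (t - s) + (g (s - t) + ennreal (1 / sqrt l) * indicator {c..c+l} t) \<partial>lborel) =
        (\<integral>\<^sup>+t. g (t - s) \<partial>lborel) + (\<integral>\<^sup>+t. g (s - t) + ennreal (1 / sqrt l) * indicator {c..c+l} t \<partial>lborel)"
      by (rule nn_integral_add) measurable
    ultimately show ?thesis by (simp only: g1 g2)
  qed
  also have "\<dots> = ennreal (2 * sqrt l + (2 * sqrt l + (1 / sqrt l) * l))"
    using l by (simp add: ennreal_mult[symmetric] ennreal_plus[symmetric] del: ennreal_plus)
  also have "2 * sqrt l + (2 * sqrt l + (1 / sqrt l) * l) = 5 * sqrt l"
    using l by (simp add: field_simps)
  finally show ?thesis .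
qed

text \<open>Among the angles, parametrised by \<open>{0..1}\<close>, a whole interval of length \<open>\<tau>\<close> points nearly in
  the direction \<open>u\<close>. A one-sided interval is used because a symmetric one could leave \<open>{0..1}\<close>.\<close>

lemma circle_window:
  assumes u: "cmod u = 1" and \<tau>: "0 \<le> \<tau>" "\<tau> \<le> 1 / 2"
  obtains t\<^sub>1 where "{t\<^sub>1..t\<^sub>1 + \<tau>} \<subseteq> {0..1}"
    "\<And>s t. t \<in> {t\<^sub>1..t\<^sub>1 + \<tau>} \<Longrightarrow> s \<ge> 0 \<Longrightarrow> cmod (circlepath 0 s t - of_real s * u) \<le> s * (2 * pi * \<tau>)"
proof -
  have "u \<in> path_image (circlepath 0 1)" using u by (simp add: path_image_circlepath)
  then obtain t0 where t0: "t0 \<in> {0..1}" "u = circlepath 0 1 t0" by (auto simp: path_image_def)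
  define t1 where "t1 = (if t0 \<le> 1 / 2 then t0 else t0 - \<tau>)"
  have near: "cmod (circlepath 0 s t - of_real s * u) \<le> s * (2 * pi * \<tau>)" if "\<bar>t - t0\<bar> \<le> \<tau>" "s \<ge> 0" for s t
  proof -
    have "circlepath 0 s t - of_real s * u = of_real s * (iexp (2 * pi * t0) * (iexp (2 * pi * (t - t0)) - 1))"
      by (simp add: t0(2) circlepath exp_add[symmetric] algebra_simps)
    hence "cmod (circlepath 0 s t - of_real s * u) = s * cmod (iexp (2 * pi * (t - t0)) - 1)"
      using that(2) by (simp add: norm_mult)
    also have "cmod (iexp (2 * pi * (t - t0)) - 1) = 2 * \<bar>sin (2 * pi * (t - t0) / 2)\<bar>"
      by (rule dist_exp_i_1)
    also have "\<dots> \<le> 2 * \<bar>2 * pi * (t - t0) / 2\<bar>" by (intro mult_left_mono abs_sin_x_le_abs_x) auto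
    also have "\<dots> = 2 * pi * \<bar>t - t0\<bar>" by (simp add: abs_mult)
    also have "\<dots> \<le> 2 * pi * \<tau>" using that by (intro mult_left_mono) auto
    finally show ?thesis using that(2) by (simp add: mult_left_mono)
  qed
  show ?thesis
    by (rule that[of t1]) (use t0(1) \<tau> in \<open>auto simp: t1_def split: if_splits intro!: near\<close>)
qed

lemma window_weight_bound:
  fixes k :: "complex \<Rightarrow> real \<Rightarrow> ennreal"
  assumes "s\<^sub>1 \<le> s\<^sub>2" "0 \<le> \<tau>" "{t\<^sub>1..t\<^sub>1 + \<tau>} \<subseteq> {0..1}"
    and "\<And>s t. s \<in> {s\<^sub>1..s\<^sub>2} \<Longrightarrow> t \<in> {t\<^sub>1..t\<^sub>1 + \<tau>} \<Longrightarrow> c \<le> k (z - circlepath 0 s t) s"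
  shows "c * ennreal ((s\<^sub>2 - s\<^sub>1) * \<tau>) \<le> circle_weight k z"
proof -
  have "c * ennreal ((s\<^sub>2 - s\<^sub>1) * \<tau>) = (\<integral>\<^sup>+s. c * ennreal \<tau> * indicator {s\<^sub>1..s\<^sub>2} s \<partial>lborel)"
    using assms(1,2) by (subst nn_integral_cmult_indicator) (auto simp: ennreal_mult mult_ac)
  also have "\<dots> \<le> (\<integral>\<^sup>+s. (\<integral>\<^sup>+t\<in>{0..1}. k (z - circlepath 0 s t) s \<partial>lborel) \<partial>lborel)"
  proof (rule nn_integral_mono)
    fix s :: real
    show "c * ennreal \<tau> * indicator {s\<^sub>1..s\<^sub>2} s \<le> (\<integral>\<^sup>+t\<in>{0..1}. k (z - circlepath 0 s t) s \<partial>lborel)"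
    proof (cases "s \<in> {s\<^sub>1..s\<^sub>2}")
      case True
      have "c * ennreal \<tau> = (\<integral>\<^sup>+t. c * indicator {t\<^sub>1..t\<^sub>1 + \<tau>} t \<partial>lborel)"
        using assms(2) by (subst nn_integral_cmult_indicator) auto
      also have "\<dots> \<le> (\<integral>\<^sup>+t\<in>{0..1}. k (z - circlepath 0 s t) s \<partial>lborel)"
      proof (rule nn_integral_mono)
        fix t :: real
        show "c * indicator {t\<^sub>1..t\<^sub>1 + \<tau>} t \<le> k (z - circlepath 0 s t) s * indicator {0..1} t"
          using assms(4)[OF True, of t] assms(3) by (cases "t \<in> {t\<^sub>1..t\<^sub>1 + \<tau>}") auto
      qed
      finally show ?thesis using True by simp
    qed simp
  qed
  finally show ?thesis unfolding circle_weight_def .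
qed

lemma ennreal_divide_leI:
  assumes c: "c > 0" and C: "C \<ge> 0" and le: "ennreal c * x \<le> ennreal C * y"
  shows "x \<le> ennreal (C / c) * y"
proof -
  have "x = ennreal (1 / c) * (ennreal c * x)"
    using c by (simp add: mult.assoc[symmetric] ennreal_mult[symmetric])
  also have "\<dots> \<le> ennreal (1 / c) * (ennreal C * y)" by (rule mult_left_mono[OF le]) simp
  also have "\<dots> = ennreal (C / c) * y"
    using c C by (simp add: mult.assoc[symmetric] ennreal_mult[symmetric])
  finally show ?thesis .
qed

text \<open>What is needed of a nonnegative function \<open>v\<close> that is superharmonic off \<open>K\<close> and has the value
  \<open>\<eta>\<close> at infinity. The formula \<open>\<eta> - ln |Q| / n + U\<close> has a wrong value at the roots of \<open>Q\<close>, since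
  \<open>ln 0 = 0\<close>, and Jensen's formula is most convenient on circles that avoid the roots. The centres
  and radii excluded in this way form null sets, which is why the inequality is required almost
  everywhere only. The last clause is superharmonicity at infinity, for large circles around all
  points of the unit disc and not just around 0, so that it can be averaged over the centres.\<close>

definition superharmonic_off :: "complex set \<Rightarrow> real \<Rightarrow> (complex \<Rightarrow> ennreal) \<Rightarrow> real \<Rightarrow> bool" where
  "superharmonic_off K R v \<eta> \<longleftrightarrow> v \<in> borel_measurable borel \<and>
     (AE a in lborel. AE s in lborel. 0 < s \<and> s < infdist a K \<longrightarrow> circle_mean v a s \<le> v a) \<and>
     (\<forall>a\<in>ball 0 1. AE s in lborel. R < s \<longrightarrow> circle_mean v a s \<le> ennreal \<eta>)"

text \<open>Circles with centre in the unit disc and radius \<open>s > R\<close>, weighted by \<open>1 / s\<^sup>2\<close>. Through a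
  point \<open>z\<close>, they fill a set of radii of length about 1 and a set of angles of length about
  \<open>1 / |z|\<close>, so the resulting density decays like \<open>1 / |z| ^ 3\<close>, which dominates the Fubini-Study
  density.\<close>

lemma superharmonic_off_far:
  assumes "R \<ge> 1"
  obtains C where "C > 0" "\<And>v \<eta>. superharmonic_off K R v \<eta> \<Longrightarrow>
    (\<integral>\<^sup>+z\<in>{z. R < cmod z}. v z * ennreal (1 / (1 + cmod z) ^ 3) \<partial>lborel) \<le> ennreal C * ennreal \<eta>"
proof -
  define k :: "complex \<Rightarrow> real \<Rightarrow> ennreal"
    where "k = (\<lambda>a s. indicator (ball 0 1) a * (ennreal (1 / s\<^sup>2) * indicator {R<..} s))"
  define c where "c = 1 / (16 * pi)"
  have c: "c > 0" by (simp add: c_def)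
  have [measurable]: "ball (0::complex) 1 \<in> sets borel" "{R<..} \<in> sets borel" by auto
  have km [measurable]: "(\<lambda>(a, s). k a s) \<in> borel_measurable (borel \<Otimes>\<^sub>M borel)"
    unfolding k_def by measurable
  have ks: "(\<integral>\<^sup>+s. k a s \<partial>lborel) \<le> indicator (ball 0 1) a * ennreal (1 / R)" for a
  proof -
    have "(\<integral>\<^sup>+s. k a s \<partial>lborel) = indicator (ball 0 1) a * (\<integral>\<^sup>+s. ennreal (1 / s\<^sup>2) * indicator {R<..} s \<partial>lborel)"
      unfolding k_def by (rule nn_integral_cmult) measurable
    also have "(\<integral>\<^sup>+s. ennreal (1 / s\<^sup>2) * indicator {R<..} s \<partial>lborel) \<le> (\<integral>\<^sup>+s\<in>{R..}. ennreal (1 / s\<^sup>2) \<partial>lborel)"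
      by (intro nn_integral_mono) (auto simp: indicator_def)
    also have "\<dots> = ennreal (0 - (- 1 / R))"
    proof (rule nn_integral_FTC_atLeast)
      show "((\<lambda>s. - 1 / s) has_real_derivative 1 / s\<^sup>2) (at s)" if "R \<le> s" for s
        using that assms by (auto intro!: derivative_eq_intros simp: power2_eq_square)
      show "((\<lambda>s. - 1 / s) \<longlongrightarrow> (0::real)) at_top"
        by (rule tendsto_divide_0[OF tendsto_const filterlim_at_top_imp_at_infinity[OF filterlim_ident]])
    qed auto
    finally show ?thesis by (simp add: mult_left_mono)
  qed
  have W: "ennreal (c / (1 + cmod z) ^ 3) \<le> circle_weight k z"
    if z: "R < cmod z" for z
  proof -
    define r where "r = cmod z"
    have r: "r > 1" "R < r" using z assms by (auto simp: r_def)
    define \<tau> where "\<tau> = 1 / (8 * pi * (r + 1))"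
    have pr: "1 / (8 * pi * (r + 1)) \<le> 1 / 2"
    proof -
      have "3 * 8 \<le> pi * (r * 8 + 8)" using r pi_gt3 by (intro mult_mono) auto
      thus ?thesis using r by (simp add: field_simps)
    qed
    have \<tau>: "0 \<le> \<tau>" "\<tau> \<le> 1 / 2" using r pr by (auto simp: \<tau>_def)
    have u: "cmod (z / of_real r) = 1" using r by (simp add: norm_divide r_def[symmetric])
    obtain t1 where t1: "{t1..t1 + \<tau>} \<subseteq> {0..1}"
      "\<And>s t. t \<in> {t1..t1 + \<tau>} \<Longrightarrow> s \<ge> 0 \<Longrightarrow> cmod (circlepath 0 s t - of_real s * (z / of_real r)) \<le> s * (2 * pi * \<tau>)"
      using circle_window[OF u \<tau>] by blast
    have "ennreal (1 / (r + 1)\<^sup>2) * ennreal ((r + 1 / 2 - r) * \<tau>) \<le> circle_weight k z"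
    proof (rule window_weight_bound[OF _ \<tau>(1) t1(1)])
      fix s t assume s: "s \<in> {r..r + 1 / 2}" and t: "t \<in> {t1..t1 + \<tau>}"
      have "cmod (z - of_real s * (z / of_real r)) = \<bar>r - s\<bar>"
      proof -
        have "z - of_real s * (z / of_real r) = of_real (r - s) * (z / of_real r)"
          using r by (simp add: field_simps)
        thus ?thesis by (metis mult.right_neutral norm_mult norm_of_real real_norm_def u)
      qed
      hence "cmod (z - circlepath 0 s t) \<le> \<bar>r - s\<bar> + s * (2 * pi * \<tau>)"
        using norm_triangle_ineq4[of "z - of_real s * (z / of_real r)" "circlepath 0 s t - of_real s * (z / of_real r)"]
          t1(2)[OF t, of s] s r by simp
      also have "2 * pi * \<tau> = 1 / (4 * (r + 1))" using r by (simp add: \<tau>_def divide_simps)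
      also have "\<bar>r - s\<bar> + s * (1 / (4 * (r + 1))) < 1"
      proof -
        have "s * (1 / (4 * (r + 1))) \<le> (r + 1) * (1 / (4 * (r + 1)))" using s r by (intro mult_right_mono) auto
        also have "\<dots> = 1 / 4" using r by (simp add: field_simps)
        finally have "s * (1 / (4 * (r + 1))) \<le> 1 / 4" .
        moreover have "\<bar>r - s\<bar> \<le> 1 / 2" using s by auto
        ultimately show ?thesis by linarith
      qed
      finally have "z - circlepath 0 s t \<in> ball 0 1" by simp
      moreover have "1 / (r + 1)\<^sup>2 \<le> 1 / s\<^sup>2" using s r by (intro divide_left_mono power_mono) auto
      ultimately show "ennreal (1 / (r + 1)\<^sup>2) \<le> k (z - circlepath 0 s t) s"
        using s r by (simp add: k_def ennreal_leI)
    qed simp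
    also have "ennreal (1 / (r + 1)\<^sup>2) * ennreal ((r + 1 / 2 - r) * \<tau>) = ennreal (c / (1 + cmod z) ^ 3)"
      using r \<tau> by (subst ennreal_mult[symmetric]) (auto simp: c_def \<tau>_def r_def[symmetric] power2_eq_square power3_eq_cube field_simps)
    finally show ?thesis .
  qed
  define E where "E = measure lborel (ball (0::complex) 1)"
  have E: "emeasure lborel (ball (0::complex) 1) = ennreal E"
    unfolding E_def using emeasure_bounded_finite[OF bounded_ball, of "0::complex" 1]
    by (intro emeasure_eq_ennreal_measure) auto
  have E0: "E \<ge> 0" "0 \<le> 1 / R" using assms by (auto simp: E_def)
  show ?thesis
  proof (rule that[of "(E * (1 / R) + 1) / c"])
    show "(E * (1 / R) + 1) / c > 0" using c assms E0 by (auto intro!: divide_pos_pos add_nonneg_pos)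
    fix v \<eta> assume v: "superharmonic_off K R v \<eta>"
    hence vm [measurable]: "v \<in> borel_measurable borel" by (simp add: superharmonic_off_def)
    have "ennreal c * (\<integral>\<^sup>+z\<in>{z. R < cmod z}. v z * ennreal (1 / (1 + cmod z) ^ 3) \<partial>lborel) =
          (\<integral>\<^sup>+z. v z * (ennreal (c / (1 + cmod z) ^ 3) * indicator {z. R < cmod z} z) \<partial>lborel)"
      by (subst nn_integral_cmult[symmetric])
         (auto simp: divide_inverse ennreal_mult'[OF less_imp_le[OF c]] mult_ac)
    also have "\<dots> \<le> (\<integral>\<^sup>+z. v z * circle_weight k z \<partial>lborel)"
      using W by (intro nn_integral_mono mult_left_mono) (auto simp: indicator_def)
    also have "\<dots> \<le> (\<integral>\<^sup>+a. ennreal \<eta> * (\<integral>\<^sup>+s. k a s \<partial>lborel) \<partial>lborel)"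
    proof (rule nn_integral_circle_mean_bound)
      show "AE a in lborel. AE s in lborel. k a s \<noteq> 0 \<longrightarrow> circle_mean v a s \<le> ennreal \<eta>"
      proof (rule AE_I2)
        fix a :: complex
        show "AE s in lborel. k a s \<noteq> 0 \<longrightarrow> circle_mean v a s \<le> ennreal \<eta>"
          using v by (cases "a \<in> ball 0 1") (auto simp: superharmonic_off_def k_def indicator_def elim!: eventually_mono)
      qed
    qed measurable
    also have "\<dots> \<le> (\<integral>\<^sup>+a. ennreal \<eta> * (indicator (ball (0::complex) 1) a * ennreal (1 / R)) \<partial>lborel)"
      by (intro nn_integral_mono mult_left_mono ks) auto
    also have "\<dots> = ennreal \<eta> * (ennreal E * ennreal (1 / R))"
      by (simp add: nn_integral_cmult nn_integral_multc E)
    also have "\<dots> = ennreal (E * (1 / R)) * ennreal \<eta>"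
      using assms E0 by (simp only: ennreal_mult[of E "1 / R"] mult_ac)
    also have "\<dots> \<le> ennreal (E * (1 / R) + 1) * ennreal \<eta>"
      by (intro mult_right_mono ennreal_leI) auto
    finally have *: "ennreal c * (\<integral>\<^sup>+z\<in>{z. R < cmod z}. v z * ennreal (1 / (1 + cmod z) ^ 3) \<partial>lborel)
      \<le> ennreal (E * (1 / R) + 1) * ennreal \<eta>" .
    show "(\<integral>\<^sup>+z\<in>{z. R < cmod z}. v z * ennreal (1 / (1 + cmod z) ^ 3) \<partial>lborel) \<le> ennreal ((E * (1 / R) + 1) / c) * ennreal \<eta>"
      by (rule ennreal_divide_leI[OF c _ *]) (use E0 in auto)
  qed
qed

section \<open>Harnack estimates off the arc and up to the arc\<close>

text \<open>The integral over \<open>F\<close> is bounded by the value at infinity, uniformly over all superharmonic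
  functions: a Harnack inequality between \<open>F\<close> and infinity.\<close>

definition controlled :: "complex set \<Rightarrow> real \<Rightarrow> complex set \<Rightarrow> bool" where
  "controlled K R F \<longleftrightarrow> (\<exists>C\<ge>0. \<forall>v \<eta>. superharmonic_off K R v \<eta> \<longrightarrow>
     (\<integral>\<^sup>+z\<in>F. v z \<partial>lborel) \<le> ennreal C * ennreal \<eta>)"

lemma controlled_subset:
  assumes "controlled K R F" "G \<subseteq> F"
  shows "controlled K R G"
proof -
  from assms(1) obtain C where C: "C \<ge> 0"
    "\<And>v \<eta>. superharmonic_off K R v \<eta> \<Longrightarrow> (\<integral>\<^sup>+z\<in>F. v z \<partial>lborel) \<le> ennreal C * ennreal \<eta>"
    by (auto simp: controlled_def)
  have "(\<integral>\<^sup>+z\<in>G. v z \<partial>lborel) \<le> ennreal C * ennreal \<eta>" if "superharmonic_off K R v \<eta>" for v \<eta>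
  proof (rule order.trans[OF _ C(2)[OF that]])
    show "(\<integral>\<^sup>+z\<in>G. v z \<partial>lborel) \<le> (\<integral>\<^sup>+z\<in>F. v z \<partial>lborel)"
      using assms(2) by (intro nn_integral_mono) (auto simp: indicator_def)
  qed
  thus ?thesis using C(1) by (auto simp: controlled_def)
qed

lemma controlled_far:
  assumes R: "R \<ge> 1" and a: "cmod a > R + 1"
  shows "controlled K R (ball a 1)"
proof -
  obtain C where C: "C > 0" "\<And>v \<eta>. superharmonic_off K R v \<eta> \<Longrightarrow>
    (\<integral>\<^sup>+z\<in>{z. R < cmod z}. v z * ennreal (1 / (1 + cmod z) ^ 3) \<partial>lborel) \<le> ennreal C * ennreal \<eta>"
    using superharmonic_off_far[OF R] by blast
  define c where "c = 1 / (2 + cmod a) ^ 3"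
  have c: "c > 0" by (auto simp: c_def intro!: add_pos_nonneg)
  show ?thesis unfolding controlled_def
  proof (intro exI[of _ "C / c"] conjI allI impI)
    show "0 \<le> C / c" using C(1) c by simp
    fix v \<eta> assume v: "superharmonic_off K R v \<eta>"
    hence [measurable]: "v \<in> borel_measurable borel" by (simp add: superharmonic_off_def)
    show "(\<integral>\<^sup>+z\<in>ball a 1. v z \<partial>lborel) \<le> ennreal (C / c) * ennreal \<eta>"
    proof (rule ennreal_divide_leI[OF c less_imp_le[OF C(1)]], rule order.trans[OF _ C(2)[OF v]])
      have [measurable]: "ball a 1 \<in> sets borel" by simp
      have "ennreal c * (\<integral>\<^sup>+z\<in>ball a 1. v z \<partial>lborel) = (\<integral>\<^sup>+z. ennreal c * (v z * indicator (ball a 1) z) \<partial>lborel)"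
        by (rule nn_integral_cmult[symmetric]) measurable
      also have "\<dots> \<le> (\<integral>\<^sup>+z\<in>{z. R < cmod z}. v z * ennreal (1 / (1 + cmod z) ^ 3) \<partial>lborel)"
      proof (rule nn_integral_mono)
        fix z :: complex
        show "ennreal c * (v z * indicator (ball a 1) z) \<le> v z * ennreal (1 / (1 + cmod z) ^ 3) * indicator {z. R < cmod z} z"
        proof (cases "z \<in> ball a 1")
          case True
          hence d: "cmod (a - z) < 1" by (simp add: dist_norm)
          have z: "R < cmod z" "1 + cmod z \<le> 2 + cmod a"
            using d a norm_triangle_ineq2[of a z] norm_triangle_ineq2[of z a] norm_minus_commute[of a z] by linarith+
          have "c \<le> 1 / (1 + cmod z) ^ 3" unfolding c_def using z R
            by (intro divide_left_mono power_mono mult_pos_pos zero_less_power) auto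
          hence "ennreal c \<le> ennreal (1 / (1 + cmod z) ^ 3)" by (rule ennreal_leI)
          hence "ennreal c * v z \<le> ennreal (1 / (1 + cmod z) ^ 3) * v z" by (rule mult_right_mono) simp
          thus ?thesis using True z by (simp add: mult.commute[of "v z"])
        qed simp
      qed
      finally show "ennreal c * (\<integral>\<^sup>+z\<in>ball a 1. v z \<partial>lborel) \<le>
        (\<integral>\<^sup>+z\<in>{z. R < cmod z}. v z * ennreal (1 / (1 + cmod z) ^ 3) \<partial>lborel)" .
    qed
  qed
qed

text \<open>If a superposition of circles with centres in \<open>F\<close>, none of which meets \<open>K\<close>, covers \<open>N\<close> with
  density bounded below, then the circle mean inequality transports a Harnack bound from \<open>F\<close> to \<open>N\<close>.\<close>

lemma controlled_by_weight:
  assumes F: "controlled K R F" "F \<in> sets borel" and N: "N \<in> sets borel"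
    and km: "(\<lambda>(a, s). k a s) \<in> borel_measurable (borel \<Otimes>\<^sub>M borel)"
    and c: "c > 0" and D: "D \<ge> 0"
    and W: "\<And>z. z \<in> N \<Longrightarrow> ennreal c \<le> circle_weight k z"
    and supp: "\<And>a s. k a s \<noteq> 0 \<Longrightarrow> 0 < s \<and> s < infdist a K"
    and ks: "\<And>a. (\<integral>\<^sup>+s. k a s \<partial>lborel) \<le> ennreal D * indicator F a"
  shows "controlled K R N"
proof -
  obtain B where B: "B \<ge> 0" "\<And>v \<eta>. superharmonic_off K R v \<eta> \<Longrightarrow>
     (\<integral>\<^sup>+z\<in>F. v z \<partial>lborel) \<le> ennreal B * ennreal \<eta>"
    using F(1) by (auto simp: controlled_def)
  note [measurable] = F(2) N km
  show ?thesis unfolding controlled_def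
  proof (intro exI[of _ "(D * B) / c"] conjI allI impI)
    show "0 \<le> D * B / c" using B(1) c D by simp
    fix v \<eta> assume v: "superharmonic_off K R v \<eta>"
    hence [measurable]: "v \<in> borel_measurable borel" by (simp add: superharmonic_off_def)
    show "(\<integral>\<^sup>+z\<in>N. v z \<partial>lborel) \<le> ennreal (D * B / c) * ennreal \<eta>"
    proof (rule ennreal_divide_leI[OF c])
      have "ennreal c * (\<integral>\<^sup>+z\<in>N. v z \<partial>lborel) = (\<integral>\<^sup>+z. ennreal c * (v z * indicator N z) \<partial>lborel)"
        by (rule nn_integral_cmult[symmetric]) measurable
      also have "\<dots> \<le> (\<integral>\<^sup>+z. v z * circle_weight k z \<partial>lborel)"
      proof (rule nn_integral_mono)
        fix z :: complex
        show "ennreal c * (v z * indicator N z) \<le> v z * circle_weight k z"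
          using mult_left_mono[OF W, of z "v z"] by (cases "z \<in> N") (auto simp: mult.commute)
      qed
      also have "\<dots> \<le> (\<integral>\<^sup>+a. v a * (\<integral>\<^sup>+s. k a s \<partial>lborel) \<partial>lborel)"
      proof (rule nn_integral_circle_mean_bound)
        have "AE a in lborel. AE s in lborel. 0 < s \<and> s < infdist a K \<longrightarrow> circle_mean v a s \<le> v a"
          using v by (simp add: superharmonic_off_def)
        thus "AE a in lborel. AE s in lborel. k a s \<noteq> 0 \<longrightarrow> circle_mean v a s \<le> v a"
          by (rule eventually_mono) (auto elim!: eventually_mono dest: supp)
      qed measurable
      also have "\<dots> \<le> (\<integral>\<^sup>+a. v a * (ennreal D * indicator F a) \<partial>lborel)"
        by (intro nn_integral_mono mult_left_mono ks) auto
      also have "\<dots> = (\<integral>\<^sup>+a. ennreal D * (v a * indicator F a) \<partial>lborel)" by (simp add: mult_ac)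
      also have "\<dots> = ennreal D * (\<integral>\<^sup>+a\<in>F. v a \<partial>lborel)"
        by (rule nn_integral_cmult) measurable
      also have "\<dots> \<le> ennreal D * (ennreal B * ennreal \<eta>)" by (intro mult_left_mono B(2) v) auto
      also have "\<dots> = ennreal (D * B) * ennreal \<eta>"
        using B(1) D by (subst ennreal_mult) (auto simp: mult_ac)
      finally show "ennreal c * (\<integral>\<^sup>+z\<in>N. v z \<partial>lborel) \<le> ennreal (D * B) * ennreal \<eta>" .
    qed (use B(1) D in auto)
  qed
qed

text \<open>The step of a Harnack chain: the circles with centre in a tiny disc around \<open>a\<^sub>1\<close> and radius
  below half the distance to \<open>K\<close> sweep out a disc around \<open>a\<^sub>0\<close> whose size does not depend on the
  first one.\<close>

lemma controlled_step:
  assumes d: "infdist a\<^sub>0 K = d" "d > 0" and a1: "dist a\<^sub>1 a\<^sub>0 < d / 8"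
    and \<rho>: "\<rho> > 0" and good: "controlled K R (ball a\<^sub>1 \<rho>)"
  shows "controlled K R (ball a\<^sub>0 (d / 8))"
proof -
  define r where "r = min \<rho> (d / 8)"
  have r: "r > 0" "r \<le> d / 8" "r \<le> \<rho>" using \<rho> d by (auto simp: r_def)
  have good': "controlled K R (ball a\<^sub>1 r)"
    by (rule controlled_subset[OF good]) (use r in auto)
  define k :: "complex \<Rightarrow> real \<Rightarrow> ennreal"
    where "k = (\<lambda>a s. indicator (ball a\<^sub>1 r) a * indicator {0<..<d/2} s)"
  have [measurable]: "ball a\<^sub>1 r \<in> sets borel" "ball a\<^sub>0 (d/8) \<in> sets borel" "{0<..<d/2} \<in> sets borel" by auto
  have km [measurable]: "(\<lambda>(a, s). k a s) \<in> borel_measurable (borel \<Otimes>\<^sub>M borel)"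
    unfolding k_def by measurable
  have ks: "(\<integral>\<^sup>+s. k a s \<partial>lborel) = indicator (ball a\<^sub>1 r) a * ennreal (d / 2)" for a
    unfolding k_def using d by (subst nn_integral_cmult_indicator) auto
  define \<tau> where "\<tau> = r / (4 * pi * d)"
  have "r * 1 \<le> (2 * d) * pi" using r d pi_gt3 by (intro mult_mono) auto
  hence \<tau>: "0 < \<tau>" "\<tau> \<le> 1 / 2" using r d by (auto simp: \<tau>_def field_simps)
  define c where "c = (r / 8) * \<tau>"
  have c: "c > 0" using r \<tau> by (simp add: c_def)
  have W: "ennreal c \<le> circle_weight k z" if z: "z \<in> ball a\<^sub>0 (d / 8)" for z
  proof -
    define s0 where "s0 = cmod (z - a\<^sub>1)"
    define u where "u = (if z = a\<^sub>1 then 1 else (z - a\<^sub>1) / of_real s0)"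
    have u: "cmod u = 1" "z - a\<^sub>1 = of_real s0 * u" by (auto simp: u_def s0_def norm_divide)
    have s0: "0 \<le> s0" "s0 < d / 4"
      using z a1 dist_triangle[of z a\<^sub>1 a\<^sub>0] by (auto simp: s0_def dist_norm norm_minus_commute)
    obtain t1 where t1: "{t1..t1 + \<tau>} \<subseteq> {0..1}"
      "\<And>s t. t \<in> {t1..t1 + \<tau>} \<Longrightarrow> s \<ge> 0 \<Longrightarrow> cmod (circlepath 0 s t - of_real s * u) \<le> s * (2 * pi * \<tau>)"
      using circle_window[OF u(1) less_imp_le[OF \<tau>(1)] \<tau>(2)] by blast
    \<comment> \<open>the radii start above \<open>s0\<close> to remain positive when \<open>z\<close> is \<open>a\<^sub>1\<close>\<close>
    have "1 * ennreal ((s0 + r / 4 - (s0 + r / 8)) * \<tau>) \<le> circle_weight k z"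
    proof (rule window_weight_bound[OF _ less_imp_le[OF \<tau>(1)] t1(1)])
      fix s t assume s: "s \<in> {s0 + r / 8..s0 + r / 4}" and t: "t \<in> {t1..t1 + \<tau>}"
      have s': "0 < s" "s < d / 2" "\<bar>s0 - s\<bar> \<le> r / 4" using s s0 r by auto
      have "z - circlepath 0 s t - a\<^sub>1 = of_real (s0 - s) * u - (circlepath 0 s t - of_real s * u)"
        using u(2) by (simp add: algebra_simps)
      also have "cmod \<dots> \<le> \<bar>s0 - s\<bar> + cmod (circlepath 0 s t - of_real s * u)"
        by (rule order.trans[OF norm_triangle_ineq4]) (simp add: norm_mult u(1) del: of_real_diff)
      also have "\<dots> \<le> r / 4 + s * (2 * pi * \<tau>)" using t1(2)[OF t, of s] s' by linarith
      also have "s * (2 * pi * \<tau>) \<le> d / 2 * (2 * pi * \<tau>)" using s' \<tau> by (intro mult_right_mono) auto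
      also have "d / 2 * (2 * pi * \<tau>) = r / 4" using d by (simp add: \<tau>_def)
      finally have "z - circlepath 0 s t \<in> ball a\<^sub>1 r" using r(1) by (simp add: dist_norm norm_minus_commute)
      thus "1 \<le> k (z - circlepath 0 s t) s" using s' by (simp add: k_def)
    qed (use r in auto)
    thus ?thesis by (simp add: c_def)
  qed
  show ?thesis
  proof (rule controlled_by_weight[OF good' _ _ km c _ W])
    show "0 < s \<and> s < infdist a K" if "k a s \<noteq> 0" for a s
    proof -
      have a: "a \<in> ball a\<^sub>1 r" and s: "0 < s" "s < d / 2"
        using that by (auto simp: k_def indicator_def split: if_splits)
      have "d \<le> infdist a K + dist a\<^sub>0 a" using infdist_triangle[of a\<^sub>0 K a] d by simp
      moreover have "dist a\<^sub>0 a < d / 4"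
        using dist_triangle[of a\<^sub>0 a a\<^sub>1] a a1 r by (auto simp: dist_commute)
      ultimately show ?thesis using s d by linarith
    qed
    show "(\<integral>\<^sup>+s. k a s \<partial>lborel) \<le> ennreal (d / 2) * indicator (ball a\<^sub>1 r) a" for a
      using ks[of a] by (simp add: mult.commute)
  qed (use d in auto)
qed

text \<open>The set of centres of controlled discs is open, and relatively closed in the complement of
  \<open>K\<close> because the size of the disc in the chain step depends on the distance to \<open>K\<close> only. It
  contains the points far away, so connectedness of the complement concludes.\<close>

lemma controlled_ball:
  assumes K: "compact K" "K \<noteq> {}" "connected (- K)" and R: "R \<ge> 1" "K \<subseteq> cball 0 R" and a: "a \<notin> K"
  shows "\<exists>\<rho>>0. controlled K R (ball a \<rho>)"
proof -
  define G where "G = {a. a \<notin> K \<and> (\<exists>\<rho>>0. controlled K R (ball a \<rho>))}"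
  have GI: "a \<in> G" if "a \<notin> K" "\<rho> > 0" "controlled K R (ball a \<rho>)" for a \<rho> using that by (auto simp: G_def)
  have clK: "closed K" using K by (simp add: compact_imp_closed)
  have pos: "infdist a K > 0" if "a \<notin> K" for a
    using in_closed_iff_infdist_zero[OF clK K(2)] that infdist_nonneg[of a K] by force
  have "open G"
  proof (rule openI)
    fix a assume "a \<in> G"
    then obtain \<rho> where a: "a \<notin> K" "\<rho> > 0" "controlled K R (ball a \<rho>)" by (auto simp: G_def)
    have "open (- K)" using clK by auto
    then obtain e where e: "e > 0" "ball a e \<subseteq> - K" using a(1) open_contains_ball by blast
    have "ball a (min e (\<rho> / 2)) \<subseteq> G"
    proof
      fix b assume b: "b \<in> ball a (min e (\<rho> / 2))"
      have "ball b (\<rho> / 2) \<subseteq> ball a \<rho>"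
      proof
        fix x assume "x \<in> ball b (\<rho> / 2)"
        thus "x \<in> ball a \<rho>" using b dist_triangle[of a x b] by simp
      qed
      hence "controlled K R (ball b (\<rho> / 2))" by (rule controlled_subset[OF a(3)])
      moreover have "b \<notin> K" using b e by auto
      ultimately show "b \<in> G" using a(2) by (intro GI[of b "\<rho> / 2"]) auto
    qed
    thus "\<exists>e>0. ball a e \<subseteq> G" using e(1) a(2) by (intro exI[of _ "min e (\<rho> / 2)"]) auto
  qed
  moreover have "open (- K - G)"
  proof (rule openI)
    fix a assume a: "a \<in> - K - G"
    define d where "d = infdist a K"
    have d: "d > 0" using a pos by (auto simp: d_def)
    have "ball a (d / 8) \<subseteq> - K - G"
    proof
      fix b assume b: "b \<in> ball a (d / 8)"
      have "b \<notin> K" using infdist_le[of b K a] b d by (auto simp: d_def)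
      moreover have "b \<notin> G"
      proof
        assume "b \<in> G"
        then obtain \<rho> where "\<rho> > 0" "controlled K R (ball b \<rho>)" by (auto simp: G_def)
        hence "controlled K R (ball a (d / 8))"
          using controlled_step[OF d_def[symmetric] d, of b \<rho> R] b by (simp add: dist_commute)
        hence "a \<in> G" using a d by (intro GI[of a "d / 8"]) auto
        thus False using a by auto
      qed
      ultimately show "b \<in> - K - G" by auto
    qed
    thus "\<exists>e>0. ball a e \<subseteq> - K - G" using d by (intro exI[of _ "d / 8"]) auto
  qed
  ultimately have "G \<inter> - K = {} \<or> (- K - G) \<inter> - K = {}"
    by (intro connectedD[OF K(3)]) auto
  moreover have "of_real (R + 2) \<in> G \<inter> - K"
  proof -
    define b where "b = complex_of_real (R + 2)"
    have n: "cmod b = R + 2" unfolding b_def norm_of_real using R(1) by simp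
    hence "b \<notin> K" using R(2) by auto
    moreover have "controlled K R (ball b 1)" by (intro controlled_far R) (simp add: n)
    ultimately show ?thesis unfolding b_def[symmetric] using GI[of b 1] by auto
  qed
  ultimately have "- K \<subseteq> G" by blast
  thus ?thesis using a by (auto simp: G_def)
qed

lemma controlled_compact:
  assumes K: "compact K" "K \<noteq> {}" "connected (- K)" and R: "R \<ge> 1" "K \<subseteq> cball 0 R"
    and F: "compact F" "F \<inter> K = {}"
  shows "controlled K R F"
proof -
  have "\<forall>a\<in>F. \<exists>\<rho>>0. controlled K R (ball a \<rho>)"
    using controlled_ball[OF K R] F(2) by blast
  then obtain \<rho> where \<rho>: "\<And>a. a \<in> F \<Longrightarrow> \<rho> a > 0" "\<And>a. a \<in> F \<Longrightarrow> controlled K R (ball a (\<rho> a))"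
    by metis
  have "\<forall>a\<in>F. \<exists>C\<ge>0. \<forall>v \<eta>. superharmonic_off K R v \<eta> \<longrightarrow>
     (\<integral>\<^sup>+z\<in>ball a (\<rho> a). v z \<partial>lborel) \<le> ennreal C * ennreal \<eta>"
    using \<rho>(2) unfolding controlled_def by blast
  then obtain C where C: "\<And>a. a \<in> F \<Longrightarrow> C a \<ge> 0"
    "\<And>a v \<eta>. a \<in> F \<Longrightarrow> superharmonic_off K R v \<eta> \<Longrightarrow> (\<integral>\<^sup>+z\<in>ball a (\<rho> a). v z \<partial>lborel) \<le> ennreal (C a) * ennreal \<eta>"
    by metis
  obtain G where G: "G \<subseteq> F" "finite G" "F \<subseteq> (\<Union>a\<in>G. ball a (\<rho> a))"
  proof (rule compactE_image[OF F(1), of F "\<lambda>a. ball a (\<rho> a)"])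
    show "F \<subseteq> (\<Union>a\<in>F. ball a (\<rho> a))" using \<rho>(1) by auto
  qed auto
  show ?thesis unfolding controlled_def
  proof (intro exI[of _ "\<Sum>a\<in>G. C a"] conjI allI impI)
    show "0 \<le> (\<Sum>a\<in>G. C a)" using C(1) G(1) by (intro sum_nonneg) auto
    fix v \<eta> assume v: "superharmonic_off K R v \<eta>"
    hence [measurable]: "v \<in> borel_measurable borel" by (simp add: superharmonic_off_def)
    have [measurable]: "ball a r \<in> sets borel" for a :: complex and r by simp
    have "(\<integral>\<^sup>+z\<in>F. v z \<partial>lborel) \<le> (\<integral>\<^sup>+z. (\<Sum>a\<in>G. v z * indicator (ball a (\<rho> a)) z) \<partial>lborel)"
    proof (rule nn_integral_mono)
      fix z
      show "v z * indicator F z \<le> (\<Sum>a\<in>G. v z * indicator (ball a (\<rho> a)) z)"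
      proof (cases "z \<in> F")
        case True
        then obtain a where a: "a \<in> G" "z \<in> ball a (\<rho> a)" using G(3) by auto
        have "v z * indicator F z = v z * indicator (ball a (\<rho> a)) z" using True a by simp
        also have "\<dots> \<le> (\<Sum>a\<in>G. v z * indicator (ball a (\<rho> a)) z)"
          using a G by (intro member_le_sum) auto
        finally show ?thesis .
      qed simp
    qed
    also have "\<dots> = (\<Sum>a\<in>G. \<integral>\<^sup>+z\<in>ball a (\<rho> a). v z \<partial>lborel)"
      by (rule nn_integral_sum) measurable
    also have "\<dots> \<le> (\<Sum>a\<in>G. ennreal (C a) * ennreal \<eta>)" using G(1) C(2)[OF _ v] by (intro sum_mono) auto
    also have "\<dots> = ennreal (\<Sum>a\<in>G. C a) * ennreal \<eta>"
      unfolding sum_distrib_right[symmetric] using C(1) G(1) by (subst sum_ennreal) auto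
    finally show "(\<integral>\<^sup>+z\<in>F. v z \<partial>lborel) \<le> ennreal (\<Sum>a\<in>G. C a) * ennreal \<eta>" .
  qed
qed

text \<open>Let \<open>z\<close> be at distance \<open>\<epsilon>\<close> from its nearest point \<open>x\<close>. Moving from \<open>z\<close> by a distance \<open>s\<close>
  comparable to the reach, in a direction within \<open>O(\<surd>\<epsilon>)\<close> of the direction from \<open>x\<close> to \<open>z\<close>, leads to
  a point that is closer to \<open>z\<close> than to any point \<open>y\<close> of \<open>K\<close>. With \<open>p = |z - y|\<close> and the admissible
  angle \<open>\<phi>\<close>, twice the inner product of the displacement with \<open>z - y\<close> is at least
  \<open>2 s \<epsilon> - 8 s C p\<^sup>2 - 2 s \<phi> p\<close>; the small radius makes the second term harmless and the choice of
  \<open>\<phi>\<close> makes the quadratic in \<open>p\<close> positive.\<close>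

lemma reach_displacement:
  fixes z x y g :: complex
  assumes C: "C > 0" and reach: "(y - x) \<bullet> (z - x) \<le> C * cmod (z - x) * (cmod (y - x))\<^sup>2"
    and near: "cmod (z - x) \<le> cmod (z - y)" and \<epsilon>: "cmod (z - x) = \<epsilon>" "\<epsilon> > 0"
    and s: "r \<le> s" "s \<le> 2 * r" and r: "r = 1 / (32 * C)"
    and g: "cmod g = s" "cmod (g - of_real s * ((z - x) / of_real \<epsilon>)) \<le> s * sqrt (\<epsilon> / (4 * r))"
  shows "s < cmod (z + g - y)"
proof -
  define e where "e = (z - x) / of_real \<epsilon>"
  define p where "p = cmod (z - y)"
  define \<phi> where "\<phi> = sqrt (\<epsilon> / (4 * r))"
  have r0: "r > 0" "r * C = 1 / 32" using C r by auto
  have s0: "s > 0" using s r0 by linarith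
  have ee: "(z - y) \<bullet> e = \<epsilon> - (y - x) \<bullet> e"
  proof -
    have "(z - x) \<bullet> e = \<epsilon>"
    proof -
      have "e = (1 / \<epsilon>) *\<^sub>R (z - x)" by (simp add: e_def scaleR_conv_of_real)
      hence "(z - x) \<bullet> e = (cmod (z - x))\<^sup>2 / \<epsilon>" by (simp add: power2_norm_eq_inner)
      thus ?thesis using \<epsilon> by (simp add: power2_eq_square)
    qed
    thus ?thesis by (simp add: inner_diff_left)
  qed
  have q: "cmod (y - x) \<le> 2 * p"
    using norm_triangle_ineq4[of "z - x" "z - y"] near \<epsilon>(1) by (simp add: p_def)
  have "(y - x) \<bullet> e \<le> C * (cmod (y - x))\<^sup>2"
  proof -
    have "(y - x) \<bullet> e = ((y - x) \<bullet> (z - x)) / \<epsilon>"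
      by (simp add: e_def inner_commute[of "y - x"] inner_complex_def add_divide_distrib)
    also have "\<dots> \<le> (C * \<epsilon> * (cmod (y - x))\<^sup>2) / \<epsilon>"
      using reach \<epsilon> by (intro divide_right_mono) auto
    finally show ?thesis using \<epsilon> by simp
  qed
  also have "\<dots> \<le> C * (2 * p)\<^sup>2" using q C by (intro mult_left_mono power_mono) auto
  finally have re: "(y - x) \<bullet> e \<le> 4 * C * p\<^sup>2" by (simp add: power_mult_distrib)
  have ge: "(z - y) \<bullet> (g - of_real s * e) \<ge> - (p * (s * \<phi>))"
  proof -
    have "\<bar>(z - y) \<bullet> (g - of_real s * e)\<bar> \<le> p * cmod (g - of_real s * e)"
      unfolding p_def by (rule Cauchy_Schwarz_ineq2)
    also have "\<dots> \<le> p * (s * \<phi>)" using g(2) by (intro mult_left_mono) (auto simp: p_def e_def \<phi>_def)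
    finally show ?thesis by linarith
  qed
  have "(z - y) \<bullet> g = (z - y) \<bullet> (g - of_real s * e) + s * ((z - y) \<bullet> e)"
    by (simp add: scaleR_conv_of_real[symmetric] inner_diff_right)
  hence zg: "(z - y) \<bullet> g \<ge> s * (\<epsilon> - 4 * C * p\<^sup>2) - p * (s * \<phi>)"
    using ge mult_left_mono[OF re less_imp_le[OF s0]] ee by (simp add: algebra_simps)
  have \<phi>2: "\<phi>\<^sup>2 = \<epsilon> / (4 * r)" using r0 \<epsilon> by (simp add: \<phi>_def)
  have 1: "8 * s * C * p\<^sup>2 \<le> p\<^sup>2 / 2"
  proof -
    have "s * C \<le> 2 * r * C" using s C by (intro mult_right_mono) auto
    hence "s * C \<le> 1 / 16" using r0(2) by simp
    from mult_right_mono[OF this, of "8 * p\<^sup>2"] show ?thesis by (simp add: mult_ac)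
  qed
  have 2: "2 * (s * (p * \<phi>)) \<le> p\<^sup>2 / 2 + 2 * s\<^sup>2 * \<phi>\<^sup>2"
  proof -
    have "0 \<le> (p - 2 * (s * \<phi>))\<^sup>2" by simp
    thus ?thesis by (simp add: power2_diff power_mult_distrib mult.left_commute[of s p] mult.assoc)
  qed
  have 3: "2 * s\<^sup>2 * \<phi>\<^sup>2 \<le> s * \<epsilon>"
  proof -
    have "2 * s\<^sup>2 * \<phi>\<^sup>2 = (s * \<epsilon>) * (s / (2 * r))" unfolding \<phi>2 using r0 by (simp add: power2_eq_square field_simps)
    also have "\<dots> \<le> (s * \<epsilon>) * 1" using s r0 \<epsilon> s0 by (intro mult_left_mono) auto
    finally show ?thesis by simp
  qed
  have "(cmod (z + g - y))\<^sup>2 = p\<^sup>2 + 2 * ((z - y) \<bullet> g) + s\<^sup>2"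
    using dot_norm[of "z - y" g] g(1) by (simp add: p_def algebra_simps field_simps)
  moreover have "2 * ((z - y) \<bullet> g) \<ge> 2 * (s * \<epsilon>) - 8 * s * C * p\<^sup>2 - 2 * (s * (p * \<phi>))"
    using zg by (simp add: algebra_simps)
  moreover have "s * \<epsilon> > 0" using s0 \<epsilon> by simp
  ultimately have "s\<^sup>2 < (cmod (z + g - y))\<^sup>2" using 1 2 3 by linarith
  thus ?thesis by (rule power_less_imp_less_base) simp
qed

lemma borel_measurable_near:
  assumes "closed K"
  shows "{z::complex. z \<notin> K \<and> infdist z K < e} \<in> sets borel"
proof -
  have "{z. z \<notin> K \<and> infdist z K < e} = (- K) \<inter> {z. infdist z K < e}" by auto
  moreover have "open {z::complex. infdist z K < e}" by (intro open_Collect_less continuous_intros)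
  ultimately show ?thesis using assms by auto
qed

text \<open>Up to the arc. The circles of centre \<open>a\<close> in a fixed compact set off \<open>K\<close> and radius
  \<open>s < infdist a K\<close> get the weight \<open>(infdist a K - s) powr (-1/2)\<close>. A point \<open>z\<close> at distance \<open>\<epsilon>\<close> from
  \<open>K\<close> lies on such circles for a set of radii and angles of measure about \<open>\<surd>\<epsilon>\<close>, and on these the
  weight is at least \<open>\<epsilon> powr (-1/2)\<close> because \<open>infdist a K - s \<le> \<epsilon>\<close>. The density at \<open>z\<close> is thus
  bounded below independently of \<open>\<epsilon>\<close>.\<close>

lemma controlled_near:
  assumes K: "compact K" "K \<noteq> {}" "connected (- K)" and R: "R \<ge> 1" "K \<subseteq> cball 0 R"
    and C: "C > 0" "reach_bound K C"
  shows "\<exists>\<epsilon>>0. controlled K R {z. z \<notin> K \<and> infdist z K < \<epsilon>}"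
proof -
  have clK: "closed K" using K by (simp add: compact_imp_closed)
  define r where "r = 1 / (32 * C)"
  have r: "r > 0" using C by (simp add: r_def)
  define F where "F = {a. r \<le> infdist a K \<and> infdist a K \<le> 4 * r}"
  have F: "compact F" "F \<inter> K = {}"
  proof -
    have "closed {a. r \<le> infdist a K}" by (intro closed_Collect_le continuous_intros)
    moreover have "compact {a. infdist a K \<le> 4 * r}" using K r by (intro compact_infdist_le) auto
    ultimately have "compact ({a. r \<le> infdist a K} \<inter> {a. infdist a K \<le> 4 * r})"
      by (rule closed_Int_compact)
    thus "compact F" by (simp add: F_def Int_def)
    show "F \<inter> K = {}" using r by (auto simp: F_def)
  qed
  have [measurable]: "F \<in> sets borel" using F(1) by (simp add: compact_imp_closed)
  define k :: "complex \<Rightarrow> real \<Rightarrow> ennreal" where "k = (\<lambda>a s. indicator F a *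
    (indicator {0<..<infdist a K} s * ennreal ((infdist a K - s) powr (- 1 / 2))))"
  have km [measurable]: "(\<lambda>(a, s). k a s) \<in> borel_measurable (borel \<Otimes>\<^sub>M borel)"
  proof -
    have "(\<lambda>(a, s). k a s) = (\<lambda>x. indicator F (fst x) * ((if 0 < snd x \<and> snd x < infdist (fst x) K then 1 else 0) *
        ennreal ((infdist (fst x) K - snd x) powr (- 1 / 2))))"
      by (auto simp: k_def fun_eq_iff indicator_def)
    thus ?thesis by simp
  qed
  have ks: "(\<integral>\<^sup>+s. k a s \<partial>lborel) \<le> ennreal (10 * sqrt r) * indicator F a" for a
  proof (cases "a \<in> F")
    case True
    define d where "d = infdist a K"
    have d: "d > 0" "d \<le> 4 * r" using True r by (auto simp: d_def F_def)
    have "(\<integral>\<^sup>+s. k a s \<partial>lborel) \<le> (\<integral>\<^sup>+s\<in>{0..0+d}. ennreal (\<bar>s - d\<bar> powr (- 1 / 2)) \<partial>lborel)"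
      using True by (intro nn_integral_mono) (auto simp: k_def d_def indicator_def)
    also have "\<dots> \<le> ennreal (5 * sqrt d)" by (rule nn_integral_inverse_sqrt_dist[OF d(1)])
    also have "5 * sqrt d \<le> 5 * sqrt (4 * r)" using d by simp
    finally show ?thesis using True by (simp add: real_sqrt_mult ennreal_leI)
  qed (simp add: k_def)
  define c where "c = sqrt r / (4 * pi)"
  have c: "c > 0" using r by (simp add: c_def)
  have W: "ennreal c \<le> circle_weight k z" if z: "z \<notin> K" "infdist z K < r" for z
  proof -
    obtain x where x: "x \<in> K" "infdist z K = dist z x" using infdist_attains_inf[OF clK K(2)] by blast
    define \<epsilon> where "\<epsilon> = cmod (z - x)"
    have \<epsilon>: "0 < \<epsilon>" "\<epsilon> < r" "infdist z K = \<epsilon>" using x z by (auto simp: \<epsilon>_def dist_norm)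
    have near: "cmod (z - x) \<le> cmod (z - y)" if "y \<in> K" for y
      using infdist_le[OF that, of z] x(2) by (simp add: dist_norm)
    define \<phi> where "\<phi> = sqrt (\<epsilon> / (4 * r))"
    have \<phi>: "0 < \<phi>" "\<phi> \<le> 1"
    proof -
      show "0 < \<phi>" using \<epsilon> r by (simp add: \<phi>_def)
      have "\<epsilon> / (4 * r) \<le> 1" using \<epsilon> r by (simp add: field_simps)
      thus "\<phi> \<le> 1" by (simp add: \<phi>_def)
    qed
    define \<tau> where "\<tau> = \<phi> / (2 * pi)"
    have \<tau>: "0 \<le> \<tau>" "\<tau> \<le> 1 / 2" "2 * pi * \<tau> = \<phi>" using \<phi> pi_gt3 by (auto simp: \<tau>_def field_simps)
    define u where "u = - ((z - x) / of_real \<epsilon>)"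
    have u: "cmod u = 1" using \<epsilon>(1) unfolding u_def norm_minus_cancel norm_divide by (simp add: \<epsilon>_def)
    obtain t1 where t1: "{t1..t1 + \<tau>} \<subseteq> {0..1}"
      "\<And>s t. t \<in> {t1..t1 + \<tau>} \<Longrightarrow> s \<ge> 0 \<Longrightarrow> cmod (circlepath 0 s t - of_real s * u) \<le> s * (2 * pi * \<tau>)"
      using circle_window[OF u \<tau>(1,2)] by blast
    have "ennreal (\<epsilon> powr (- 1 / 2)) * ennreal ((2 * r - r) * \<tau>) \<le> circle_weight k z"
    proof (rule window_weight_bound[OF _ \<tau>(1) t1(1)])
      fix s t assume s: "s \<in> {r..2 * r}" and t: "t \<in> {t1..t1 + \<tau>}"
      have s0: "s > 0" using s r by auto
      define g where "g = - circlepath 0 s t"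
      define a where "a = z + g"
      have g: "cmod g = s" using s0 by (simp add: g_def circlepath norm_mult)
      have g2: "cmod (g - of_real s * ((z - x) / of_real \<epsilon>)) \<le> s * \<phi>"
      proof -
        have "g - of_real s * ((z - x) / of_real \<epsilon>) = - (circlepath 0 s t - of_real s * u)" by (simp add: g_def u_def)
        thus ?thesis using t1(2)[OF t, of s] s0 \<tau>(3) by (simp only: norm_minus_cancel)
      qed
      have "s < dist a y" if "y \<in> K" for y
        unfolding a_def dist_norm
      proof (rule reach_displacement[OF C(1) _ near[OF that] \<epsilon>_def[symmetric] \<epsilon>(1) _ _ r_def g])
        show "(y - x) \<bullet> (z - x) \<le> C * cmod (z - x) * (cmod (y - x))\<^sup>2"
          using C(2) x(1) that near unfolding reach_bound_def by blast
        show "cmod (g - of_real s * ((z - x) / of_real \<epsilon>)) \<le> s * sqrt (\<epsilon> / (4 * r))" using g2 by (simp add: \<phi>_def)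
      qed (use s in auto)
      hence low: "s < infdist a K" using infdist_attains_inf[OF clK K(2), of a] by metis
      have up: "infdist a K \<le> \<epsilon> + s"
        using infdist_triangle[of a K z] \<epsilon>(3) g by (simp add: a_def dist_norm)
      have "a \<in> F" using low up s \<epsilon> by (auto simp: F_def)
      moreover have "\<epsilon> powr (- 1 / 2) \<le> (infdist a K - s) powr (- 1 / 2)"
        using low up by (intro powr_mono2') auto
      ultimately show "ennreal (\<epsilon> powr (- 1 / 2)) \<le> k (z - circlepath 0 s t) s"
        using low s0 by (simp add: k_def a_def g_def ennreal_leI)
    qed (use r in auto)
    also have "ennreal (\<epsilon> powr (- 1 / 2)) * ennreal ((2 * r - r) * \<tau>) = ennreal c"
    proof -
      have e: "\<epsilon> powr (- 1 / 2) = 1 / sqrt \<epsilon>" using \<epsilon>(1) by (simp add: powr_minus_divide powr_half_sqrt)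
      have "\<epsilon> powr (- 1 / 2) * ((2 * r - r) * \<tau>) = c"
        unfolding e using \<epsilon>(1) r by (simp add: \<tau>_def \<phi>_def c_def real_sqrt_divide real_sqrt_mult field_simps)
      thus ?thesis using \<tau>(1) r by (subst ennreal_mult[symmetric]) auto
    qed
    finally show ?thesis .
  qed
  define N where "N = {z. z \<notin> K \<and> infdist z K < r}"
  have [measurable]: "N \<in> sets borel"
    unfolding N_def by (rule borel_measurable_near[OF clK])
  have "controlled K R N"
  proof (rule controlled_by_weight[OF controlled_compact[OF K R F] _ _ km c _ _ _ ks])
    show "ennreal c \<le> circle_weight k z" if "z \<in> N" for z using that W by (simp add: N_def)
    show "0 < s \<and> s < infdist a K" if "k a s \<noteq> 0" for a s
      using that by (auto simp: k_def indicator_def split: if_splits)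
  qed (use r in auto)
  thus ?thesis using r unfolding N_def by blast
qed

text \<open>The plane, up to the null set \<open>K\<close>, consists of a neighbourhood of \<open>K\<close>, a compact set off \<open>K\<close>
  and a neighbourhood of infinity.\<close>

lemma fubini_study_superharmonic_bound:
  assumes K: "compact K" "K \<noteq> {}" "connected (- K)" "negligible K" and R: "R \<ge> 1" "K \<subseteq> cball 0 R"
    and C: "C > 0" "reach_bound K C"
  obtains B where "B > 0" "\<And>v \<eta>. superharmonic_off K R v \<eta> \<Longrightarrow>
    (\<integral>\<^sup>+z. v z \<partial>fubini_study) \<le> ennreal B * ennreal \<eta>"
proof -
  obtain \<epsilon> where \<epsilon>: "\<epsilon> > 0" "controlled K R {z. z \<notin> K \<and> infdist z K < \<epsilon>}"
    using controlled_near[OF K(1-3) R C] by blast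
  define N where "N = {z. z \<notin> K \<and> infdist z K < \<epsilon>}"
  obtain B1 where B1: "B1 \<ge> 0" "\<And>v \<eta>. superharmonic_off K R v \<eta> \<Longrightarrow>
     (\<integral>\<^sup>+z\<in>N. v z \<partial>lborel) \<le> ennreal B1 * ennreal \<eta>"
    using \<epsilon>(2) unfolding controlled_def N_def[symmetric] by blast
  define F where "F = cball 0 R \<inter> {z. \<epsilon> \<le> infdist z K}"
  have "closed {z. \<epsilon> \<le> infdist z K}" by (intro closed_Collect_le continuous_intros)
  hence F: "compact F" unfolding F_def by (intro compact_Int_closed) auto
  have FK: "F \<inter> K = {}" using \<epsilon>(1) by (auto simp: F_def)
  obtain B2 where B2: "B2 \<ge> 0" "\<And>v \<eta>. superharmonic_off K R v \<eta> \<Longrightarrow>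
     (\<integral>\<^sup>+z\<in>F. v z \<partial>lborel) \<le> ennreal B2 * ennreal \<eta>"
    using controlled_compact[OF K(1-3) R F FK] unfolding controlled_def by blast
  obtain B3 where B3: "B3 > 0" "\<And>v \<eta>. superharmonic_off K R v \<eta> \<Longrightarrow>
    (\<integral>\<^sup>+z\<in>{z. R < cmod z}. v z * ennreal (1 / (1 + cmod z) ^ 3) \<partial>lborel) \<le> ennreal B3 * ennreal \<eta>"
    using superharmonic_off_far[OF R(1)] by blast
  have clK: "closed K" using K by (simp add: compact_imp_closed)
  have [measurable]: "F \<in> sets borel" using F by (simp add: compact_imp_closed)
  have [measurable]: "N \<in> sets borel"
    unfolding N_def by (rule borel_measurable_near[OF clK])
  define w where "w = (\<lambda>z. 1 / (pi * (1 + (cmod z)\<^sup>2)\<^sup>2))"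
  have w1: "w z \<le> 1" for z
  proof -
    have "1 * 1 \<le> pi * (1 + (cmod z)\<^sup>2)\<^sup>2" using pi_gt3 by (intro mult_mono one_le_power) auto
    thus ?thesis by (simp add: w_def)
  qed
  have w3: "w z \<le> 4 * (1 / (1 + cmod z) ^ 3)" for z
  proof -
    define x where "x = cmod z"
    have x: "x \<ge> 0" by (simp add: x_def)
    have "(1 + x)\<^sup>2 \<le> 2 * (1 + x\<^sup>2)" using sum_squares_ge_zero[of "1 - x" 0] by (simp add: power2_eq_square algebra_simps)
    hence "((1 + x)\<^sup>2)\<^sup>2 \<le> (2 * (1 + x\<^sup>2))\<^sup>2" by (intro power_mono) auto
    also have "\<dots> = 4 * (1 + x\<^sup>2)\<^sup>2" by (subst power_mult_distrib) simp
    finally have "((1 + x)\<^sup>2)\<^sup>2 \<le> 4 * (1 + x\<^sup>2)\<^sup>2" .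
    moreover have "(1 + x) ^ 3 \<le> ((1 + x)\<^sup>2)\<^sup>2"
      unfolding power_mult[symmetric] using x by (intro power_increasing) auto
    moreover have "1 * (1 + x\<^sup>2)\<^sup>2 \<le> pi * (1 + x\<^sup>2)\<^sup>2" using pi_gt3 by (intro mult_right_mono) auto
    ultimately have "(1 + x) ^ 3 \<le> 4 * (pi * (1 + x\<^sup>2)\<^sup>2)" by linarith
    moreover have "0 < (1 + x) ^ 3" using x by (intro zero_less_power) auto
    moreover have "0 < pi * (1 + x\<^sup>2)\<^sup>2"
      using pi_gt_zero by (intro mult_pos_pos zero_less_power add_pos_nonneg) auto
    ultimately show ?thesis unfolding w_def x_def[symmetric] by (simp add: divide_simps mult.commute)
  qed
  have AE: "AE z in lborel. z \<notin> K"
  proof -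
    have "K \<in> null_sets lebesgue" using K(4) by (simp add: negligible_iff_null_sets)
    hence "emeasure lborel K = 0"
      using clK by (simp add: null_sets_def emeasure_completion)
    hence "K \<in> null_sets lborel" using clK by (intro null_setsI) auto
    thus ?thesis by (rule AE_not_in)
  qed
  show ?thesis
  proof (rule that[of "B1 + B2 + 4 * B3"])
    show "0 < B1 + B2 + 4 * B3" using B1 B2 B3 by simp
    fix v \<eta> assume v: "superharmonic_off K R v \<eta>"
    hence [measurable]: "v \<in> borel_measurable borel" by (simp add: superharmonic_off_def)
    have "(\<integral>\<^sup>+z. v z \<partial>fubini_study) = (\<integral>\<^sup>+z. ennreal (w z) * v z \<partial>lborel)"
      unfolding fubini_study_eq w_def by (rule nn_integral_density) measurable
    also have "\<dots> \<le> (\<integral>\<^sup>+z. v z * indicator N z + v z * indicator F z +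
        ennreal 4 * (v z * ennreal (1 / (1 + cmod z) ^ 3) * indicator {z. R < cmod z} z) \<partial>lborel)"
    proof (rule nn_integral_mono_AE, rule eventually_mono[OF AE])
      fix z assume z: "z \<notin> K"
      have a: "ennreal (w z) * v z \<le> v z" using mult_right_mono[OF ennreal_leI[OF w1[of z]], of "v z"] by simp
      have b: "ennreal (w z) * v z \<le> ennreal 4 * (v z * ennreal (1 / (1 + cmod z) ^ 3))"
        using mult_right_mono[OF ennreal_leI[OF w3[of z]], of "v z"]
        by (simp only: ennreal_mult'[of 4] mult_ac) (simp add: mult_ac)
      consider "z \<in> N" | "z \<in> F" | "R < cmod z" using z by (force simp: N_def F_def)
      thus "ennreal (w z) * v z \<le> v z * indicator N z + v z * indicator F z +
        ennreal 4 * (v z * ennreal (1 / (1 + cmod z) ^ 3) * indicator {z. R < cmod z} z)"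
      proof cases
        case 1 thus ?thesis using a by (simp add: add.assoc add_increasing2)
      next
        case 2 thus ?thesis using a by (simp add: add.commute[of "v z * indicator N z"] add.assoc add_increasing2)
      next
        case 3 thus ?thesis using b by (simp add: add_increasing)
      qed
    qed
    also have "\<dots> = (\<integral>\<^sup>+z\<in>N. v z \<partial>lborel) + (\<integral>\<^sup>+z\<in>F. v z \<partial>lborel) +
        ennreal 4 * (\<integral>\<^sup>+z\<in>{z. R < cmod z}. v z * ennreal (1 / (1 + cmod z) ^ 3) \<partial>lborel)"
      by (subst nn_integral_add, measurable, subst nn_integral_add, measurable, subst nn_integral_cmult, measurable)
    also have "\<dots> \<le> ennreal B1 * ennreal \<eta> + ennreal B2 * ennreal \<eta> + ennreal 4 * (ennreal B3 * ennreal \<eta>)"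
      by (intro add_mono mult_left_mono B1(2) B2(2) B3(2) v) auto
    also have "\<dots> = ennreal (B1 + B2 + 4 * B3) * ennreal \<eta>"
    proof -
      have "ennreal (B1 + B2 + 4 * B3) = ennreal B1 + ennreal B2 + ennreal 4 * ennreal B3"
        using B1(1) B2(1) B3(1) by (subst ennreal_mult[symmetric]) (auto simp: ennreal_plus[symmetric] simp del: ennreal_plus)
      thus ?thesis by (simp only: distrib_right mult.assoc)
    qed
    finally show "(\<integral>\<^sup>+z. v z \<partial>fubini_study) \<le> ennreal (B1 + B2 + 4 * B3) * ennreal \<eta>" .
  qed
qed

section \<open>Hoelder continuity of the potential in the plane\<close>

lemma AE_in_support:
  fixes \<mu> :: "'a::second_countable_topology measure"
  assumes "sets \<mu> = sets borel" "measure_support \<mu> \<subseteq> K"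
  shows "AE a in \<mu>. a \<in> K"
proof -
  define F where "F = {U. open U \<and> emeasure \<mu> U = 0}"
  obtain F' where F': "F' \<subseteq> F" "countable F'" "\<Union>F' = \<Union>F"
    using Lindelof[of F] by (auto simp: F_def)
  have "\<Union>F' \<in> null_sets \<mu>"
    using F' assms(1) by (intro null_sets_UN'[of F' "\<lambda>U. U", simplified]) (auto simp: F_def null_sets_def)
  hence "AE a in \<mu>. a \<notin> \<Union>F'" by (rule AE_not_in)
  thus ?thesis
  proof (rule eventually_mono)
    fix a assume "a \<notin> \<Union>F'"
    hence "a \<in> measure_support \<mu>"
      unfolding F'(3) by (auto simp: F_def measure_support_def zero_less_iff_neq_zero)
    thus "a \<in> K" using assms(2) by blast
  qed
qed

lemma log_potential_parts:
  assumes sets: "sets \<mu> = sets borel" and ne: "AE a in \<mu>. a \<noteq> z"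
  shows "(\<integral>\<^sup>+ a. e2ennreal (elog (cmod (z - a))) \<partial>\<mu>) = (\<integral>\<^sup>+ a. ennreal (ln (cmod (z - a))) \<partial>\<mu>)"
    and "(\<integral>\<^sup>+ a. e2ennreal (- elog (cmod (z - a))) \<partial>\<mu>) = (\<integral>\<^sup>+ a. ennreal (- ln (cmod (z - a))) \<partial>\<mu>)"
  using ne by (auto intro!: nn_integral_cong_AE elim!: eventually_mono simp: elog_def)

lemma log_potential_eq_rpot:
  assumes sets: "sets \<mu> = sets borel" and ne: "AE a in \<mu>. a \<noteq> z"
    and int: "integrable \<mu> (\<lambda>a. ln (cmod (z - a)))"
  shows "log_potential \<mu> z = ereal (rpot \<mu> z)"
proof -
  define P where "P = (\<integral>\<^sup>+ a. ennreal (ln (cmod (z - a))) \<partial>\<mu>)"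
  define N where "N = (\<integral>\<^sup>+ a. ennreal (- ln (cmod (z - a))) \<partial>\<mu>)"
  have fin: "P \<noteq> \<infinity>" "N \<noteq> \<infinity>" using int unfolding P_def N_def real_integrable_def by auto
  have "rpot \<mu> z = enn2real P - enn2real N"
    unfolding rpot_def P_def N_def by (rule real_lebesgue_integral_def[OF int])
  moreover have "log_potential \<mu> z = enn2ereal P - enn2ereal N"
    unfolding log_potential_def log_potential_parts[OF sets ne] P_def N_def ..
  moreover have "enn2ereal P = ereal (enn2real P)" "enn2ereal N = ereal (enn2real N)"
    using fin by (cases P; cases N; simp add: enn2ereal_ennreal)+
  ultimately show ?thesis by simp
qed

text \<open>Finiteness of the potential excludes that the integral of the negative part, whose integrand
  is \<open>\<infinity>\<close> at \<open>z\<close>, is infinite.\<close>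

lemma log_potential_finite:
  assumes sets: "sets \<mu> = sets borel" and fin: "\<bar>log_potential \<mu> z\<bar> \<noteq> \<infinity>"
  shows "AE a in \<mu>. a \<noteq> z" "integrable \<mu> (\<lambda>a. ln (cmod (z - a)))"
proof -
  note [measurable_cong] = sets
  define P where "P = (\<integral>\<^sup>+ a. e2ennreal (elog (cmod (z - a))) \<partial>\<mu>)"
  define N where "N = (\<integral>\<^sup>+ a. e2ennreal (- elog (cmod (z - a))) \<partial>\<mu>)"
  have PN: "P \<noteq> \<infinity>" "N \<noteq> \<infinity>"
    using fin unfolding log_potential_def P_def[symmetric] N_def[symmetric]
    by (cases P; cases N; auto simp: enn2ereal_ennreal)+
  have "AE a in \<mu>. e2ennreal (- elog (cmod (z - a))) \<noteq> \<infinity>"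
    by (rule nn_integral_noteq_infinite) (use PN(2) in \<open>auto simp: N_def\<close>)
  thus ne: "AE a in \<mu>. a \<noteq> z" by (rule eventually_mono) (auto simp: elog_def)
  show "integrable \<mu> (\<lambda>a. ln (cmod (z - a)))"
    unfolding real_integrable_def using PN
    unfolding P_def N_def log_potential_parts[OF sets ne] by simp
qed

lemma ln_ge_inverse_sqrt:
  fixes y :: real assumes "y > 0"
  shows "- ln y \<le> 2 * y powr (- 1 / 2)"
proof -
  have "ln (y powr (- 1 / 2)) \<le> y powr (- 1 / 2) - 1" by (rule ln_le_minus_one) (use assms in simp)
  thus ?thesis using assms by (simp add: ln_powr)
qed

text \<open>The parametrisation is bi-Lipschitz, so this is at most the integral of \<open>ln (D L / |t - s|)\<close>
  over an interval of length \<open>l\<close>; the singularity is at most an inverse square root of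
  \<open>|t - s| / l\<close>.\<close>

lemma nn_integral_ln_arc:
  fixes \<gamma> :: "real \<Rightarrow> complex"
  assumes L: "L \<ge> 1" and I: "{c..c+l} \<subseteq> {0..1}" "l > 0" and s: "s \<in> {0..1}"
    and inv: "\<And>s t. s \<in> {0..1} \<Longrightarrow> t \<in> {0..1} \<Longrightarrow> \<bar>s - t\<bar> \<le> L * cmod (\<gamma> s - \<gamma> t)"
    and D: "D \<ge> 1"
  shows "(\<integral>\<^sup>+t\<in>{c..c+l}. ennreal (ln D - ln (cmod (\<gamma> t - \<gamma> s))) \<partial>lborel) \<le> ennreal (l * (ln D + ln L - ln l + 10))"
proof -
  have nn: "ln D + ln L - ln l \<ge> 0"
  proof -
    have "l \<le> 1" using I by auto
    hence "ln l \<le> 0" using I by (simp add: ln_le_zero_iff)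
    moreover have "ln D \<ge> 0" "ln L \<ge> 0" using D L by auto
    ultimately show ?thesis by linarith
  qed
  have "AE t in lborel. t \<noteq> s" using AE_lborel_singleton[of s] by auto
  hence "(\<integral>\<^sup>+t\<in>{c..c+l}. ennreal (ln D - ln (cmod (\<gamma> t - \<gamma> s))) \<partial>lborel) \<le>
     (\<integral>\<^sup>+t. ennreal (ln D + ln L - ln l) * indicator {c..c+l} t +
        ennreal (2 * sqrt l) * (ennreal (\<bar>t - s\<bar> powr (- 1 / 2)) * indicator {c..c+l} t) \<partial>lborel)"
  proof (intro nn_integral_mono_AE, elim eventually_mono)
    fix t :: real assume ts: "t \<noteq> s"
    show "ennreal (ln D - ln (cmod (\<gamma> t - \<gamma> s))) * indicator {c..c+l} t \<le>
      ennreal (ln D + ln L - ln l) * indicator {c..c+l} t +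
        ennreal (2 * sqrt l) * (ennreal (\<bar>t - s\<bar> powr (- 1 / 2)) * indicator {c..c+l} t)"
    proof (cases "t \<in> {c..c+l}")
      case True
      hence t: "t \<in> {0..1}" using I by auto
      define d where "d = \<bar>t - s\<bar>"
      have d: "d > 0" using ts by (simp add: d_def)
      have "d / L \<le> cmod (\<gamma> t - \<gamma> s)" using inv[OF t s] L by (simp add: d_def field_simps)
      hence "ln (d / L) \<le> ln (cmod (\<gamma> t - \<gamma> s))" using d L by (intro ln_mono) auto
      hence "ln D - ln (cmod (\<gamma> t - \<gamma> s)) \<le> ln D + ln L - ln d" using d L by (simp add: ln_div)
      also have "\<dots> = (ln D + ln L - ln l) + (- ln (d / l))" using d I by (simp add: ln_div)
      also have "- ln (d / l) \<le> 2 * (d / l) powr (- 1 / 2)" by (rule ln_ge_inverse_sqrt) (use d I in auto)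
      also have "2 * (d / l) powr (- 1 / 2) = 2 * sqrt l * d powr (- 1 / 2)"
        using d I by (simp add: powr_divide powr_minus_divide powr_half_sqrt)
      finally have "ln D - ln (cmod (\<gamma> t - \<gamma> s)) \<le> (ln D + ln L - ln l) + 2 * sqrt l * d powr (- 1 / 2)"
        by linarith
      hence "ennreal (ln D - ln (cmod (\<gamma> t - \<gamma> s))) \<le> ennreal ((ln D + ln L - ln l) + 2 * sqrt l * d powr (- 1 / 2))"
        by (rule ennreal_leI)
      also have "\<dots> = ennreal (ln D + ln L - ln l) + ennreal (2 * sqrt l) * ennreal (d powr (- 1 / 2))"
        using I nn by (subst ennreal_plus) (auto simp: ennreal_mult)
      finally show ?thesis using True by (simp add: d_def)
    qed simp
  qed
  also have "\<dots> = ennreal (ln D + ln L - ln l) * ennreal l +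
       ennreal (2 * sqrt l) * (\<integral>\<^sup>+t\<in>{c..c+l}. ennreal (\<bar>t - s\<bar> powr (- 1 / 2)) \<partial>lborel)"
  proof -
    have "(\<integral>\<^sup>+t. ennreal (ln D + ln L - ln l) * indicator {c..c+l} t \<partial>lborel) = ennreal (ln D + ln L - ln l) * ennreal l"
      using I by (subst nn_integral_cmult_indicator) auto
    moreover have "(\<integral>\<^sup>+t. ennreal (2 * sqrt l) * (ennreal (\<bar>t - s\<bar> powr (- 1 / 2)) * indicator {c..c+l} t) \<partial>lborel) =
      ennreal (2 * sqrt l) * (\<integral>\<^sup>+t\<in>{c..c+l}. ennreal (\<bar>t - s\<bar> powr (- 1 / 2)) \<partial>lborel)"
      by (rule nn_integral_cmult) measurable
    ultimately show ?thesis by (subst nn_integral_add) auto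
  qed
  also have "\<dots> \<le> ennreal (ln D + ln L - ln l) * ennreal l + ennreal (2 * sqrt l) * ennreal (5 * sqrt l)"
    by (intro add_left_mono mult_left_mono nn_integral_inverse_sqrt_dist I) auto
  also have "ennreal (2 * sqrt l) * ennreal (5 * sqrt l) = ennreal (l * 10)"
    using I by (subst ennreal_mult[symmetric]) (auto simp: algebra_simps)
  also have "ennreal (ln D + ln L - ln l) * ennreal l + ennreal (l * 10) = ennreal ((ln D + ln L - ln l) * l + l * 10)"
    using I nn by (subst ennreal_mult[symmetric], simp, simp, subst ennreal_plus[symmetric]) auto
  also have "(ln D + ln L - ln l) * l + l * 10 = l * (ln D + ln L - ln l + 10)" by (simp add: algebra_simps)
  finally show ?thesis .
qed

text \<open>A lower bound for the mean of \<open>ln |y - a|\<close> over the points \<open>y\<close> in a piece of the arc of size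
  \<open>R\<close> around \<open>x\<close>, minus \<open>ln |x - a|\<close>, in terms of \<open>\<rho> = |x - a|\<close>. It is large for \<open>\<rho>\<close> much smaller
  than \<open>R\<close>, and negative by no more than \<open>O(R / \<rho>)\<close> far away.\<close>

definition growth_kernel :: "real \<Rightarrow> real \<Rightarrow> real \<Rightarrow> real" where
  "growth_kernel C R \<rho> = max (- (3 * (1 + C) * (R / (R + \<rho>)))) (ln R - ln \<rho> - C)"

lemma growth_kernel_near:
  assumes C: "C \<ge> 0" and R: "R > 0" and \<rho>: "0 < \<rho>" "\<rho> < 2 * R"
  shows "growth_kernel C R \<rho> = ln R - ln \<rho> - C"
proof -
  have "ln \<rho> \<le> ln (2 * R)" using \<rho> R by (intro ln_mono) auto
  hence 1: "ln R - ln \<rho> \<ge> - 1" using R ln_le_minus_one[of 2] by (simp add: ln_mult)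
  have "1 / 3 \<le> R / (R + \<rho>)" using \<rho> R by (simp add: field_simps)
  hence "3 * (1 + C) * (1 / 3) \<le> 3 * (1 + C) * (R / (R + \<rho>))" using C by (intro mult_left_mono) auto
  moreover have "3 * (1 + C) * (1 / 3) = 1 + C" by simp
  ultimately have "- (3 * (1 + C) * (R / (R + \<rho>))) \<le> ln R - ln \<rho> - C" using 1 by linarith
  thus ?thesis unfolding growth_kernel_def by (rule max_absorb2)
qed

lemma growth_kernel_ge:
  "growth_kernel C R \<rho> \<ge> - (3 * (1 + C) * (R / (R + \<rho>)))" "growth_kernel C R \<rho> \<ge> ln R - ln \<rho> - C"
  by (auto simp: growth_kernel_def)

text \<open>The second entry of the maximum that defines the kernel comes from integrating the
  logarithmic singularity along the arc. For \<open>\<rho> \<ge> 2 R\<close> the logarithm varies by at most \<open>2 R / \<rho>\<close>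
  over the piece of the arc, which gives the first entry; for smaller \<open>\<rho>\<close> the maximum is the second
  entry. The constant \<open>D\<close>, which bounds the diameter of the arc in the application, makes the
  right-hand side nonnegative.\<close>

lemma ln_arc_le_kernel:
  fixes \<gamma> :: "real \<Rightarrow> complex"
  assumes L: "L \<ge> 1" and I: "{c..c+l} \<subseteq> {0..1}" "l > 0" "t\<^sub>0 \<in> {c..c+l}" and s: "s \<in> {0..1}"
    and lip: "\<And>s t. s \<in> {0..1} \<Longrightarrow> t \<in> {0..1} \<Longrightarrow> cmod (\<gamma> s - \<gamma> t) \<le> L * \<bar>s - t\<bar>"
    and inv: "\<And>s t. s \<in> {0..1} \<Longrightarrow> t \<in> {0..1} \<Longrightarrow> \<bar>s - t\<bar> \<le> L * cmod (\<gamma> s - \<gamma> t)"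
    and D: "D \<ge> 1" "cmod (\<gamma> t\<^sub>0 - \<gamma> s) \<le> D"
    and \<rho>: "\<rho> = cmod (\<gamma> t\<^sub>0 - \<gamma> s)" "\<rho> > 0" and C: "C = 2 * ln L + 10" and R: "R = L * l"
  shows "(\<integral>\<^sup>+t\<in>{c..c+l}. ennreal (ln D - ln (cmod (\<gamma> t - \<gamma> s))) \<partial>lborel) \<le>
      ennreal (l * (ln D - ln \<rho> - growth_kernel C R \<rho>))"
    and "ln D - ln \<rho> - growth_kernel C R \<rho> \<ge> 0"
proof -
  have C0: "C \<ge> 0" using L by (simp add: C)
  have R0: "R > 0" using L I by (simp add: R)
  have gen: "(\<integral>\<^sup>+t\<in>{c..c+l}. ennreal (ln D - ln (cmod (\<gamma> t - \<gamma> s))) \<partial>lborel) \<le>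
      ennreal (l * (ln D - ln \<rho> - (ln R - ln \<rho> - C)))"
    using nn_integral_ln_arc[OF L I(1,2) s inv D(1)] L I by (simp add: R C ln_mult algebra_simps)
  have D0: "ln D - ln \<rho> \<ge> 0" using D \<rho> by simp
  have C1: "0 \<le> 3 * (1 + C) * (R / (R + \<rho>))" using C0 R0 \<rho> by (intro mult_nonneg_nonneg) auto
  have g0: "ln D - ln \<rho> - (ln R - ln \<rho> - C) \<ge> 0"
  proof -
    have "l \<le> 1" using I by auto
    hence "ln l \<le> 0" using I by (simp add: ln_le_zero_iff)
    moreover have "ln D \<ge> 0" "ln L \<ge> 0" using D L by auto
    moreover have "ln D - ln \<rho> - (ln R - ln \<rho> - C) = ln D + ln L - ln l + 10"
      using L I by (simp add: R C ln_mult)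
    ultimately show ?thesis by linarith
  qed
  show "ln D - ln \<rho> - growth_kernel C R \<rho> \<ge> 0"
  proof -
    have "growth_kernel C R \<rho> \<le> ln D - ln \<rho>"
      unfolding growth_kernel_def by (rule max.boundedI) (use g0 D0 C1 in linarith)+
    thus ?thesis by simp
  qed
  show "(\<integral>\<^sup>+t\<in>{c..c+l}. ennreal (ln D - ln (cmod (\<gamma> t - \<gamma> s))) \<partial>lborel) \<le>
      ennreal (l * (ln D - ln \<rho> - growth_kernel C R \<rho>))"
  proof (cases "\<rho> < 2 * R")
    case True
    thus ?thesis using gen growth_kernel_near[OF C0 R0 \<rho>(2)] by simp
  next
    case False
    hence far: "2 * R \<le> \<rho>" by simp
    have pt: "ln D - ln (cmod (\<gamma> t - \<gamma> s)) \<le> ln D - ln \<rho> + 3 * (1 + C) * (R / (R + \<rho>))" if t: "t \<in> {c..c+l}" for t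
    proof -
      have "cmod (\<gamma> t - \<gamma> t\<^sub>0) \<le> L * \<bar>t - t\<^sub>0\<bar>" using t I by (intro lip) auto
      also have "\<dots> \<le> R" using t I L unfolding R by (intro mult_left_mono) auto
      finally have "\<rho> - R \<le> cmod (\<gamma> t - \<gamma> s)"
        using norm_triangle_ineq2[of "\<gamma> t\<^sub>0 - \<gamma> s" "\<gamma> t\<^sub>0 - \<gamma> t"] by (simp add: \<rho>(1) norm_minus_commute)
      hence "ln (\<rho> - R) \<le> ln (cmod (\<gamma> t - \<gamma> s))" using far R0 by (intro ln_mono) auto
      moreover have "ln \<rho> - ln (\<rho> - R) \<le> 2 * R / \<rho>"
      proof -
        have "ln (\<rho> / (\<rho> - R)) \<le> \<rho> / (\<rho> - R) - 1" using far R0 by (intro ln_le_minus_one) auto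
        also have "\<dots> = R / (\<rho> - R)" using far R0 by (simp add: field_simps)
        also have "\<dots> \<le> R / (\<rho> / 2)" using far R0 by (intro divide_left_mono) auto
        also have "\<dots> = 2 * R / \<rho>" by simp
        finally show ?thesis using far R0 by (simp add: ln_div)
      qed
      moreover have "2 * R / \<rho> \<le> 3 * (R / (R + \<rho>))" using far R0 by (simp add: field_simps)
      moreover have "3 * (R / (R + \<rho>)) \<le> 3 * (1 + C) * (R / (R + \<rho>))"
        using C0 R0 \<rho> by (intro mult_right_mono) auto
      ultimately show ?thesis by linarith
    qed
    have "(\<integral>\<^sup>+t\<in>{c..c+l}. ennreal (ln D - ln (cmod (\<gamma> t - \<gamma> s))) \<partial>lborel) \<le>
       (\<integral>\<^sup>+t. ennreal (ln D - ln \<rho> + 3 * (1 + C) * (R / (R + \<rho>))) * indicator {c..c+l} t \<partial>lborel)"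
      using pt by (intro nn_integral_mono) (auto simp: indicator_def intro!: ennreal_leI)
    also have "\<dots> = ennreal (l * (ln D - ln \<rho> - (- (3 * (1 + C) * (R / (R + \<rho>))))))"
    proof -
      define q where "q = ln D - ln \<rho> + 3 * (1 + C) * (R / (R + \<rho>))"
      have q: "q \<ge> 0" using D0 C1 by (simp add: q_def)
      have "(\<integral>\<^sup>+t. ennreal q * indicator {c..c+l} t \<partial>lborel) = ennreal (q * l)"
        using I q by (subst nn_integral_cmult_indicator) (auto simp: ennreal_mult)
      thus ?thesis unfolding diff_minus_eq_add q_def[symmetric] by (simp add: mult.commute)
    qed
    finally have far': "(\<integral>\<^sup>+t\<in>{c..c+l}. ennreal (ln D - ln (cmod (\<gamma> t - \<gamma> s))) \<partial>lborel) \<le> \<dots>" .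
    show ?thesis using gen far' by (simp add: growth_kernel_def max_def)
  qed
qed

lemma integrable_cutoff:
  fixes \<mu> :: "complex measure"
  assumes "prob_space \<mu>" and sets: "sets \<mu> = sets borel" and s: "s > 0"
  shows "integrable \<mu> (\<lambda>a. s / (s + cmod (x - a)))" "(\<integral>a. s / (s + cmod (x - a)) \<partial>\<mu>) \<le> 1"
proof -
  interpret prob_space \<mu> by fact
  note [measurable_cong] = sets
  have bd: "0 \<le> s / (s + cmod (x - a))" "s / (s + cmod (x - a)) \<le> 1" for a
  proof -
    have "s + cmod (x - a) > 0" using s by (intro add_pos_nonneg) auto
    thus "0 \<le> s / (s + cmod (x - a))" "s / (s + cmod (x - a)) \<le> 1" using s by auto
  qed
  show int: "integrable \<mu> (\<lambda>a. s / (s + cmod (x - a)))"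
  proof (rule integrable_const_bound[where B = 1])
    show "AE a in \<mu>. norm (s / (s + cmod (x - a))) \<le> 1"
      unfolding real_norm_def abs_of_nonneg[OF bd(1)] using bd(2) by (rule AE_I2)
  qed measurable
  have "(\<integral>a. s / (s + cmod (x - a)) \<partial>\<mu>) \<le> (\<integral>a. 1 \<partial>\<mu>)" by (intro integral_mono int bd) auto
  thus "(\<integral>a. s / (s + cmod (x - a)) \<partial>\<mu>) \<le> 1" by (simp add: prob_space)
qed

text \<open>Integrating the kernel against \<open>\<mu>\<close> compares the mean of the potential over a piece of the arc
  of size \<open>R\<close> with its value at \<open>x\<^sub>0\<close>. By Hoelder continuity on \<open>K\<close> the difference is at most
  \<open>H * R powr \<beta>\<close>.\<close>

lemma integral_growth_kernel_le:
  fixes \<gamma> :: "real \<Rightarrow> complex"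
  assumes "prob_space \<mu>" and sets: "sets \<mu> = sets borel" and AEK: "AE a in \<mu>. a \<in> K"
    and K: "K = \<gamma> ` {0..1}" and [measurable]: "\<gamma> \<in> borel_measurable borel" and L: "L \<ge> 1"
    and lip: "\<And>s t. s \<in> {0..1} \<Longrightarrow> t \<in> {0..1} \<Longrightarrow> cmod (\<gamma> s - \<gamma> t) \<le> L * \<bar>s - t\<bar>"
    and inv: "\<And>s t. s \<in> {0..1} \<Longrightarrow> t \<in> {0..1} \<Longrightarrow> \<bar>s - t\<bar> \<le> L * cmod (\<gamma> s - \<gamma> t)"
    and ne: "\<And>z. z \<in> K \<Longrightarrow> AE a in \<mu>. a \<noteq> z"
    and int: "\<And>z. z \<in> K \<Longrightarrow> integrable \<mu> (\<lambda>a. ln (cmod (z - a)))"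
    and H: "H \<ge> 0" "\<beta> > 0" "\<And>x y. x \<in> K \<Longrightarrow> y \<in> K \<Longrightarrow> \<bar>rpot \<mu> x - rpot \<mu> y\<bar> \<le> H * cmod (x - y) powr \<beta>"
    and x0: "x\<^sub>0 \<in> K" and l: "0 < l" "l \<le> 1 / 2" and C: "C = 2 * ln L + 10" and R: "R = L * l"
  shows "integrable \<mu> (\<lambda>a. growth_kernel C R (cmod (x\<^sub>0 - a)))"
    and "(\<integral>a. growth_kernel C R (cmod (x\<^sub>0 - a)) \<partial>\<mu>) \<le> H * R powr \<beta>"
proof -
  interpret prob_space \<mu> by fact
  note [measurable_cong] = sets
  have R0: "R > 0" using L l by (simp add: R)
  define b where "b = (\<lambda>a. growth_kernel C R (cmod (x\<^sub>0 - a)))"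
  have bint: "integrable \<mu> b"
    unfolding b_def growth_kernel_def
  proof (intro integrable_max)
    show "integrable \<mu> (\<lambda>a. - (3 * (1 + C) * (R / (R + cmod (x\<^sub>0 - a)))))"
      by (intro integrable_minus integrable_mult_right integrable_cutoff assms(1) sets R0)
    show "integrable \<mu> (\<lambda>a. ln R - ln (cmod (x\<^sub>0 - a)) - C)" using int[OF x0] by simp
  qed
  thus "integrable \<mu> (\<lambda>a. growth_kernel C R (cmod (x\<^sub>0 - a)))" by (simp add: b_def)
  obtain t0 where t0: "t0 \<in> {0..1}" "x\<^sub>0 = \<gamma> t0" using x0 K by auto
  \<comment> \<open>a piece on one side of \<open>t0\<close>, chosen to remain inside the parameter interval\<close>
  define c where "c = (if t0 \<le> 1 / 2 then t0 else t0 - l)"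
  have I: "{c..c+l} \<subseteq> {0..1}" "t0 \<in> {c..c+l}" using t0 l by (auto simp: c_def)
  define D where "D = max 1 L"
  have D: "D \<ge> 1" by (simp add: D_def)
  have DK: "cmod (x - y) \<le> D" if "x \<in> K" "y \<in> K" for x y
  proof -
    from that obtain s t where st: "s \<in> {0..1}" "t \<in> {0..1}" "x = \<gamma> s" "y = \<gamma> t" by (auto simp: K)
    hence "L * \<bar>s - t\<bar> \<le> L * 1" using L by (intro mult_left_mono) auto
    hence "cmod (\<gamma> s - \<gamma> t) \<le> L" using lip[OF st(1,2)] by linarith
    thus ?thesis using st L by (simp add: D_def)
  qed
  have nn: "AE a in \<mu>. 0 \<le> ln D - ln (cmod (x\<^sub>0 - a)) - b a"
    using AEK ne[OF x0]
  proof eventually_elim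
    case (elim a)
    then obtain s where s: "s \<in> {0..1}" "a = \<gamma> s" by (auto simp: K)
    show ?case unfolding b_def s(2) t0(2)
      by (rule ln_arc_le_kernel(2)[OF L I(1) l(1) I(2) s(1) lip inv D _ refl _ C R])
         (use elim s t0 DK[OF x0, of a] in auto)
  qed
  define J where "J = {c..c+l}"
  have [measurable]: "J \<in> sets borel" by (simp add: J_def)
  have \<gamma>K: "\<gamma> t \<in> K" if "t \<in> J" for t using that I by (auto simp: J_def K)
  have "ennreal (l * (ln D - rpot \<mu> x\<^sub>0 - H * R powr \<beta>)) =
        (\<integral>\<^sup>+t\<in>J. ennreal (ln D - rpot \<mu> x\<^sub>0 - H * R powr \<beta>) \<partial>lborel)"
    unfolding J_def using l by (subst nn_integral_cmult_indicator) (auto simp: ennreal_mult' mult.commute[of _ "ennreal l"])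
  also have "\<dots> \<le> (\<integral>\<^sup>+t\<in>J. (\<integral>\<^sup>+a. ennreal (ln D - ln (cmod (\<gamma> t - a))) \<partial>\<mu>) \<partial>lborel)"
  proof (rule nn_integral_mono)
    fix t
    show "ennreal (ln D - rpot \<mu> x\<^sub>0 - H * R powr \<beta>) * indicator J t \<le>
      (\<integral>\<^sup>+a. ennreal (ln D - ln (cmod (\<gamma> t - a))) \<partial>\<mu>) * indicator J t"
    proof (cases "t \<in> J")
      case True
      have "(\<integral>\<^sup>+a. ennreal (ln D - ln (cmod (\<gamma> t - a))) \<partial>\<mu>) = ennreal (\<integral>a. ln D - ln (cmod (\<gamma> t - a)) \<partial>\<mu>)"
      proof (rule nn_integral_eq_integral)
        show "AE a in \<mu>. 0 \<le> ln D - ln (cmod (\<gamma> t - a))"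
          using AEK ne[OF \<gamma>K[OF True]]
        proof eventually_elim
          case (elim a)
          thus ?case using DK[OF \<gamma>K[OF True], of a] D by simp
        qed
      qed (use int[OF \<gamma>K[OF True]] in simp)
      also have "(\<integral>a. ln D - ln (cmod (\<gamma> t - a)) \<partial>\<mu>) = ln D - rpot \<mu> (\<gamma> t)"
        using int[OF \<gamma>K[OF True]] by (simp add: rpot_def prob_space)
      also have "ennreal (ln D - rpot \<mu> (\<gamma> t)) \<ge> ennreal (ln D - rpot \<mu> x\<^sub>0 - H * R powr \<beta>)"
      proof (rule ennreal_leI)
        have "cmod (\<gamma> t - \<gamma> t0) \<le> L * \<bar>t - t0\<bar>" using True I t0 by (intro lip) (auto simp: J_def)
        also have "\<dots> \<le> R" using True I L unfolding R by (intro mult_left_mono) (auto simp: J_def)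
        finally have "cmod (\<gamma> t - x\<^sub>0) powr \<beta> \<le> R powr \<beta>" using H(2) t0(2) by (intro powr_mono2) auto
        hence "H * cmod (\<gamma> t - x\<^sub>0) powr \<beta> \<le> H * R powr \<beta>" using H(1) by (rule mult_left_mono)
        thus "ln D - rpot \<mu> x\<^sub>0 - H * R powr \<beta> \<le> ln D - rpot \<mu> (\<gamma> t)"
          using H(3)[OF \<gamma>K[OF True] x0] by linarith
      qed
      finally show ?thesis using True by simp
    qed simp
  qed
  also have "\<dots> = (\<integral>\<^sup>+t. (\<integral>\<^sup>+a. ennreal (ln D - ln (cmod (\<gamma> t - a))) * indicator J t \<partial>\<mu>) \<partial>lborel)"
    by (intro nn_integral_cong nn_integral_multc[symmetric]) measurable
  also have "\<dots> = (\<integral>\<^sup>+a. (\<integral>\<^sup>+t\<in>J. ennreal (ln D - ln (cmod (\<gamma> t - a))) \<partial>lborel) \<partial>\<mu>)"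
  proof -
    interpret pair_sigma_finite lborel \<mu> ..
    show ?thesis by (rule Fubini'[symmetric]) measurable
  qed
  also have "\<dots> \<le> (\<integral>\<^sup>+a. ennreal (l * (ln D - ln (cmod (x\<^sub>0 - a)) - b a)) \<partial>\<mu>)"
  proof (rule nn_integral_mono_AE)
    show "AE a in \<mu>. (\<integral>\<^sup>+t\<in>J. ennreal (ln D - ln (cmod (\<gamma> t - a))) \<partial>lborel) \<le> ennreal (l * (ln D - ln (cmod (x\<^sub>0 - a)) - b a))"
      using AEK ne[OF x0]
    proof eventually_elim
      case (elim a)
      then obtain s where s: "s \<in> {0..1}" "a = \<gamma> s" by (auto simp: K)
      show ?case unfolding J_def b_def s(2) t0(2)
        by (rule ln_arc_le_kernel(1)[OF L I(1) l(1) I(2) s(1) lip inv D _ refl _ C R])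
           (use elim s t0 DK[OF x0, of a] in auto)
    qed
  qed
  also have "\<dots> = ennreal (\<integral>a. l * (ln D - ln (cmod (x\<^sub>0 - a)) - b a) \<partial>\<mu>)"
  proof (rule nn_integral_eq_integral)
    show "AE a in \<mu>. 0 \<le> l * (ln D - ln (cmod (x\<^sub>0 - a)) - b a)"
      using nn by eventually_elim (use l in simp)
  qed (use int[OF x0] bint in simp)
  also have "(\<integral>a. l * (ln D - ln (cmod (x\<^sub>0 - a)) - b a) \<partial>\<mu>) = l * (ln D - rpot \<mu> x\<^sub>0 - integral\<^sup>L \<mu> b)"
    using int[OF x0] bint by (simp add: rpot_def prob_space)
  finally have le: "ennreal (l * (ln D - rpot \<mu> x\<^sub>0 - H * R powr \<beta>)) \<le> ennreal (l * (ln D - rpot \<mu> x\<^sub>0 - integral\<^sup>L \<mu> b))" .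
  have "0 \<le> (\<integral>a. ln D - ln (cmod (x\<^sub>0 - a)) - b a \<partial>\<mu>)"
    using nn by (rule integral_nonneg_AE)
  also have "\<dots> = ln D - rpot \<mu> x\<^sub>0 - integral\<^sup>L \<mu> b"
    using int[OF x0] bint by (simp add: rpot_def prob_space)
  finally have "0 \<le> l * (ln D - rpot \<mu> x\<^sub>0 - integral\<^sup>L \<mu> b)" using l by simp
  hence "l * (ln D - rpot \<mu> x\<^sub>0 - H * R powr \<beta>) \<le> l * (ln D - rpot \<mu> x\<^sub>0 - integral\<^sup>L \<mu> b)"
    using le by (simp add: ennreal_le_iff)
  thus "(\<integral>a. growth_kernel C R (cmod (x\<^sub>0 - a)) \<partial>\<mu>) \<le> H * R powr \<beta>"
    using l by (simp add: b_def)
qed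

text \<open>The function \<open>s / (s + \<rho>)\<close> is a smooth substitute for the indicator of \<open>\<rho> \<le> s\<close>. Passing to a
  scale \<open>R\<close> that is larger by a big factor \<open>\<Lambda>\<close> gains a factor \<open>1 / 2\<close>: for \<open>\<rho> \<le> \<surd>\<Lambda> s\<close> the kernel is
  at least \<open>N\<close>, and for larger \<open>\<rho>\<close> the function is much smaller at scale \<open>s\<close> than at scale \<open>R\<close>. The
  size of \<open>N\<close> absorbs the negative part of the kernel.\<close>

lemma scale_step:
  assumes C: "C \<ge> 0" and N: "N \<ge> 1" "N \<ge> 12 * (1 + C)" and \<Lambda>: "\<Lambda> \<ge> exp (2 * (N + C))" "\<Lambda> \<ge> 64"
    and s: "s > 0" and R: "R = \<Lambda> * s" and \<rho>: "\<rho> > 0"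
  shows "s / (s + \<rho>) \<le> growth_kernel C R \<rho> / N + 1 / 2 * (R / (R + \<rho>))"
proof -
  have R0: "R > 0" using \<Lambda> s by (simp add: R)
  have f: "0 \<le> R / (R + \<rho>)" using R0 \<rho> by simp
  have N0: "N > 0" using N by simp
  have "12 * (1 + C) * (R / (R + \<rho>)) \<le> N * (R / (R + \<rho>))" by (rule mult_right_mono[OF N(2) f])
  hence "growth_kernel C R \<rho> \<ge> - (1 / 4) * (N * (R / (R + \<rho>)))"
    using growth_kernel_ge(1)[of C R \<rho>] by linarith
  hence "growth_kernel C R \<rho> / N \<ge> (- (1 / 4) * (N * (R / (R + \<rho>)))) / N"
    using N0 by (intro divide_right_mono) auto
  hence kN: "growth_kernel C R \<rho> / N \<ge> - (1 / 4) * (R / (R + \<rho>))" using N0 by simp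
  have sq: "sqrt \<Lambda> \<ge> 8" using \<Lambda>(2) by (intro real_le_rsqrt) auto
  show ?thesis
  proof (cases "\<rho> \<le> sqrt \<Lambda> * s")
    case True
    have "ln \<rho> \<le> ln (sqrt \<Lambda> * s)" using True \<rho> by (intro ln_mono) auto
    also have "\<dots> = ln \<Lambda> / 2 + ln s" using \<Lambda>(2) s by (simp add: ln_mult ln_sqrt)
    finally have "ln R - ln \<rho> \<ge> ln \<Lambda> / 2" using \<Lambda>(2) s by (simp add: R ln_mult)
    moreover have "2 * (N + C) \<le> ln \<Lambda>" using \<Lambda> by (simp add: ln_ge_iff)
    ultimately have "growth_kernel C R \<rho> \<ge> N" using growth_kernel_ge(2)[where C = C and R = R and \<rho> = \<rho>] by argo
    hence "growth_kernel C R \<rho> / N \<ge> 1" using N0 by simp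
    moreover have "s / (s + \<rho>) \<le> 1" using s \<rho> by simp
    ultimately show ?thesis using f by linarith
  next
    case False
    have "s / (s + \<rho>) \<le> s / \<rho>" using s \<rho> by (intro divide_left_mono) auto
    also have "s / \<rho> \<le> 1 / 4 * (R / (R + \<rho>))"
    proof -
      have "4 * (R + \<rho>) * s \<le> R * \<rho>"
      proof -
        have "8 * s \<le> \<rho>" using False sq s mult_right_mono[of 8 "sqrt \<Lambda>" s] by linarith
        hence "R * (8 * s) \<le> R * \<rho>" using R0 by (intro mult_left_mono) auto
        moreover have "8 * s * \<rho> \<le> R * \<rho>" unfolding R using \<Lambda>(2) s \<rho> by (intro mult_right_mono) auto
        ultimately show ?thesis by (simp add: algebra_simps)
      qed
      thus ?thesis using R0 \<rho> by (simp add: field_simps)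
    qed
    finally show ?thesis using kN by linarith
  qed
qed

text \<open>Iterating the halving over the scales \<open>\<Lambda> ^ n\<close> gives a power. The exponent is chosen with
  \<open>\<Lambda> powr \<kappa> \<le> 3 / 2\<close>, so that the induction hypothesis accounts for three quarters of the bound; the
  remaining quarter absorbs the error term.\<close>

lemma half_step_decay:
  fixes \<Lambda> R\<^sub>0 C \<beta> :: real and f :: "'a \<Rightarrow> real \<Rightarrow> real"
  assumes \<Lambda>: "\<Lambda> > 1" and R0: "R\<^sub>0 > 0" and C: "C \<ge> 0" and \<beta>: "\<beta> > 0"
    and f1: "\<And>x s. x \<in> X \<Longrightarrow> s > 0 \<Longrightarrow> f x s \<le> 1"
    and step: "\<And>x s. x \<in> X \<Longrightarrow> s > 0 \<Longrightarrow> \<Lambda> * s \<le> R\<^sub>0 \<Longrightarrow> f x s \<le> 1 / 2 * f x (\<Lambda> * s) + C * (\<Lambda> * s) powr \<beta>"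
  obtains \<kappa> B where "0 < \<kappa>" "\<kappa> \<le> 1" "B > 0" "\<And>x s. x \<in> X \<Longrightarrow> s > 0 \<Longrightarrow> f x s \<le> B * s powr \<kappa>"
proof -
  define \<kappa> where "\<kappa> = min 1 (min \<beta> (ln (3 / 2) / ln \<Lambda>))"
  have "ln \<Lambda> > 0" using \<Lambda> by simp
  hence \<kappa>: "0 < \<kappa>" "\<kappa> \<le> 1" "\<kappa> \<le> \<beta>" "\<kappa> \<le> ln (3 / 2) / ln \<Lambda>" using \<beta> by (auto simp: \<kappa>_def)
  have \<Lambda>\<kappa>: "\<Lambda> powr \<kappa> \<le> 3 / 2"
  proof -
    have "\<kappa> * ln \<Lambda> \<le> ln (3 / 2)" using \<kappa>(4) \<open>ln \<Lambda> > 0\<close> by (simp add: field_simps)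
    hence "exp (\<kappa> * ln \<Lambda>) \<le> exp (ln (3 / 2))" by (subst exp_le_cancel_iff)
    thus ?thesis using \<Lambda> by (simp add: powr_def)
  qed
  define s1 where "s1 = R\<^sub>0 / \<Lambda>"
  have s1: "s1 > 0" using R0 \<Lambda> by (simp add: s1_def)
  define E where "E = R\<^sub>0 powr (\<beta> - \<kappa>)"
  define B where "B = s1 powr (- \<kappa>) + 6 * C * E"
  have B: "B \<ge> s1 powr (- \<kappa>)" "B \<ge> 6 * (C * E)" "B > 0"
    using C s1 by (auto simp: B_def E_def intro!: add_pos_nonneg)
  show ?thesis
  proof (rule that[OF \<kappa>(1,2) B(3)])
    fix x s assume x: "x \<in> X" and s: "(s::real) > 0"
    have base: "f x s \<le> B * s powr \<kappa>" if "s \<ge> s1" for s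
    proof -
      have "1 = s1 powr (- \<kappa>) * s1 powr \<kappa>" using s1 by (simp add: powr_minus)
      also have "\<dots> \<le> B * s powr \<kappa>" using B s1 that \<kappa> by (intro mult_mono powr_mono2) auto
      finally show ?thesis using f1[OF x, of s] that s1 by linarith
    qed
    have ind: "f x s \<le> B * s powr \<kappa>" if "s > 0" "s1 \<le> \<Lambda> ^ n * s" for n s
      using that
    proof (induction n arbitrary: s)
      case 0
      thus ?case using base by simp
    next
      case (Suc n)
      show ?case
      proof (cases "s \<ge> s1")
        case False
        hence le: "\<Lambda> * s \<le> R\<^sub>0" using \<Lambda> by (simp add: s1_def field_simps)
        have pos: "\<Lambda> * s > 0" using Suc.prems(1) \<Lambda> by simp
        have IH: "f x (\<Lambda> * s) \<le> B * (\<Lambda> * s) powr \<kappa>" by (rule Suc.IH) (use Suc.prems pos in \<open>auto simp: mult_ac\<close>)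
        have sk: "(\<Lambda> * s) powr \<kappa> \<le> 3 / 2 * s powr \<kappa>"
          using Suc.prems(1) \<Lambda> \<Lambda>\<kappa> by (simp add: powr_mult mult_right_mono)
        have "(\<Lambda> * s) powr \<beta> = (\<Lambda> * s) powr (\<beta> - \<kappa>) * (\<Lambda> * s) powr \<kappa>" using pos by (simp add: powr_add[symmetric])
        also have "\<dots> \<le> E * (3 / 2 * s powr \<kappa>)"
          using le pos \<kappa> sk unfolding E_def by (intro mult_mono powr_mono2) auto
        finally have b: "C * (\<Lambda> * s) powr \<beta> \<le> C * (E * (3 / 2 * s powr \<kappa>))" using C by (rule mult_left_mono)
        have "B * (\<Lambda> * s) powr \<kappa> \<le> B * (3 / 2 * s powr \<kappa>)" using B(3) sk by (intro mult_left_mono) auto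
        hence "f x s \<le> 1 / 2 * (B * (3 / 2 * s powr \<kappa>)) + C * (E * (3 / 2 * s powr \<kappa>))"
          using step[OF x Suc.prems(1) le] IH b by linarith
        also have "\<dots> = (3 / 4 * B + 1 / 4 * (6 * (C * E))) * s powr \<kappa>" by (simp add: algebra_simps)
        also have "\<dots> \<le> (3 / 4 * B + 1 / 4 * B) * s powr \<kappa>" using B(2) by (intro mult_right_mono) auto
        finally show ?thesis by simp
      qed (rule base)
    qed
    obtain n where "s1 / s < \<Lambda> ^ n" using real_arch_pow[OF \<Lambda>] by blast
    thus "f x s \<le> B * s powr \<kappa>" using s by (intro ind[of s n]) (auto simp: field_simps)
  qed
qed

text \<open>Power growth of the mass at all scales bounds the Riesz potential of half the exponent:
  decompose into dyadic shells and sum a geometric series.\<close>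

lemma riesz_potential_bound:
  fixes \<mu> :: "complex measure"
  assumes "prob_space \<mu>" and sets: "sets \<mu> = sets borel" and \<kappa>: "0 < \<kappa>" "\<kappa> \<le> 1" and B: "B > 0"
    and growth: "\<And>s. s > 0 \<Longrightarrow> (\<integral>a. s / (s + cmod (x - a)) \<partial>\<mu>) \<le> B * s powr \<kappa>"
  shows "(\<integral>\<^sup>+a. ennreal (cmod (x - a) powr (- (\<kappa> / 2))) \<partial>\<mu>) \<le> ennreal (1 + 4 * B / (1 - 2 powr (- (\<kappa> / 2))))"
proof -
  interpret prob_space \<mu> by fact
  note [measurable_cong] = sets
  define q where "q = 2 powr (\<kappa> / 2)"
  have q: "q > 1" "q \<le> 2"
    using powr_less_mono[of 0 "\<kappa>/2" 2] powr_mono[of "\<kappa>/2" 1 2] \<kappa> by (auto simp: q_def)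
  define g where "g = (\<lambda>k a. 4 * q ^ k * ((1 / 2) ^ k / ((1 / 2) ^ k + cmod (x - a))))"
  have g0: "g k a \<ge> 0" for k a using q by (auto simp: g_def intro!: mult_nonneg_nonneg divide_nonneg_nonneg add_nonneg_nonneg)
  have [measurable]: "g k \<in> borel_measurable \<mu>" for k unfolding g_def by measurable
  have pt: "ennreal (cmod (x - a) powr (- (\<kappa> / 2))) \<le> 1 + (\<Sum>k. ennreal (g k a))" for a
  proof -
    define \<rho> where "\<rho> = cmod (x - a)"
    have \<rho>0: "\<rho> \<ge> 0" by (simp add: \<rho>_def)
    consider "\<rho> = 0" | "\<rho> \<ge> 1" | "0 < \<rho>" "\<rho> < 1" using \<rho>0 by linarith
    hence "ennreal (\<rho> powr (- (\<kappa> / 2))) \<le> 1 + (\<Sum>k. ennreal (g k a))"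
    proof cases
      case 1 thus ?thesis by simp
    next
      case 2
      hence "\<rho> powr (- (\<kappa> / 2)) \<le> 1" using ge_one_powr_ge_zero[of \<rho> "\<kappa> / 2"] \<kappa> by (simp add: powr_minus inverse_le_1_iff)
      hence "ennreal (\<rho> powr (- (\<kappa> / 2))) \<le> 1" by simp
      thus ?thesis by (rule order.trans) simp
    next
      case 3
      \<comment> \<open>\<open>\<rho>\<close> lies in the dyadic shell between \<open>1 / 2 ^ n\<close> and \<open>1 / 2 ^ (n - 1)\<close>\<close>
      define n where "n = (LEAST n. 1 / \<rho> < (2::real) ^ n)"
      have n: "1 / \<rho> < 2 ^ n" unfolding n_def by (rule LeastI_ex) (rule real_arch_pow, simp)
      have "n \<noteq> 0" using n 3 by (intro notI) (simp add: field_simps)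
      then obtain k where k: "n = Suc k" by (cases n) auto
      have k': "2 ^ k \<le> 1 / \<rho>" using not_less_Least[of k "\<lambda>n. 1 / \<rho> < (2::real) ^ n"] k by (auto simp: n_def[symmetric])
      have "\<rho> powr (- (\<kappa> / 2)) = (1 / \<rho>) powr (\<kappa> / 2)" using 3 by (simp add: powr_minus powr_divide inverse_eq_divide)
      also have "\<dots> \<le> (2 ^ n) powr (\<kappa> / 2)" using n 3 \<kappa> by (intro powr_mono2) auto
      also have "\<dots> = q ^ n" by (simp add: q_def powr_realpow[symmetric] powr_powr mult.commute)
      also have "q ^ n \<le> 2 * q ^ k" using q by (simp add: k)
      also have "\<dots> \<le> g k a"
      proof -
        have "\<rho> \<le> (1 / 2) ^ k" using k' 3 by (simp add: field_simps power_one_over)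
        hence "1 / 2 \<le> (1 / 2) ^ k / ((1 / 2) ^ k + \<rho>)" using 3 by (simp add: divide_simps add_pos_pos)
        hence "4 * q ^ k * (1 / 2) \<le> 4 * q ^ k * ((1 / 2) ^ k / ((1 / 2) ^ k + \<rho>))" using q by (intro mult_left_mono) auto
        thus ?thesis by (simp add: g_def \<rho>_def)
      qed
      finally have "ennreal (\<rho> powr (- (\<kappa> / 2))) \<le> ennreal (g k a)" by (rule ennreal_leI)
      also have "\<dots> = (\<Sum>j\<in>{k}. ennreal (g j a))" by simp
      also have "\<dots> \<le> (\<Sum>k. ennreal (g k a))" by (rule sum_le_suminf) auto
      finally show ?thesis by (rule order.trans) simp
    qed
    thus ?thesis by (simp add: \<rho>_def)
  qed
  have gi: "(\<integral>\<^sup>+a. ennreal (g k a) \<partial>\<mu>) \<le> ennreal (4 * B * (1 / q) ^ k)" for k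
  proof -
    define s :: real where "s = (1 / 2) ^ k"
    have s: "s > 0" by (simp add: s_def)
    note int = integrable_cutoff(1)[OF assms(1) sets s, of x]
    have "(\<integral>\<^sup>+a. ennreal (g k a) \<partial>\<mu>) = ennreal (\<integral>a. g k a \<partial>\<mu>)"
    proof (rule nn_integral_eq_integral)
      show "integrable \<mu> (g k)" unfolding g_def s_def[symmetric] by (rule integrable_mult_right[OF int])
    qed (use g0 in auto)
    also have "(\<integral>a. g k a \<partial>\<mu>) = 4 * q ^ k * (\<integral>a. s / (s + cmod (x - a)) \<partial>\<mu>)"
      unfolding g_def s_def[symmetric] by (rule integral_mult_right_zero)
    also have "\<dots> \<le> 4 * q ^ k * (B * s powr \<kappa>)" using growth[OF s] q by (intro mult_left_mono) auto
    also have "s powr \<kappa> = (1 / q ^ 2) ^ k"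
    proof -
      have "q ^ 2 = 2 powr \<kappa>" by (simp add: q_def power2_eq_square powr_add[symmetric])
      hence "1 / q ^ 2 = (1 / 2) powr \<kappa>" by (simp add: powr_divide)
      moreover have "s powr \<kappa> = ((1 / 2) powr \<kappa>) ^ k"
        by (simp add: s_def powr_realpow[symmetric] powr_powr mult.commute)
      ultimately show ?thesis by simp
    qed
    also have "4 * q ^ k * (B * (1 / q ^ 2) ^ k) = 4 * B * (1 / q) ^ k"
      using q by (simp add: power_one_over power2_eq_square power_mult_distrib field_simps)
    finally show ?thesis by (simp add: ennreal_leI)
  qed
  have "(\<integral>\<^sup>+a. ennreal (cmod (x - a) powr (- (\<kappa> / 2))) \<partial>\<mu>) \<le> (\<integral>\<^sup>+a. 1 + (\<Sum>k. ennreal (g k a)) \<partial>\<mu>)"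
    by (intro nn_integral_mono pt)
  also have "\<dots> = (\<integral>\<^sup>+a. 1 \<partial>\<mu>) + (\<integral>\<^sup>+a. (\<Sum>k. ennreal (g k a)) \<partial>\<mu>)" by (rule nn_integral_add) measurable
  also have "\<dots> = 1 + (\<Sum>k. \<integral>\<^sup>+a. ennreal (g k a) \<partial>\<mu>)" by (subst nn_integral_suminf) (auto simp: emeasure_space_1)
  also have "\<dots> \<le> 1 + (\<Sum>k. ennreal (4 * B * (1 / q) ^ k))" by (intro add_left_mono suminf_le gi) auto
  also have "(\<Sum>k. ennreal (4 * B * (1 / q) ^ k)) = ennreal (4 * B * (1 / (1 - 1 / q)))"
  proof (rule suminf_ennreal_eq)
    show "(\<lambda>k. 4 * B * (1 / q) ^ k) sums (4 * B * (1 / (1 - 1 / q)))"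
      by (intro sums_mult geometric_sums) (use q in auto)
  qed (use B q in auto)
  also have "1 + ennreal (4 * B * (1 / (1 - 1 / q))) = ennreal (1 + 4 * B / (1 - 1 / q))"
    using B q by (subst ennreal_plus) (auto simp: divide_simps)
  also have "1 / q = 2 powr (- (\<kappa> / 2))" by (simp add: q_def powr_minus_divide)
  finally show ?thesis .
qed

text \<open>A point \<open>a\<close> of \<open>K\<close> is at most twice as far from the nearest point \<open>x\<close> of \<open>z\<close> in \<open>K\<close> as from
  \<open>z\<close>.\<close>

lemma riesz_potential_everywhere:
  fixes \<mu> :: "complex measure"
  assumes K: "closed K" "K \<noteq> {}" and AEK: "AE a in \<mu>. a \<in> K" and sets: "sets \<mu> = sets borel" and \<kappa>: "\<kappa> > 0" "\<kappa> \<le> 1" and M: "M \<ge> 0"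
    and ne: "\<And>z. z \<in> K \<Longrightarrow> AE a in \<mu>. a \<noteq> z"
    and riesz: "\<And>x. x \<in> K \<Longrightarrow> (\<integral>\<^sup>+a. ennreal (cmod (x - a) powr (- \<kappa>)) \<partial>\<mu>) \<le> ennreal M"
  shows "(\<integral>\<^sup>+a. ennreal (cmod (z - a) powr (- \<kappa>)) \<partial>\<mu>) \<le> ennreal (2 * M)" and "AE a in \<mu>. a \<noteq> z"
proof -
  note [measurable_cong] = sets
  show nez: "AE a in \<mu>. a \<noteq> z"
  proof (cases "z \<in> K")
    case False
    thus ?thesis using AEK by (auto elim!: eventually_mono)
  qed (rule ne)
  obtain x where x: "x \<in> K" "infdist z K = dist z x" using infdist_attains_inf[OF K] by blast
  have "(\<integral>\<^sup>+a. ennreal (cmod (z - a) powr (- \<kappa>)) \<partial>\<mu>) \<le> (\<integral>\<^sup>+a. ennreal 2 * ennreal (cmod (x - a) powr (- \<kappa>)) \<partial>\<mu>)"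
  proof (rule nn_integral_mono_AE)
    show "AE a in \<mu>. ennreal (cmod (z - a) powr (- \<kappa>)) \<le> ennreal 2 * ennreal (cmod (x - a) powr (- \<kappa>))"
      using AEK nez ne[OF x(1)]
    proof eventually_elim
      case (elim a)
      have "dist z x \<le> dist z a" using infdist_le[OF elim(1), of z] x(2) by simp
      hence le: "cmod (x - a) \<le> 2 * cmod (z - a)"
        using norm_triangle_ineq4[of "z - a" "z - x"] by (simp add: dist_norm)
      have "cmod (z - a) powr (- \<kappa>) \<le> (cmod (x - a) / 2) powr (- \<kappa>)"
        using le elim \<kappa> by (intro powr_mono2') auto
      also have "\<dots> = 2 powr \<kappa> * cmod (x - a) powr (- \<kappa>)" by (simp add: powr_divide powr_minus field_simps)
      also have "\<dots> \<le> 2 powr 1 * cmod (x - a) powr (- \<kappa>)" using \<kappa> by (intro mult_right_mono powr_mono) auto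
      finally have "ennreal (cmod (z - a) powr (- \<kappa>)) \<le> ennreal (2 * cmod (x - a) powr (- \<kappa>))"
        by (intro ennreal_leI) simp
      also have "\<dots> = ennreal 2 * ennreal (cmod (x - a) powr (- \<kappa>))" by (rule ennreal_mult') simp
      finally show ?case .
    qed
  qed
  also have "\<dots> = ennreal 2 * (\<integral>\<^sup>+a. ennreal (cmod (x - a) powr (- \<kappa>)) \<partial>\<mu>)" by (rule nn_integral_cmult) measurable
  also have "\<dots> \<le> ennreal 2 * ennreal M" by (intro mult_left_mono riesz x) auto
  also have "\<dots> = ennreal (2 * M)" using M by (simp add: ennreal_mult)
  finally show "(\<integral>\<^sup>+a. ennreal (cmod (z - a) powr (- \<kappa>)) \<partial>\<mu>) \<le> ennreal (2 * M)" .
qed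

lemma ln_one_plus_le_powr:
  fixes q \<kappa> :: real
  assumes "q \<ge> 0" "0 < \<kappa>" "\<kappa> \<le> 1"
  shows "ln (1 + q) \<le> q powr \<kappa> / \<kappa>"
proof -
  have "1 + q \<le> (1 + q powr \<kappa>) powr (1 / \<kappa>)"
  proof (cases "q = 0")
    case False
    have "(1 + q) powr \<kappa> \<le> 1 powr \<kappa> + q powr \<kappa>"
    proof -
      have "1 = 1 / (1 + q) + q / (1 + q)" using assms by (simp add: add_divide_distrib[symmetric])
      also have "\<dots> \<le> (1 / (1 + q)) powr \<kappa> + (q / (1 + q)) powr \<kappa>"
      proof (rule add_mono)
        show "1 / (1 + q) \<le> (1 / (1 + q)) powr \<kappa>"
          using powr_mono'[of \<kappa> 1 "1 / (1 + q)"] assms by (simp add: field_simps)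
        show "q / (1 + q) \<le> (q / (1 + q)) powr \<kappa>"
          using powr_mono'[of \<kappa> 1 "q / (1 + q)"] assms by (simp add: field_simps)
      qed
      also have "\<dots> = (1 powr \<kappa> + q powr \<kappa>) / (1 + q) powr \<kappa>" using assms by (simp add: powr_divide add_divide_distrib)
      finally show ?thesis using assms by (simp add: field_simps)
    qed
    hence "((1 + q) powr \<kappa>) powr (1 / \<kappa>) \<le> (1 + q powr \<kappa>) powr (1 / \<kappa>)" using assms by (intro powr_mono2) auto
    thus ?thesis using assms by (simp add: powr_powr)
  qed (use assms in simp)
  hence "ln (1 + q) \<le> ln ((1 + q powr \<kappa>) powr (1 / \<kappa>))" using assms by (intro ln_mono) auto
  also have "\<dots> = ln (1 + q powr \<kappa>) / \<kappa>" by (simp add: ln_powr)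
  also have "\<dots> \<le> q powr \<kappa> / \<kappa>" using assms by (intro divide_right_mono ln_add_one_self_le_self) auto
  finally show ?thesis .
qed

text \<open>With \<open>q = |z - z'| / |z' - a|\<close> the difference of the logarithms is at most
  \<open>ln (1 + q) \<le> q powr \<kappa> / \<kappa>\<close>, which integrates to a Riesz potential of order \<open>\<kappa>\<close>.\<close>

lemma rpot_holder_of_riesz:
  fixes \<mu> :: "complex measure"
  assumes "prob_space \<mu>" and sets: "sets \<mu> = sets borel" and AEK: "AE a in \<mu>. a \<in> K" "bounded K"
    and \<kappa>: "\<kappa> > 0" "\<kappa> \<le> 1" and M: "M \<ge> 0"
    and ne: "\<And>z. AE a in \<mu>. a \<noteq> z"
    and riesz: "\<And>z. (\<integral>\<^sup>+a. ennreal (cmod (z - a) powr (- \<kappa>)) \<partial>\<mu>) \<le> ennreal M"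
  shows "integrable \<mu> (\<lambda>a. ln (cmod (z - a)))"
    and "\<bar>rpot \<mu> z - rpot \<mu> z'\<bar> \<le> M / \<kappa> * cmod (z - z') powr \<kappa>"
proof -
  interpret prob_space \<mu> by fact
  note [measurable_cong] = sets
  have ri: "integrable \<mu> (\<lambda>a. cmod (z - a) powr (- \<kappa>))" for z
    using riesz[of z] by (intro integrableI_nonneg) (auto intro: le_less_trans)
  have rM: "(\<integral>a. cmod (z - a) powr (- \<kappa>) \<partial>\<mu>) \<le> M" for z
    using riesz[of z] nn_integral_eq_integral[OF ri[of z]] M by simp
  have int: "integrable \<mu> (\<lambda>a. ln (cmod (z - a)))" for z
  proof -
    obtain B0 where B0: "\<And>b. b \<in> K \<Longrightarrow> cmod b \<le> B0" using AEK(2) by (auto simp: bounded_iff)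
    have "integrable \<mu> (\<lambda>a. (cmod z + B0) + cmod (z - a) powr (- \<kappa>) / \<kappa>)" using ri by simp
    thus ?thesis
    proof (rule Bochner_Integration.integrable_bound)
      show "AE a in \<mu>. norm (ln (cmod (z - a))) \<le> norm ((cmod z + B0) + cmod (z - a) powr (- \<kappa>) / \<kappa>)"
        using AEK(1) ne[of z]
      proof eventually_elim
        case (elim a)
        define \<rho> where "\<rho> = cmod (z - a)"
        have \<rho>: "\<rho> > 0" "\<rho> \<le> cmod z + B0"
          using elim B0[OF elim(1)] norm_triangle_ineq4[of z a] by (auto simp: \<rho>_def)
        have "ln \<rho> \<le> \<rho>" using ln_le_minus_one[OF \<rho>(1)] by simp
        moreover have "- ln \<rho> \<le> \<rho> powr (- \<kappa>) / \<kappa>"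
        proof -
          have "ln (\<rho> powr (- \<kappa>)) \<le> \<rho> powr (- \<kappa>)" using ln_le_minus_one[of "\<rho> powr (- \<kappa>)"] \<rho> by simp
          thus ?thesis using \<rho> \<kappa> by (simp add: ln_powr field_simps)
        qed
        moreover have "0 \<le> \<rho> powr (- \<kappa>) / \<kappa>" using \<kappa> by simp
        ultimately have "\<bar>ln \<rho>\<bar> \<le> (cmod z + B0) + \<rho> powr (- \<kappa>) / \<kappa>" using \<rho> by linarith
        thus ?case unfolding \<rho>_def[symmetric] by simp
      qed
    qed measurable
  qed
  thus "integrable \<mu> (\<lambda>a. ln (cmod (z - a)))" .
  have one: "rpot \<mu> z - rpot \<mu> z' \<le> M / \<kappa> * cmod (z - z') powr \<kappa>" for z z'
  proof -
    have "rpot \<mu> z - rpot \<mu> z' = (\<integral>a. ln (cmod (z - a)) - ln (cmod (z' - a)) \<partial>\<mu>)"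
      using int by (simp add: rpot_def)
    also have "\<dots> \<le> (\<integral>a. cmod (z - z') powr \<kappa> / \<kappa> * cmod (z' - a) powr (- \<kappa>) \<partial>\<mu>)"
    proof (rule integral_mono_AE)
      show "AE a in \<mu>. ln (cmod (z - a)) - ln (cmod (z' - a)) \<le> cmod (z - z') powr \<kappa> / \<kappa> * cmod (z' - a) powr (- \<kappa>)"
        using ne[of z] ne[of z']
      proof eventually_elim
        case (elim a)
        have p: "cmod (z - a) > 0" "cmod (z' - a) > 0" using elim by auto
        have "ln (cmod (z - a)) - ln (cmod (z' - a)) = ln (cmod (z - a) / cmod (z' - a))" using p by (simp add: ln_div)
        also have "\<dots> \<le> ln (1 + cmod (z - z') / cmod (z' - a))"
        proof (rule ln_mono)
          have "cmod (z - a) \<le> cmod (z' - a) + cmod (z - z')"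
            using norm_triangle_ineq[of "z' - a" "z - z'"] by simp
          thus "cmod (z - a) / cmod (z' - a) \<le> 1 + cmod (z - z') / cmod (z' - a)" using p by (simp add: field_simps)
        qed (use p in simp)
        also have "\<dots> \<le> (cmod (z - z') / cmod (z' - a)) powr \<kappa> / \<kappa>" by (rule ln_one_plus_le_powr) (use \<kappa> in auto)
        also have "\<dots> = cmod (z - z') powr \<kappa> / \<kappa> * cmod (z' - a) powr (- \<kappa>)"
          by (simp add: powr_divide powr_minus field_simps)
        finally show ?case .
      qed
    qed (use int ri in auto)
    also have "\<dots> = cmod (z - z') powr \<kappa> / \<kappa> * (\<integral>a. cmod (z' - a) powr (- \<kappa>) \<partial>\<mu>)" by simp
    also have "\<dots> \<le> cmod (z - z') powr \<kappa> / \<kappa> * M" using rM \<kappa> by (intro mult_left_mono) auto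
    finally show ?thesis by (simp add: mult.commute)
  qed
  show "\<bar>rpot \<mu> z - rpot \<mu> z'\<bar> \<le> M / \<kappa> * cmod (z - z') powr \<kappa>"
    using one[of z z'] one[of z' z] by (simp add: norm_minus_commute abs_le_iff)
qed

text \<open>The mass near \<open>x\<close> at scale \<open>s\<close>, measured by the integral \<open>f x s\<close> of \<open>s / (s + |x - a|)\<close>,
  satisfies the halving inequality between scales, hence decays like a power of \<open>s\<close>.\<close>

lemma smooth_arc_potential_holder:
  assumes K: "smooth_nonclosed_curve K" and \<mu>: "prob_space \<mu>" "sets \<mu> = sets borel" and supp: "measure_support \<mu> \<subseteq> K"
    and fin: "\<forall>z\<in>K. \<bar>log_potential \<mu> z\<bar> \<noteq> \<infinity>"
    and hol: "holder_continuous_on K (\<lambda>z. real_of_ereal (log_potential \<mu> z))"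
  obtains \<kappa> H where "0 < \<kappa>" "\<kappa> \<le> 1" "H \<ge> 0"
    "\<And>z. integrable \<mu> (\<lambda>a. ln (cmod (z - a)))"
    "\<And>z. log_potential \<mu> z = ereal (rpot \<mu> z)"
    "\<And>z z'. \<bar>rpot \<mu> z - rpot \<mu> z'\<bar> \<le> H * cmod (z - z') powr \<kappa>"
proof -
  interpret prob_space \<mu> by fact
  note [measurable_cong] = \<mu>(2)
  note top = smooth_nonclosed_curve_topology[OF K]
  have AEK: "AE a in \<mu>. a \<in> K" by (rule AE_in_support[OF \<mu>(2) supp])
  have ne: "AE a in \<mu>. a \<noteq> z" and int: "integrable \<mu> (\<lambda>a. ln (cmod (z - a)))" if "z \<in> K" for z
    using log_potential_finite[OF \<mu>(2)] fin that by auto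
  have lp: "real_of_ereal (log_potential \<mu> z) = rpot \<mu> z" if "z \<in> K" for z
    using log_potential_eq_rpot[OF \<mu>(2) ne[OF that] int[OF that]] by simp
  obtain C \<beta> where \<beta>: "0 < \<beta>" and C: "\<And>x y. x \<in> K \<Longrightarrow> y \<in> K \<Longrightarrow>
      dist (real_of_ereal (log_potential \<mu> x)) (real_of_ereal (log_potential \<mu> y)) \<le> C * dist x y powr \<beta>"
    using hol unfolding holder_continuous_on_def by blast
  define H where "H = max C 0"
  have H: "H \<ge> 0" "\<bar>rpot \<mu> x - rpot \<mu> y\<bar> \<le> H * cmod (x - y) powr \<beta>" if "x \<in> K" "y \<in> K" for x y
  proof -
    have "\<bar>rpot \<mu> x - rpot \<mu> y\<bar> \<le> C * cmod (x - y) powr \<beta>"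
      using C[OF that] lp that by (simp add: dist_norm)
    also have "\<dots> \<le> H * cmod (x - y) powr \<beta>" by (intro mult_right_mono) (auto simp: H_def)
    finally show "\<bar>rpot \<mu> x - rpot \<mu> y\<bar> \<le> H * cmod (x - y) powr \<beta>" .
  qed (simp add: H_def)
  have H0: "H \<ge> 0" by (simp add: H_def)
  obtain \<gamma> L where \<gamma>K: "K = \<gamma> ` {0..1}" and \<gamma>c: "continuous_on UNIV \<gamma>" and L: "L \<ge> 1"
    and lip: "\<And>s t. s \<in> {0..1} \<Longrightarrow> t \<in> {0..1} \<Longrightarrow> cmod (\<gamma> s - \<gamma> t) \<le> L * \<bar>s - t\<bar>"
    and inv: "\<And>s t. s \<in> {0..1} \<Longrightarrow> t \<in> {0..1} \<Longrightarrow> \<bar>s - t\<bar> \<le> L * cmod (\<gamma> s - \<gamma> t)"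
    using smooth_nonclosed_curve_parametrisation[OF K] by metis
  have \<gamma>m: "\<gamma> \<in> borel_measurable borel" using \<gamma>c by (rule borel_measurable_continuous_onI)
  define C0 where "C0 = 2 * ln L + 10"
  have C0: "C0 \<ge> 0" using L by (simp add: C0_def)
  define N where "N = 12 * (1 + C0)"
  have N: "N \<ge> 1" "N \<ge> 12 * (1 + C0)" using C0 by (auto simp: N_def)
  define \<Lambda> where "\<Lambda> = max 64 (exp (2 * (N + C0)))"
  have \<Lambda>: "\<Lambda> \<ge> exp (2 * (N + C0))" "\<Lambda> \<ge> 64" "\<Lambda> > 1" by (auto simp: \<Lambda>_def)
  define f where "f = (\<lambda>x s. \<integral>a. s / (s + cmod (x - a)) \<partial>\<mu>)"
  note fint = integrable_cutoff(1)[OF \<mu>]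
  have f1: "f x s \<le> 1" if "s > 0" for s x unfolding f_def by (rule integrable_cutoff(2)[OF \<mu> that])
  have step: "f x s \<le> 1 / 2 * f x (\<Lambda> * s) + H / N * (\<Lambda> * s) powr \<beta>"
    if x: "x \<in> K" and s: "s > 0" "\<Lambda> * s \<le> L / 2" for x s
  proof -
    define R where "R = \<Lambda> * s"
    define l where "l = R / L"
    have R: "R = L * l" "R > 0" using L s \<Lambda> by (auto simp: l_def R_def)
    have l: "0 < l" "l \<le> 1 / 2" using R L s(2) by (auto simp: l_def R_def field_simps)
    note ker = integral_growth_kernel_le[OF \<mu> AEK \<gamma>K \<gamma>m L lip inv ne int H0 \<beta> H(2) x l C0_def R(1)]
    have "f x s \<le> (\<integral>a. growth_kernel C0 R (cmod (x - a)) / N + 1 / 2 * (R / (R + cmod (x - a))) \<partial>\<mu>)"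
      unfolding f_def
    proof (rule integral_mono_AE[OF fint[OF s(1)]])
      show "integrable \<mu> (\<lambda>a. growth_kernel C0 R (cmod (x - a)) / N + 1 / 2 * (R / (R + cmod (x - a))))"
        by (intro Bochner_Integration.integrable_add integrable_mult_right fint[OF R(2)] integrable_divide ker(1))
      show "AE a in \<mu>. s / (s + cmod (x - a)) \<le> growth_kernel C0 R (cmod (x - a)) / N + 1 / 2 * (R / (R + cmod (x - a)))"
        using ne[OF x]
      proof eventually_elim
        case (elim a)
        show ?case by (rule scale_step[OF C0 N \<Lambda>(1,2) s(1) R_def]) (use elim in auto)
      qed
    qed
    also have "\<dots> = (\<integral>a. growth_kernel C0 R (cmod (x - a)) \<partial>\<mu>) / N + 1 / 2 * f x R"
    proof -
      have "(\<integral>a. growth_kernel C0 R (cmod (x - a)) / N + 1 / 2 * (R / (R + cmod (x - a))) \<partial>\<mu>) =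
          (\<integral>a. growth_kernel C0 R (cmod (x - a)) / N \<partial>\<mu>) + (\<integral>a. 1 / 2 * (R / (R + cmod (x - a))) \<partial>\<mu>)"
        by (intro Bochner_Integration.integral_add integrable_mult_right fint[OF R(2)] integrable_divide ker(1))
      also have "(\<integral>a. 1 / 2 * (R / (R + cmod (x - a))) \<partial>\<mu>) = 1 / 2 * f x R"
        unfolding f_def by (rule integral_mult_right_zero)
      also have "(\<integral>a. growth_kernel C0 R (cmod (x - a)) / N \<partial>\<mu>) = (\<integral>a. growth_kernel C0 R (cmod (x - a)) \<partial>\<mu>) / N"
        by (rule integral_divide_zero)
      finally show ?thesis .
    qed
    also have "\<dots> \<le> (H * R powr \<beta>) / N + 1 / 2 * f x R"
      using ker(2) N by (intro add_right_mono divide_right_mono) auto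
    finally show ?thesis by (simp add: R_def)
  qed
  have pre: "L / 2 > 0" "H / N \<ge> 0" using L H0 N by auto
  obtain \<kappa> B where \<kappa>: "0 < \<kappa>" "\<kappa> \<le> 1" and B: "B > 0"
    and fB: "\<And>x s. x \<in> K \<Longrightarrow> s > 0 \<Longrightarrow> f x s \<le> B * s powr \<kappa>"
    using half_step_decay[OF \<Lambda>(3) pre \<beta>, of K f] f1 step by blast
  have growth: "(\<integral>a. s / (s + cmod (x - a)) \<partial>\<mu>) \<le> B * s powr \<kappa>" if "x \<in> K" "s > 0" for x s
    using fB[OF that] by (simp add: f_def)
  define M1 where "M1 = 1 + 4 * B / (1 - 2 powr (- (\<kappa> / 2)))"
  have "2 powr (- (\<kappa> / 2)) < 2 powr (0::real)" using \<kappa> by (intro powr_less_mono) auto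
  hence M1: "M1 \<ge> 0" using B by (simp add: M1_def)
  have riesz: "(\<integral>\<^sup>+a. ennreal (cmod (x - a) powr (- (\<kappa> / 2))) \<partial>\<mu>) \<le> ennreal M1" if "x \<in> K" for x
    unfolding M1_def by (rule riesz_potential_bound[OF \<mu> \<kappa> B growth[OF that]])
  have \<kappa>2: "\<kappa> / 2 > 0" "\<kappa> / 2 \<le> 1" using \<kappa> by auto
  note ev = riesz_potential_everywhere[OF compact_imp_closed[OF top(1)] top(2) AEK \<mu>(2) \<kappa>2 M1 ne riesz]
  have M2: "2 * M1 \<ge> 0" using M1 by simp
  note hh = rpot_holder_of_riesz[OF \<mu> AEK compact_imp_bounded[OF top(1)] \<kappa>2 M2 ev(2) ev(1)]
  show ?thesis
    by (rule that[OF \<kappa>2 _ hh(1) log_potential_eq_rpot[OF \<mu>(2) ev(2) hh(1)] hh(2)]) (use M1 \<kappa> in auto)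
qed

section \<open>The maximum principle and the distance of the potentials\<close>

lemma infdist_lower:
  assumes "b \<in> K" shows "infdist a K \<le> cmod (a - b)"
  using infdist_le[OF assms, of a] by (simp add: dist_norm)

lemma rpot_circle_mean_off:
  assumes "prob_space \<mu>" "sets \<mu> = sets borel" "compact K" "AE a in \<mu>. a \<in> K"
    and s: "0 < s" "s < infdist a K"
  shows "((\<lambda>t. rpot \<mu> (circlepath a s t)) has_integral rpot \<mu> a) {0..1}"
  unfolding rpot_def[of \<mu> a]
proof (rule has_integral_rpot_circle[where K = K and e = "infdist a K - s"])
  fix t b assume b: "b \<in> K"
  show "infdist a K - s \<le> cmod (circlepath a s t - b)"
  proof -
    have "cmod (circlepath a s t - a) = s" using s by (simp add: circlepath norm_mult)
    thus ?thesis
      using norm_triangle_ineq4[of "circlepath a s t - b" "circlepath a s t - a"] infdist_lower[OF b, of a] by simp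
  qed
  show "((\<lambda>t. ln (cmod (circlepath a s t - b))) has_integral ln (cmod (a - b))) {0..1}"
    using infdist_lower[OF b, of a] s by (intro has_integral_ln_circle_outside) auto
qed (use assms in \<open>auto simp: compact_imp_closed compact_imp_bounded\<close>)

lemma rpot_circle_mean_far:
  assumes "prob_space \<mu>" "sets \<mu> = sets borel" "compact K" "AE a in \<mu>. a \<in> K"
    and r: "\<And>b. b \<in> K \<Longrightarrow> cmod (a - b) \<le> r" and s: "r < s" "0 < s"
  shows "((\<lambda>t. rpot \<mu> (circlepath a s t)) has_integral ln s) {0..1}"
proof -
  interpret prob_space \<mu> by fact
  have "((\<lambda>t. rpot \<mu> (circlepath a s t)) has_integral (\<integral>b. ln s \<partial>\<mu>)) {0..1}"
  proof (rule has_integral_rpot_circle[where K = K and e = "s - r"])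
    fix t b assume b: "b \<in> K"
    show "s - r \<le> cmod (circlepath a s t - b)"
    proof -
      have "cmod (circlepath a s t - a) = s" using s by (simp add: circlepath norm_mult)
      thus ?thesis using norm_triangle_ineq4[of "circlepath a s t - b" "a - b"] r[OF b] by simp
    qed
    show "((\<lambda>t. ln (cmod (circlepath a s t - b))) has_integral ln s) {0..1}"
      using r[OF b] s by (intro has_integral_ln_circle_inside) auto
  qed (use assms in \<open>auto simp: compact_imp_closed compact_imp_bounded\<close>)
  thus ?thesis by (simp add: prob_space)
qed

lemma continuous_mean_eq_bound:
  fixes f :: "real \<Rightarrow> real"
  assumes f: "continuous_on {0..1} f" "(f has_integral I) {0..1}" and le: "\<And>t. t \<in> {0..1} \<Longrightarrow> f t \<le> c"
    and I: "c \<le> I" and t: "t \<in> {0..1}"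
  shows "f t = c"
proof -
  have c: "((\<lambda>t. c) has_integral c) {0..1::real}" using has_integral_const_real[of c 0 1] by simp
  have "I \<le> c" by (rule has_integral_le[OF f(2) c]) (use le in auto)
  hence "((\<lambda>t. c - f t) has_integral 0) (cbox 0 1)" using has_integral_diff[OF c f(2)] I by simp
  hence "c - f t = 0"
    by (rule has_integral_0_cbox_imp_0[rotated 2]) (use f le t in \<open>auto intro!: continuous_intros\<close>)
  thus ?thesis by simp
qed

lemma continuous_on_circle:
  assumes "continuous_on UNIV f"
  shows "continuous_on A (\<lambda>t. f (circlepath a s t))"
  by (rule continuous_on_compose2[OF assms]) (auto simp: circlepath intro!: continuous_intros)

text \<open>The upper half of the statement that \<open>ln |Q| / n\<close> minus the potential tends to 0 at infinity.\<close>

lemma growth_at_infinity: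
  assumes "prob_space \<mu>" "sets \<mu> = sets borel" "AE a in \<mu>. a \<in> K" "integrable \<mu> (\<lambda>a. ln (cmod (z - a)))"
    and Q: "lead_coeff Q = 1" "\<And>b. poly Q b = 0 \<Longrightarrow> cmod b \<le> R" and K: "\<And>b. b \<in> K \<Longrightarrow> cmod b \<le> R"
    and z: "R < cmod z" "0 \<le> R"
  shows "cmod (poly Q z) * exp (- real (degree Q) * rpot \<mu> z) \<le> ((cmod z + R) / (cmod z - R)) ^ degree Q"
proof -
  interpret prob_space \<mu> by fact
  have nz: "poly Q z \<noteq> 0" using Q(2)[of z] z by auto
  have Q0: "Q \<noteq> 0" using Q(1) by auto
  have "ln (cmod (poly Q z)) = (\<Sum>b\<in>#proots Q. ln (cmod (z - b)))" by (rule ln_norm_poly_eq[OF Q(1) nz])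
  also have "\<dots> \<le> (\<Sum>b\<in>#proots Q. ln (cmod z + R))"
  proof (rule sum_mset_mono)
    fix b assume "b \<in># proots Q"
    hence b: "poly Q b = 0" using Q0 by simp
    hence "z \<noteq> b" using nz by auto
    thus "ln (cmod (z - b)) \<le> ln (cmod z + R)"
      using norm_triangle_ineq4[of z b] Q(2)[OF b] by (intro ln_mono) auto
  qed
  also have "\<dots> = degree Q * ln (cmod z + R)" by (simp add: size_proots_complex)
  finally have 1: "ln (cmod (poly Q z)) \<le> degree Q * ln (cmod z + R)" .
  have "(\<integral>a. ln (cmod z - R) \<partial>\<mu>) \<le> rpot \<mu> z" unfolding rpot_def
  proof (rule integral_mono_AE)
    show "AE a in \<mu>. ln (cmod z - R) \<le> ln (cmod (z - a))"
      using assms(3)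
    proof eventually_elim
      case (elim a)
      thus ?case using norm_triangle_ineq2[of z a] K[OF elim] z by (intro ln_mono) auto
    qed
  qed (use assms(4) in auto)
  hence 2: "ln (cmod z - R) \<le> rpot \<mu> z" by (simp add: prob_space)
  have "cmod (poly Q z) * exp (- real (degree Q) * rpot \<mu> z) = exp (ln (cmod (poly Q z)) - degree Q * rpot \<mu> z)"
    using nz by (simp add: exp_diff exp_minus field_simps)
  also have "\<dots> \<le> exp (degree Q * (ln (cmod z + R) - ln (cmod z - R)))"
    using 1 mult_left_mono[OF 2, of "real (degree Q)"] by (simp add: algebra_simps)
  also have "\<dots> = exp (ln ((cmod z + R) / (cmod z - R))) ^ degree Q"
    using z by (simp add: exp_of_nat_mult ln_div)
  also have "\<dots> = ((cmod z + R) / (cmod z - R)) ^ degree Q" using z by (subst exp_ln) (auto intro!: divide_pos_pos)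
  finally show ?thesis .
qed

text \<open>The function \<open>g = |Q| exp (-n U)\<close> is continuous, and the circle means of \<open>ln g\<close> dominate its
  values off \<open>K\<close>. It attains its maximum: if \<open>g > 1\<close> somewhere, since \<open>g\<close> tends to 1 at infinity,
  and if \<open>g \<le> 1\<close>, since the mean of \<open>ln g\<close> over a large circle is nonnegative, so that \<open>g = 1\<close> on
  it. Around a maximum point off \<open>K\<close>, \<open>g\<close> is constant on the circles that do not reach \<open>K\<close>, except
  possibly those through a root, and by continuity \<open>g\<close> has the same value at the nearest point of
  \<open>K\<close>. So the maximum is attained on \<open>K\<close>.\<close>

lemma poly_potential_max_principle:
  fixes Q :: "complex poly"
  assumes \<mu>: "prob_space \<mu>" "sets \<mu> = sets borel" and K: "compact K" "K \<noteq> {}" and AEK: "AE a in \<mu>. a \<in> K"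
    and int: "\<And>z. integrable \<mu> (\<lambda>a. ln (cmod (z - a)))"
    and cont: "continuous_on UNIV (rpot \<mu>)"
    and Q: "lead_coeff Q = 1" "degree Q > 0"
    and le: "\<And>z. z \<in> K \<Longrightarrow> cmod (poly Q z) \<le> exp (degree Q * (rpot \<mu> z + M))"
  shows "cmod (poly Q z) \<le> exp (degree Q * (rpot \<mu> z + M))"
proof -
  define n where "n = real (degree Q)"
  have n: "n > 0" using Q by (simp add: n_def)
  have Q0: "Q \<noteq> 0" using Q by auto
  define g where "g = (\<lambda>z. cmod (poly Q z) * exp (- n * rpot \<mu> z))"
  have gcont: "continuous_on UNIV g" unfolding g_def
    by (intro continuous_intros cont)
  have g0: "g z \<ge> 0" for z by (simp add: g_def)
  have gpos: "g z > 0 \<longleftrightarrow> poly Q z \<noteq> 0" for z by (simp add: g_def zero_less_mult_iff)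
  have lng: "ln (g z) = ln (cmod (poly Q z)) - n * rpot \<mu> z" if "poly Q z \<noteq> 0" for z
    using that by (simp add: g_def ln_mult)
  have iff: "cmod (poly Q z) \<le> exp (degree Q * (rpot \<mu> z + M)) \<longleftrightarrow> g z \<le> exp (n * M)" for z
  proof -
    have "exp (degree Q * (rpot \<mu> z + M)) = exp (n * M) * exp (n * rpot \<mu> z)"
      by (simp add: n_def exp_add[symmetric] algebra_simps)
    thus ?thesis by (simp add: g_def exp_minus field_simps)
  qed
  have roots: "finite {b. poly Q b = 0}" using Q0 by (rule poly_roots_finite)
  obtain R where R: "R \<ge> 0" "\<And>b. poly Q b = 0 \<Longrightarrow> cmod b \<le> R" "\<And>b. b \<in> K \<Longrightarrow> cmod b \<le> R"
  proof -
    have "bounded ({b. poly Q b = 0} \<union> K)" using roots K by (simp add: finite_imp_bounded compact_imp_bounded)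
    then obtain R where "R > 0" "\<forall>b\<in>{b. poly Q b = 0} \<union> K. cmod b \<le> R" by (auto simp: bounded_pos)
    thus ?thesis using that[of R] by auto
  qed
  have mean: "((\<lambda>t. ln (g (circlepath a s t))) has_integral jensen_mean Q a s - n * I) {0..1}"
    "continuous_on {0..1} (\<lambda>t. ln (g (circlepath a s t)))" "\<And>t. g (circlepath a s t) > 0"
    if s: "s > 0" "\<And>b. poly Q b = 0 \<Longrightarrow> cmod (a - b) \<noteq> s"
      and I: "((\<lambda>t. rpot \<mu> (circlepath a s t)) has_integral I) {0..1}" for a s I
  proof -
    have nr: "poly Q (circlepath a s t) \<noteq> 0" for t
      using s(2)[of "circlepath a s t"] s(1) by (auto simp: circlepath norm_mult)
    show "\<And>t. g (circlepath a s t) > 0" using nr gpos by simp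
    thus "continuous_on {0..1} (\<lambda>t. ln (g (circlepath a s t)))"
      by (intro continuous_on_ln continuous_on_circle gcont) (auto simp: less_imp_neq[symmetric])
    show "((\<lambda>t. ln (g (circlepath a s t))) has_integral jensen_mean Q a s - n * I) {0..1}"
      unfolding lng[OF nr]
      by (intro has_integral_diff has_integral_mult_right I has_integral_ln_poly_circle Q s)
  qed
  obtain z0 where z0: "\<And>z. g z \<le> g z0"
  proof (cases "\<exists>z1. g z1 > 1")
    case True
    then obtain z1 where z1: "g z1 > 1" by blast
    \<comment> \<open>the \<open>n\<close>-th root of \<open>g z1\<close>; \<open>B\<close> is the radius from which on the bound \<open>(|z| + R) / (|z| - R)\<close> is below it\<close>
    define y where "y = exp (ln (g z1) / n)"
    have y: "y > 1" "y ^ degree Q = g z1"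
      using z1 n by (auto simp: y_def exp_of_nat_mult[symmetric] n_def)
    define B where "B = max (R + 1) (R * (y + 1) / (y - 1) + 1)"
    have out: "g z < g z1" if z: "cmod z > B" for z
    proof -
      have zR: "cmod z > R" using z by (simp add: B_def)
      have "R * (y + 1) / (y - 1) < cmod z" using z by (simp add: B_def)
      hence "R * (y + 1) < cmod z * (y - 1)" using y by (simp add: pos_divide_less_eq)
      hence "(cmod z + R) / (cmod z - R) < y" using zR by (simp add: pos_divide_less_eq algebra_simps)
      hence "((cmod z + R) / (cmod z - R)) ^ degree Q < y ^ degree Q"
        using Q(2) zR R(1) by (intro power_strict_mono divide_nonneg_nonneg) auto
      moreover have "g z \<le> ((cmod z + R) / (cmod z - R)) ^ degree Q"
        unfolding g_def n_def by (rule growth_at_infinity[OF \<mu> AEK int Q(1) R(2) R(3) zR R(1)])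
      ultimately show ?thesis using y by simp
    qed
    have z1B: "z1 \<in> cball 0 B" using out[of z1] by force
    obtain z0 where z0: "z0 \<in> cball 0 B" "\<And>z. z \<in> cball 0 B \<Longrightarrow> g z \<le> g z0"
    proof -
      have "cball (0::complex) B \<noteq> {}" using z1B by blast
      moreover have "continuous_on (cball 0 B) g" by (rule continuous_on_subset[OF gcont]) simp
      ultimately have "\<exists>z0\<in>cball 0 B. \<forall>z\<in>cball 0 B. g z \<le> g z0"
        by (intro continuous_attains_sup compact_cball)
      thus ?thesis using that by blast
    qed
    have "g z \<le> g z0" for z
      using z0(2)[of z] z0(2)[OF z1B] out[of z] by (cases "z \<in> cball 0 B") auto
    thus ?thesis by (rule that)
  next
    case False
    hence g1: "g z \<le> 1" for z by (meson not_le)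
    define s where "s = R + 1"
    have s: "s > 0" "s > R" using R by (auto simp: s_def)
    have I: "((\<lambda>t. rpot \<mu> (circlepath 0 s t)) has_integral ln s) {0..1}"
      by (rule rpot_circle_mean_far[OF \<mu> K(1) AEK, where r = R]) (use R s in auto)
    have nr: "cmod (0 - b) \<noteq> s" if "poly Q b = 0" for b using R(2)[OF that] s by auto
    note m = mean[OF s(1) nr I]
    have "ln (g (circlepath 0 s 0)) = 0"
    proof (rule continuous_mean_eq_bound[OF m(2) m(1)])
      show "ln (g (circlepath 0 s t)) \<le> 0" for t using m(3)[of t] g1 by simp
      show "0 \<le> jensen_mean Q 0 s - n * ln s"
        using degree_ln_le_circle_mean[OF s(1), of Q 0] by (simp add: n_def)
    qed auto
    hence "g (circlepath 0 s 0) = 1" using m(3)[of 0] by simp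
    thus ?thesis using g1 that by metis
  qed
  have "g z0 \<le> exp (n * M)"
  proof (rule ccontr)
    assume "\<not> g z0 \<le> exp (n * M)"
    hence big: "g z0 > exp (n * M)" by simp
    have gz0: "g z0 > 0" using big exp_gt_zero[of "n * M"] by linarith
    have Qz0: "poly Q z0 \<noteq> 0" using gz0 gpos by simp
    have clK: "closed K" using K by (simp add: compact_imp_closed)
    obtain x where x: "x \<in> K" "infdist z0 K = dist z0 x" using infdist_attains_inf[OF clK K(2)] by blast
    have gx: "g x \<le> exp (n * M)" using le[OF x(1)] iff by simp
    define d where "d = infdist z0 K"
    have d: "d > 0" using x gx big by (auto simp: d_def)
    define u where "u = (x - z0) / of_real d"
    have u: "cmod u = 1" using x d by (simp add: u_def d_def dist_norm norm_divide norm_minus_commute)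
    \<comment> \<open>the radii of the circles around \<open>z0\<close> that pass through a root\<close>
    define F where "F = (\<lambda>b. cmod (z0 - b)) ` {b. poly Q b = 0}"
    have F: "finite F" using roots by (simp add: F_def)
    have spread: "g (z0 + of_real s * u) = g z0" if s: "0 < s" "s < d" "s \<notin> F" for s
    proof -
      have I: "((\<lambda>t. rpot \<mu> (circlepath z0 s t)) has_integral rpot \<mu> z0) {0..1}"
        by (rule rpot_circle_mean_off[OF \<mu> K(1) AEK s(1)]) (use s in \<open>simp add: d_def\<close>)
      have nr: "cmod (z0 - b) \<noteq> s" if "poly Q b = 0" for b using s(3) that by (auto simp: F_def)
      note m = mean[OF s(1) nr I]
      have "z0 + of_real s * u \<in> path_image (circlepath z0 s)"
        using u s by (simp add: path_image_circlepath dist_norm norm_mult)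
      then obtain t where t: "t \<in> {0..1}" "z0 + of_real s * u = circlepath z0 s t" by (auto simp: path_image_def)
      have "ln (g (circlepath z0 s t)) = ln (g z0)"
      proof (rule continuous_mean_eq_bound[OF m(2) m(1) _ _ t(1)])
        show "ln (g (circlepath z0 s t)) \<le> ln (g z0)" for t using m(3)[of t] z0 by (intro ln_mono) auto
        show "ln (g z0) \<le> jensen_mean Q z0 s - n * rpot \<mu> z0"
          using ln_norm_poly_le_circle_mean[OF Q(1) Qz0 s(1)] lng[OF Qz0] by simp
      qed
      thus ?thesis using m(3)[of t] gz0 t(2) by simp
    qed
    have "g (z0 + of_real d * u) = g z0"
    proof (rule ccontr)
      assume ne: "g (z0 + of_real d * u) \<noteq> g z0"
      have "continuous_on UNIV (\<lambda>s. g (z0 + of_real s * u))"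
        by (rule continuous_on_compose2[OF gcont]) (auto intro!: continuous_intros)
      hence "isCont (\<lambda>s. g (z0 + of_real s * u)) d" by (simp add: continuous_on_eq_continuous_at)
      hence "eventually (\<lambda>s. g (z0 + of_real s * u) \<noteq> g z0) (at d)"
        using ne by (intro tendsto_imp_eventually_ne) (auto simp: isCont_def)
      then obtain e where e: "e > 0" "\<And>s. s \<noteq> d \<Longrightarrow> dist s d < e \<Longrightarrow> g (z0 + of_real s * u) \<noteq> g z0"
        by (auto simp: eventually_at)
      have "infinite ({max 0 (d - e)<..<d} - F)" using d e F by (intro Diff_infinite_finite) auto
      then obtain s where "s \<in> {max 0 (d - e)<..<d} - F" using infinite_imp_nonempty by blast
      thus False using spread[of s] e(2)[of s] by (auto simp: dist_real_def)
    qed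
    moreover have "z0 + of_real d * u = x" using d by (simp add: u_def)
    ultimately show False using gx big by simp
  qed
  hence "g z \<le> exp (n * M)" using z0[of z] by linarith
  thus ?thesis using iff by simp
qed

text \<open>Jensen's formula is applied to circles that avoid the roots, which excludes finitely many
  radii for each centre. The roots themselves are excluded as centres, because \<open>ln 0 = 0\<close> gives \<open>v\<close>
  a wrong value there.\<close>

lemma superharmonic_off_potential_difference:
  fixes Q :: "complex poly"
  assumes \<mu>: "prob_space \<mu>" "sets \<mu> = sets borel" and K: "compact K" and AEK: "AE a in \<mu>. a \<in> K"
    and cont: "continuous_on UNIV (rpot \<mu>)"
    and R: "\<And>b. b \<in> K \<Longrightarrow> cmod b \<le> R - 1" "R \<ge> 1"
    and Q: "lead_coeff Q = 1" "degree Q > 0"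
    and le: "\<And>z. cmod (poly Q z) \<le> exp (degree Q * (rpot \<mu> z + \<eta>))"
  shows "superharmonic_off K R (\<lambda>z. ennreal (\<eta> + rpot \<mu> z - ln (cmod (poly Q z)) / degree Q)) \<eta>"
proof -
  define n where "n = real (degree Q)"
  have n: "n > 0" using Q by (simp add: n_def)
  have Q0: "Q \<noteq> 0" using Q by auto
  have roots: "finite {b. poly Q b = 0}" using Q0 by (rule poly_roots_finite)
  define v where "v = (\<lambda>z. \<eta> + rpot \<mu> z - ln (cmod (poly Q z)) / n)"
  have [measurable]: "rpot \<mu> \<in> borel_measurable borel" using cont by (rule borel_measurable_continuous_onI)
  have [measurable]: "poly Q \<in> borel_measurable borel"
    by (intro borel_measurable_continuous_onI continuous_intros)
  have v0: "v z \<ge> 0" if "poly Q z \<noteq> 0" for z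
  proof -
    have "ln (cmod (poly Q z)) \<le> ln (exp (n * (rpot \<mu> z + \<eta>)))"
      using le[of z] that by (intro ln_mono) (auto simp: n_def)
    thus ?thesis using n by (simp add: v_def field_simps)
  qed
  have mean: "circle_mean (\<lambda>z. ennreal (v z)) a s = ennreal (\<eta> + I - jensen_mean Q a s / n)"
    if s: "s > 0" "s \<notin> (\<lambda>b. cmod (a - b)) ` {b. poly Q b = 0}"
      and I: "((\<lambda>t. rpot \<mu> (circlepath a s t)) has_integral I) {0..1}" for a s I
  proof -
    have nr': "cmod (a - b) \<noteq> s" if "poly Q b = 0" for b using s(2) that by auto
    have nr: "poly Q (circlepath a s t) \<noteq> 0" for t
      using nr'[of "circlepath a s t"] s(1) by (auto simp: circlepath norm_mult)
    have "((\<lambda>t. v (circlepath a s t)) has_integral (\<eta> + I - jensen_mean Q a s / n)) {0..1}"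
      unfolding v_def using has_integral_const_real[of \<eta> 0 1]
      by (intro has_integral_diff has_integral_add has_integral_divide I has_integral_ln_poly_circle Q s nr') auto
    thus ?thesis unfolding circle_mean_def
      by (intro nn_integral_has_integral_lebesgue') (use v0 nr in auto)
  qed
  have AEs: "AE s in lborel. s \<notin> (\<lambda>b. cmod (a - b)) ` {b. poly Q b = 0}" for a
    by (rule AE_not_in[OF finite_imp_null_set_lborel]) (use roots in auto)
  have AEa: "AE a in lborel. poly Q a \<noteq> 0"
    using AE_not_in[OF finite_imp_null_set_lborel[OF roots]] by simp
  have "superharmonic_off K R (\<lambda>z. ennreal (v z)) \<eta>" unfolding superharmonic_off_def
  proof (intro conjI ballI)
    show "(\<lambda>z. ennreal (v z)) \<in> borel_measurable borel" unfolding v_def by measurable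
    show "AE a in lborel. AE s in lborel. 0 < s \<and> s < infdist a K \<longrightarrow> circle_mean (\<lambda>z. ennreal (v z)) a s \<le> ennreal (v a)"
      using AEa
    proof eventually_elim
      case (elim a)
      show ?case
      proof (rule eventually_mono[OF AEs[of a]], intro impI)
        fix s assume nF: "s \<notin> (\<lambda>b. cmod (a - b)) ` {b. poly Q b = 0}" and sK: "0 < s \<and> s < infdist a K"
        have I: "((\<lambda>t. rpot \<mu> (circlepath a s t)) has_integral rpot \<mu> a) {0..1}"
          by (rule rpot_circle_mean_off[OF \<mu> K AEK]) (use sK in auto)
        have s: "s > 0" using sK by simp
        have "ln (cmod (poly Q a)) / n \<le> jensen_mean Q a s / n"
          using ln_norm_poly_le_circle_mean[OF Q(1) \<open>poly Q a \<noteq> 0\<close> s] n by (intro divide_right_mono) auto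
        thus "circle_mean (\<lambda>z. ennreal (v z)) a s \<le> ennreal (v a)"
          unfolding mean[OF s nF I] by (intro ennreal_leI) (simp add: v_def)
      qed
    qed
    fix a :: complex assume a: "a \<in> ball 0 1"
    show "AE s in lborel. R < s \<longrightarrow> circle_mean (\<lambda>z. ennreal (v z)) a s \<le> ennreal \<eta>"
    proof (rule eventually_mono[OF AEs[of a]], intro impI)
      fix s assume nF: "s \<notin> (\<lambda>b. cmod (a - b)) ` {b. poly Q b = 0}" and sR: "R < s"
      have s: "s > 0" using sR R by simp
      have I: "((\<lambda>t. rpot \<mu> (circlepath a s t)) has_integral ln s) {0..1}"
      proof (rule rpot_circle_mean_far[OF \<mu> K AEK _ _ s])
        show "cmod (a - b) \<le> R" if "b \<in> K" for b using norm_triangle_ineq4[of a b] R(1)[OF that] a by simp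
      qed (use sR in simp)
      have "n * ln s / n \<le> jensen_mean Q a s / n"
        using degree_ln_le_circle_mean[OF s, of Q a] n by (intro divide_right_mono) (auto simp: n_def)
      thus "circle_mean (\<lambda>z. ennreal (v z)) a s \<le> ennreal \<eta>"
        unfolding mean[OF s nF I] using n by (intro ennreal_leI) simp
    qed
  qed
  thus ?thesis by (simp add: v_def n_def)
qed

text \<open>For \<open>w \<le> \<eta>\<close> one has \<open>|w| \<le> \<eta> + (\<eta> - w)\<close>. The integral of the constant \<open>\<eta>\<close> is estimated like
  that of \<open>\<eta> - w\<close>: the constant 1 is superharmonic, too.\<close>

lemma potential_dist_root_measure_le:
  fixes Q :: "complex poly"
  assumes \<mu>: "prob_space \<mu>" "sets \<mu> = sets borel" and K: "compact K" "K \<noteq> {}" and AEK: "AE a in \<mu>. a \<in> K"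
    and int: "\<And>z. integrable \<mu> (\<lambda>a. ln (cmod (z - a)))"
    and pot: "\<And>z. log_potential \<mu> z = ereal (rpot \<mu> z)"
    and cont: "continuous_on UNIV (rpot \<mu>)"
    and R: "\<And>b. b \<in> K \<Longrightarrow> cmod b \<le> R - 1" "R \<ge> 1"
    and B: "B \<ge> 0" "\<And>v \<eta>. superharmonic_off K R v \<eta> \<Longrightarrow> (\<integral>\<^sup>+z. v z \<partial>fubini_study) \<le> ennreal B * ennreal \<eta>"
    and Q: "lead_coeff Q = 1" "degree Q > 0" and \<eta>: "\<eta> \<ge> 0"
    and le: "\<And>z. z \<in> K \<Longrightarrow> cmod (poly Q z) \<le> exp (degree Q * (rpot \<mu> z + \<eta>))"
  shows "potential_dist (root_measure Q) \<mu> \<le> ennreal (2 * B * \<eta>)"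
proof -
  define n where "n = real (degree Q)"
  have n: "n > 0" using Q by (simp add: n_def)
  have Q0: "Q \<noteq> 0" using Q by auto
  have le': "cmod (poly Q z) \<le> exp (degree Q * (rpot \<mu> z + \<eta>))" for z
    by (rule poly_potential_max_principle[OF \<mu> K AEK int cont Q le])
  define v where "v = (\<lambda>z. \<eta> + rpot \<mu> z - ln (cmod (poly Q z)) / n)"
  have sv: "superharmonic_off K R (\<lambda>z. ennreal (v z)) \<eta>"
    unfolding v_def n_def by (rule superharmonic_off_potential_difference[OF \<mu> K(1) AEK cont R Q le'])
  have s1: "superharmonic_off K R (\<lambda>z. 1) 1"
    by (auto simp: superharmonic_off_def circle_mean_def)
  have [measurable]: "rpot \<mu> \<in> borel_measurable borel" using cont by (rule borel_measurable_continuous_onI)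
  have [measurable]: "poly Q \<in> borel_measurable borel"
    by (intro borel_measurable_continuous_onI continuous_intros)
  have [measurable]: "v \<in> borel_measurable borel" unfolding v_def by measurable
  have "AE z in lborel. poly Q z \<noteq> 0"
    using AE_not_in[OF finite_imp_null_set_lborel[OF poly_roots_finite[OF Q0]]] by simp
  hence AE: "AE z in fubini_study. poly Q z \<noteq> 0"
    unfolding fubini_study_eq by (subst AE_density) (auto elim: eventually_mono)
  have msets: "sets fubini_study = sets borel" by (simp add: fubini_study_eq)
  note [measurable_cong] = msets
  have "potential_dist (root_measure Q) \<mu> \<le> (\<integral>\<^sup>+z. ennreal \<eta> * 1 + ennreal (v z) \<partial>fubini_study)"
    unfolding potential_dist_def
  proof (rule nn_integral_mono_AE)
    show "AE z in fubini_study. e2ennreal \<bar>log_potential (root_measure Q) z - log_potential \<mu> z\<bar> \<le> ennreal \<eta> * 1 + ennreal (v z)"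
      using AE
    proof eventually_elim
      case (elim z)
      define w where "w = ln (cmod (poly Q z)) / n - rpot \<mu> z"
      have "ln (cmod (poly Q z)) \<le> ln (exp (n * (rpot \<mu> z + \<eta>)))"
        using le'[of z] elim by (intro ln_mono) (auto simp: n_def)
      hence w: "w \<le> \<eta>" using n by (simp add: w_def field_simps)
      have "log_potential (root_measure Q) z - log_potential \<mu> z = ereal w"
        using log_potential_root_measure[OF Q(2,1), of z] elim by (simp add: pot w_def n_def)
      hence "e2ennreal \<bar>log_potential (root_measure Q) z - log_potential \<mu> z\<bar> = ennreal \<bar>w\<bar>" by simp
      also have "\<dots> \<le> ennreal (\<eta> + v z)" using w \<eta> by (intro ennreal_leI) (simp add: v_def w_def)
      also have "\<dots> = ennreal \<eta> * 1 + ennreal (v z)" using w \<eta> by (subst ennreal_plus) (auto simp: v_def w_def)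
      finally show ?case .
    qed
  qed
  also have "\<dots> = (\<integral>\<^sup>+z. ennreal \<eta> * 1 \<partial>fubini_study) + (\<integral>\<^sup>+z. ennreal (v z) \<partial>fubini_study)"
    by (rule nn_integral_add) measurable
  also have "(\<integral>\<^sup>+z. ennreal \<eta> * 1 \<partial>fubini_study) = ennreal \<eta> * (\<integral>\<^sup>+z. 1 \<partial>fubini_study)"
    by (rule nn_integral_cmult) measurable
  also have "\<dots> + (\<integral>\<^sup>+z. ennreal (v z) \<partial>fubini_study) \<le> ennreal \<eta> * (ennreal B * ennreal 1) + ennreal B * ennreal \<eta>"
    using B(2)[OF s1] B(2)[OF sv] by (intro add_mono mult_left_mono) auto
  also have "\<dots> = ennreal (2 * B * \<eta>)"
    using B(1) \<eta> by (simp add: ennreal_mult[symmetric] ennreal_plus[symmetric] mult_ac del: ennreal_plus)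
  finally show ?thesis .
qed

section \<open>The Bernstein-Markov inequality and the deviation bound\<close>

text \<open>Cauchy's estimate bounds the derivative by \<open>2 B exp h / r\<close> at distance up to \<open>r / 2\<close> from
  \<open>x\<close>, so \<open>|Q|\<close> drops by no more than \<open>B / 2\<close> over the distance \<open>r / (4 exp h)\<close>.\<close>

lemma poly_near_max_lower_bound:
  fixes Q :: "complex poly"
  assumes r: "r > 0" and B: "cmod (poly Q x) = B" "B > 0" and h: "h \<ge> 0"
    and le: "\<And>z. cmod (z - x) \<le> r \<Longrightarrow> cmod (poly Q z) \<le> B * exp h"
    and y: "cmod (y - x) \<le> r / (4 * exp h)"
  shows "B / 2 \<le> cmod (poly Q y)"
proof -
  have e: "exp h \<ge> 1" using h by simp
  have yr: "cmod (y - x) \<le> r / 2"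
  proof -
    have "2 \<le> 4 * exp h" using e by linarith
    hence "r / (4 * exp h) \<le> r / 2" using r by (intro divide_left_mono) auto
    thus ?thesis using y by linarith
  qed
  have d: "cmod (poly (pderiv Q) w) \<le> 2 * B * exp h / r" if w: "w \<in> cball x (r / 2)" for w
  proof -
    have "norm ((deriv ^^ 1) (poly Q) w) \<le> (fact 1) * (B * exp h) / (r / 2) ^ 1"
    proof (rule Cauchy_inequality)
      show "poly Q holomorphic_on ball w (r / 2)" by (intro holomorphic_intros)
      show "continuous_on (cball w (r / 2)) (poly Q)" by (intro continuous_intros)
      show "cmod (poly Q z) \<le> B * exp h" if "cmod (w - z) = r / 2" for z
      proof (rule le)
        have "cmod (z - x) \<le> cmod (w - z) + cmod (w - x)"
          using norm_triangle_ineq4[of "w - x" "w - z"] by simp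
        thus "cmod (z - x) \<le> r" using that w by (simp add: dist_norm norm_minus_commute)
      qed
    qed (use r in auto)
    moreover have "deriv (poly Q) w = poly (pderiv Q) w" by (rule DERIV_imp_deriv[OF poly_DERIV])
    ultimately show ?thesis by (simp add: mult_ac)
  qed
  have "cmod (poly Q y - poly Q x) \<le> 2 * B * exp h / r * cmod (y - x)"
  proof (rule field_differentiable_bound[where S = "cball x (r / 2)"])
    show "(poly Q has_field_derivative poly (pderiv Q) z) (at z within cball x (r / 2))" for z
      by (rule has_field_derivative_at_within[OF poly_DERIV])
  qed (use d yr r in \<open>auto simp: dist_norm norm_minus_commute\<close>)
  also have "\<dots> \<le> 2 * B * exp h / r * (r / (4 * exp h))"
    using y B r by (intro mult_left_mono) auto
  also have "\<dots> = B / 2" using r by simp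
  finally show ?thesis using norm_triangle_ineq2[of "poly Q x" "poly Q x - poly Q y"] B(1)
    by (simp add: norm_minus_commute)
qed

text \<open>At distance \<open>r = n powr (-1 / \<kappa>)\<close> the Hoelder bound lets \<open>n U\<close> vary by at most \<open>H\<close>. So \<open>|Q|\<close>
  exceeds its value at the maximum point of \<open>|Q| exp (-n U)\<close> by at most the factor \<open>exp H\<close> there,
  and it stays above half that value on a piece of the arc of length proportional to \<open>r\<close>.\<close>

lemma bernstein_markov_arc:
  fixes Q :: "complex poly" and \<gamma> :: "real \<Rightarrow> complex" and U :: "complex \<Rightarrow> real"
  assumes L: "L \<ge> 1" and lip: "\<And>s t. s \<in> {0..1} \<Longrightarrow> t \<in> {0..1} \<Longrightarrow> cmod (\<gamma> s - \<gamma> t) \<le> L * \<bar>s - t\<bar>"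
    and \<kappa>: "0 < \<kappa>" and H: "H \<ge> 0" and U: "\<And>z z'. \<bar>U z - U z'\<bar> \<le> H * cmod (z - z') powr \<kappa>"
    and n: "n \<ge> 1" and \<alpha>: "\<alpha> > 0" and t0: "t\<^sub>0 \<in> {0..1}"
    and max: "cmod (poly Q (\<gamma> t\<^sub>0)) = exp (n * (U (\<gamma> t\<^sub>0) + M))"
    and le: "\<And>z. cmod (poly Q z) \<le> exp (n * (U z + M))"
  shows "ennreal ((exp (- H) / 2) powr \<alpha> / (4 * exp H * L) * n powr (- 1 / \<kappa>) * exp (\<alpha> * n * M)) \<le>
    (\<integral>\<^sup>+t\<in>{0..1}. ennreal (cmod (poly Q (\<gamma> t)) powr \<alpha> * exp (- (\<alpha> * n * U (\<gamma> t)))) \<partial>lborel)"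
proof -
  define x where "x = \<gamma> t\<^sub>0"
  define B where "B = cmod (poly Q x)"
  have B: "B > 0" by (simp add: B_def max x_def)
  define r where "r = n powr (- 1 / \<kappa>)"
  have r: "r > 0" "r \<le> 1" "n * r powr \<kappa> = 1"
  proof -
    show "r > 0" using n by (simp add: r_def)
    have "n powr (- 1 / \<kappa>) \<le> n powr 0" using n \<kappa> by (intro powr_mono) auto
    thus "r \<le> 1" using n by (simp add: r_def)
    have "r powr \<kappa> = n powr (- 1 / \<kappa> * \<kappa>)" unfolding r_def by (rule powr_powr)
    also have "\<dots> = 1 / n" using n \<kappa> by (simp add: powr_minus_divide)
    finally show "n * r powr \<kappa> = 1" using n by simp
  qed
  have nH: "n * (H * cmod (z - x) powr \<kappa>) \<le> H" if "cmod (z - x) \<le> r" for z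
  proof -
    have "cmod (z - x) powr \<kappa> \<le> r powr \<kappa>" using that \<kappa> by (intro powr_mono2) auto
    hence "(n * H) * cmod (z - x) powr \<kappa> \<le> (n * H) * r powr \<kappa>" using n H by (intro mult_left_mono) auto
    also have "\<dots> = H" using r(3) by (simp add: mult.commute mult.left_commute)
    finally show ?thesis by (simp add: mult.assoc)
  qed
  have nU: "\<bar>n * U z - n * U x\<bar> \<le> H" if "cmod (z - x) \<le> r" for z
  proof -
    have "\<bar>n * U z - n * U x\<bar> = n * \<bar>U z - U x\<bar>" using n by (simp add: abs_mult right_diff_distrib[symmetric])
    also have "\<dots> \<le> n * (H * cmod (z - x) powr \<kappa>)" using U n by (intro mult_left_mono) auto
    finally show ?thesis using nH[OF that] by linarith
  qed
  have up: "cmod (poly Q z) \<le> B * exp H" if "cmod (z - x) \<le> r" for z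
  proof -
    have "cmod (poly Q z) \<le> exp (n * (U z + M))" by (rule le)
    also have "\<dots> \<le> exp (n * (U x + M) + H)" using nU[OF that] by (simp add: distrib_left abs_le_iff)
    also have "\<dots> = B * exp H" by (simp add: B_def x_def max exp_add)
    finally show ?thesis .
  qed
  define l where "l = r / (4 * exp H) / L"
  have eH: "exp H \<ge> 1" using H by simp
  have l: "l > 0" using r L by (simp add: l_def)
  have "1 * 1 \<le> exp H * L" using eH L by (intro mult_mono) auto
  hence l2: "l \<le> 1 / 2" using r(2) L by (simp add: l_def field_simps)
  define c where "c = (if t\<^sub>0 \<le> 1 / 2 then t\<^sub>0 else t\<^sub>0 - l)"
  have I: "{c..c+l} \<subseteq> {0..1}" "\<And>t. t \<in> {c..c+l} \<Longrightarrow> \<bar>t - t\<^sub>0\<bar> \<le> l"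
    using t0 l l2 by (auto simp: c_def split: if_splits)
  define m where "m = (exp (- H) / 2) powr \<alpha> * exp (\<alpha> * n * M)"
  have low: "m \<le> cmod (poly Q (\<gamma> t)) powr \<alpha> * exp (- (\<alpha> * n * U (\<gamma> t)))" if t: "t \<in> {c..c+l}" for t
  proof -
    have "cmod (\<gamma> t - x) \<le> L * \<bar>t - t\<^sub>0\<bar>" unfolding x_def using t I(1) t0 by (intro lip) auto
    also have "\<dots> \<le> L * l" using I(2)[OF t] L by (intro mult_left_mono) auto
    also have "\<dots> = r / (4 * exp H)" using L by (simp add: l_def)
    finally have near: "cmod (\<gamma> t - x) \<le> r / (4 * exp H)" .
    also have "\<dots> \<le> r / 1"
    proof -
      have "1 \<le> 4 * exp H" using eH by linarith
      thus ?thesis using r by (intro divide_left_mono) auto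
    qed
    finally have near': "cmod (\<gamma> t - x) \<le> r" by simp
    have "B / 2 \<le> cmod (poly Q (\<gamma> t))"
      by (rule poly_near_max_lower_bound[OF r(1) B_def[symmetric] B H up near])
    hence "(B / 2) powr \<alpha> \<le> cmod (poly Q (\<gamma> t)) powr \<alpha>" using B \<alpha> by (intro powr_mono2) auto
    hence "(B / 2) powr \<alpha> * exp (- (\<alpha> * n * U (\<gamma> t))) \<le> cmod (poly Q (\<gamma> t)) powr \<alpha> * exp (- (\<alpha> * n * U (\<gamma> t)))"
      by (intro mult_right_mono) auto
    moreover have "m \<le> (B / 2) powr \<alpha> * exp (- (\<alpha> * n * U (\<gamma> t)))"
    proof -
      have "n * U (\<gamma> t) \<le> n * U x + H" using nU[OF near'] by (simp add: abs_le_iff)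
      hence "\<alpha> * (n * U (\<gamma> t)) \<le> \<alpha> * (n * U x + H)" using \<alpha> by (intro mult_left_mono) auto
      hence "exp (\<alpha> * (n * (U x + M)) - \<alpha> * (n * U x + H)) \<le> exp (\<alpha> * (n * (U x + M)) - \<alpha> * n * U (\<gamma> t))"
        by (simp add: mult.assoc)
      also have "\<alpha> * (n * (U x + M)) - \<alpha> * (n * U x + H) = \<alpha> * (- H) + \<alpha> * n * M" by (simp add: algebra_simps)
      also have "exp (\<alpha> * (- H) + \<alpha> * n * M) = exp (\<alpha> * (- H)) * exp (\<alpha> * n * M)" by (rule exp_add)
      also have "exp (\<alpha> * (- H)) = exp (- H) powr \<alpha>" by (simp add: powr_def)
      also have "exp (\<alpha> * (n * (U x + M)) - \<alpha> * n * U (\<gamma> t)) = B powr \<alpha> * exp (- (\<alpha> * n * U (\<gamma> t)))"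
        by (simp add: B_def x_def max powr_def exp_diff exp_minus divide_inverse)
      finally have "exp (- H) powr \<alpha> * exp (\<alpha> * n * M) / 2 powr \<alpha> \<le> B powr \<alpha> * exp (- (\<alpha> * n * U (\<gamma> t))) / 2 powr \<alpha>"
        by (intro divide_right_mono) auto
      thus ?thesis using B by (simp add: m_def powr_divide)
    qed
    ultimately show ?thesis by linarith
  qed
  have "(exp (- H) / 2) powr \<alpha> / (4 * exp H * L) * n powr (- 1 / \<kappa>) * exp (\<alpha> * n * M) = m * l"
    by (simp add: m_def l_def r_def)
  hence "ennreal ((exp (- H) / 2) powr \<alpha> / (4 * exp H * L) * n powr (- 1 / \<kappa>) * exp (\<alpha> * n * M)) = ennreal m * ennreal l"
    using l by (simp add: ennreal_mult m_def)
  also have "\<dots> = (\<integral>\<^sup>+t. ennreal m * indicator {c..c+l} t \<partial>lborel)"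
    using l by (subst nn_integral_cmult_indicator) auto
  also have "\<dots> \<le> (\<integral>\<^sup>+t\<in>{0..1}. ennreal (cmod (poly Q (\<gamma> t)) powr \<alpha> * exp (- (\<alpha> * n * U (\<gamma> t)))) \<partial>lborel)"
  proof (rule nn_integral_mono)
    fix t
    show "ennreal m * indicator {c..c+l} t \<le> ennreal (cmod (poly Q (\<gamma> t)) powr \<alpha> * exp (- (\<alpha> * n * U (\<gamma> t)))) * indicator {0..1} t"
    proof (cases "t \<in> {c..c+l}")
      case True
      hence "t \<in> {0..1}" using I(1) by blast
      thus ?thesis using True low[OF True] by (simp add: ennreal_leI)
    qed simp
  qed
  finally show ?thesis .
qed

lemma poly_max_on_arc:
  fixes Q :: "complex poly" and U :: "complex \<Rightarrow> real"
  assumes K: "compact K" and U: "continuous_on UNIV U" and n: "n > 0"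
    and big: "z \<in> K" "cmod (poly Q z) > exp (n * (U z + \<eta>))"
  obtains x M where "x \<in> K" "\<eta> < M" "cmod (poly Q x) = exp (n * (U x + M))"
    "\<And>z. z \<in> K \<Longrightarrow> cmod (poly Q z) \<le> exp (n * (U z + M))"
proof -
  define g where "g = (\<lambda>z. cmod (poly Q z) * exp (- (n * U z)))"
  have "continuous_on UNIV g" unfolding g_def by (intro continuous_intros U)
  hence "continuous_on K g" by (rule continuous_on_subset) simp
  then obtain x where x: "x \<in> K" "\<And>z. z \<in> K \<Longrightarrow> g z \<le> g x"
    using continuous_attains_sup[OF K, of g] big(1) by blast
  have "exp (n * \<eta>) < g z"
    using big(2) by (simp add: g_def exp_minus field_simps exp_add)
  hence gx: "exp (n * \<eta>) < g x" using x(2)[OF big(1)] by linarith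
  define M where "M = ln (g x) / n"
  have gpos: "g x > 0" using gx exp_gt_zero[of "n * \<eta>"] by linarith
  have gM: "g x = exp (n * M)" using gpos n by (simp add: M_def)
  have "\<eta> < M" using gx n by (simp add: gM)
  moreover have "cmod (poly Q y) = g y * exp (n * U y)" for y by (simp add: g_def exp_minus)
  moreover have "exp (n * M) * exp (n * U y) = exp (n * (U y + M))" for y by (simp add: exp_add[symmetric] algebra_simps)
  ultimately show ?thesis using that[of x M] x gM by (metis exp_ge_zero mult_right_mono)
qed

theorem theorem1p1:
  fixes K :: "complex set" and \<mu>\<^sub>0 :: "complex measure" and \<alpha> :: real
  assumes "smooth_nonclosed_curve K"
    and "prob_space \<mu>\<^sub>0" and "sets \<mu>\<^sub>0 = sets borel" and "measure_support \<mu>\<^sub>0 \<subseteq> K"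
    and "\<forall>z\<in>K. \<bar>log_potential \<mu>\<^sub>0 z\<bar> \<noteq> \<infinity>"
    and "holder_continuous_on K (\<lambda>z. real_of_ereal (log_potential \<mu>\<^sub>0 z))"
    and "\<alpha> > 0"
  shows "\<exists>A::real. A > 0 \<and>
    (\<forall>(n::nat) (\<nu> :: complex poly measure) (c::real).
       n \<ge> 1 \<longrightarrow> prob_space \<nu> \<longrightarrow> sets \<nu> = sets (monic_poly_space n) \<longrightarrow> c \<ge> 1 \<longrightarrow>
       (\<forall>z\<in>K. (\<integral>\<^sup>+ Q. ennreal (cmod (poly Q z) powr \<alpha>) \<partial>\<nu>)
                \<le> ennreal (c * exp (\<alpha> * real n * real_of_ereal (log_potential \<mu>\<^sub>0 z)))) \<longrightarrow>
       (\<forall>\<delta>>0. \<P>(Q in \<nu>. potential_dist (root_measure Q) \<mu>\<^sub>0 \<ge> ennreal \<delta>)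
                \<le> A * real n powr A * c * exp (- (\<delta> * real n / A))))"
proof -
  note \<mu> = assms(2,3)
  note top = smooth_nonclosed_curve_topology[OF assms(1)]
  have AEK: "AE a in \<mu>\<^sub>0. a \<in> K" by (rule AE_in_support[OF \<mu>(2) assms(4)])
  obtain \<kappa> H where \<kappa>: "0 < \<kappa>" "\<kappa> \<le> 1" and H: "H \<ge> 0"
    and int: "\<And>z. integrable \<mu>\<^sub>0 (\<lambda>a. ln (cmod (z - a)))"
    and pot: "\<And>z. log_potential \<mu>\<^sub>0 z = ereal (rpot \<mu>\<^sub>0 z)"
    and hol: "\<And>z z'. \<bar>rpot \<mu>\<^sub>0 z - rpot \<mu>\<^sub>0 z'\<bar> \<le> H * cmod (z - z') powr \<kappa>"
    using smooth_arc_potential_holder[OF assms(1-6)] by metis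
  define U where "U = rpot \<mu>\<^sub>0"
  have Ucont: "continuous_on UNIV U"
  proof (rule continuous_at_imp_continuous_on, rule ballI)
    fix z
    have "((\<lambda>w. H * cmod (w - z) powr \<kappa>) \<longlongrightarrow> H * 0 powr \<kappa>) (at z)"
      using \<kappa> by (intro tendsto_intros tendsto_eq_intros) (auto intro!: always_eventually tendsto_eq_intros)
    hence "((\<lambda>w. H * cmod (w - z) powr \<kappa>) \<longlongrightarrow> 0) (at z)" by simp
    hence "((\<lambda>w. U w - U z) \<longlongrightarrow> 0) (at z)"
      by (rule tendsto_0_le[where K = 1]) (use hol H in \<open>auto simp: U_def intro!: always_eventually\<close>)
    thus "isCont U z" by (simp add: isCont_def LIM_zero_iff)
  qed
  obtain \<gamma> L where \<gamma>K: "K = \<gamma> ` {0..1}" and \<gamma>c: "continuous_on UNIV \<gamma>" and L: "L \<ge> 1"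
    and lip: "\<And>s t. s \<in> {0..1} \<Longrightarrow> t \<in> {0..1} \<Longrightarrow> cmod (\<gamma> s - \<gamma> t) \<le> L * \<bar>s - t\<bar>"
    using smooth_nonclosed_curve_parametrisation[OF assms(1)] by metis
  have [measurable]: "\<gamma> \<in> borel_measurable borel" using \<gamma>c by (rule borel_measurable_continuous_onI)
  obtain C where C: "C > 0" "reach_bound K C" using smooth_nonclosed_curve_reach[OF assms(1)] by blast
  obtain R0 where R0: "R0 > 0" "\<And>b. b \<in> K \<Longrightarrow> cmod b \<le> R0" using compact_imp_bounded[OF top(1)] by (auto simp: bounded_pos)
  define R where "R = R0 + 1"
  have R: "cmod b \<le> R - 1" if "b \<in> K" for b using R0(2)[OF that] by (simp add: R_def)
  have R1: "R \<ge> 1" using R0(1) by (simp add: R_def)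
  have RK: "K \<subseteq> cball 0 R" using R by force
  obtain B where B: "B > 0" "\<And>v \<eta>. superharmonic_off K R v \<eta> \<Longrightarrow>
    (\<integral>\<^sup>+z. v z \<partial>fubini_study) \<le> ennreal B * ennreal \<eta>"
    using fubini_study_superharmonic_bound[OF top R1 RK C] by blast
  define c\<^sub>1 where "c\<^sub>1 = (exp (- H) / 2) powr \<alpha> / (4 * exp H * L)"
  have c1: "c\<^sub>1 > 0" using L by (simp add: c\<^sub>1_def)
  define A where "A = max (1 / \<kappa>) (max (1 / c\<^sub>1) (4 * B / \<alpha>))"
  have A: "A \<ge> 1 / \<kappa>" "A \<ge> 1 / c\<^sub>1" "A \<ge> 4 * B / \<alpha>" by (auto simp: A_def)
  have "1 / c\<^sub>1 > 0" using c1 by simp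
  hence A0: "A > 0" using A(2) by linarith
  have main: "measure \<nu> {Q \<in> space \<nu>. ennreal \<delta> \<le> potential_dist (root_measure Q) \<mu>\<^sub>0} \<le> A * real n powr A * c * exp (- (\<delta> * real n / A))"
    if n: "n \<ge> 1" and \<nu>: "prob_space \<nu>" "sets \<nu> = sets (monic_poly_space n)" and c: "c \<ge> 1"
      and mom: "\<forall>z\<in>K. (\<integral>\<^sup>+ Q. ennreal (cmod (poly Q z) powr \<alpha>) \<partial>\<nu>)
                \<le> ennreal (c * exp (\<alpha> * real n * real_of_ereal (log_potential \<mu>\<^sub>0 z)))"
      and \<delta>: "\<delta> > 0" for n \<nu> c \<delta>
  proof -
    interpret \<nu>: prob_space \<nu> by fact
    note [measurable_cong] = \<nu>(2)
    note [measurable] = measurable_poly_monic_poly_space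
    have sp: "space \<nu> = monic_polys n" using sets_eq_imp_space_eq[OF \<nu>(2)] by simp
    have [measurable]: "U \<in> borel_measurable borel" using Ucont by (rule borel_measurable_continuous_onI)
    \<comment> \<open>if the difference of the potentials is at most this on \<open>K\<close>, then the distance is at most \<open>\<delta> / 2\<close>\<close>
    define \<eta> where "\<eta> = \<delta> / (4 * B)"
    have \<eta>: "\<eta> > 0" using \<delta> B by (simp add: \<eta>_def)
    define X where "X = (\<lambda>Q. \<integral>\<^sup>+t\<in>{0..1}. ennreal (cmod (poly Q (\<gamma> t)) powr \<alpha> * exp (- (\<alpha> * n * U (\<gamma> t)))) \<partial>lborel)"
    have pm [measurable]: "(\<lambda>(Q, t). poly Q (\<gamma> t)) \<in> borel_measurable (\<nu> \<Otimes>\<^sub>M lborel)"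
    proof -
      have "(\<lambda>x. (fst x, \<gamma> (snd x))) \<in> \<nu> \<Otimes>\<^sub>M lborel \<rightarrow>\<^sub>M monic_poly_space n \<Otimes>\<^sub>M borel" by measurable
      from measurable_compose[OF this measurable_poly_monic_poly_space] show ?thesis by (simp add: case_prod_beta)
    qed
    have fm [measurable]: "(\<lambda>(Q, t). ennreal (cmod (poly Q (\<gamma> t)) powr \<alpha> * exp (- (\<alpha> * n * U (\<gamma> t)))) * indicator {0..1} t)
        \<in> borel_measurable (\<nu> \<Otimes>\<^sub>M lborel)"
    proof -
      have "(\<lambda>x. ennreal (cmod (case x of (Q, t) \<Rightarrow> poly Q (\<gamma> t)) powr \<alpha> * exp (- (\<alpha> * n * U (\<gamma> (snd x))))) * indicator {0..1} (snd x))
        \<in> borel_measurable (\<nu> \<Otimes>\<^sub>M lborel)" by measurable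
      thus ?thesis by (simp add: case_prod_beta)
    qed
    have Xm [measurable]: "X \<in> borel_measurable \<nu>"
      unfolding X_def using lborel.borel_measurable_nn_integral[OF fm] by simp
    have EX: "(\<integral>\<^sup>+Q. X Q \<partial>\<nu>) \<le> ennreal c"
    proof -
      interpret pair_sigma_finite \<nu> lborel ..
      have "(\<integral>\<^sup>+Q. X Q \<partial>\<nu>) = (\<integral>\<^sup>+t. (\<integral>\<^sup>+Q. ennreal (cmod (poly Q (\<gamma> t)) powr \<alpha> * exp (- (\<alpha> * n * U (\<gamma> t)))) * indicator {0..1} t \<partial>\<nu>) \<partial>lborel)"
        unfolding X_def by (rule Fubini'[symmetric]) (rule fm)
      also have "\<dots> \<le> (\<integral>\<^sup>+t. ennreal c * indicator {0..1::real} t \<partial>lborel)"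
      proof (rule nn_integral_mono)
        fix t :: real
        show "(\<integral>\<^sup>+Q. ennreal (cmod (poly Q (\<gamma> t)) powr \<alpha> * exp (- (\<alpha> * n * U (\<gamma> t)))) * indicator {0..1} t \<partial>\<nu>) \<le> ennreal c * indicator {0..1} t"
        proof (cases "t \<in> {0..1}")
          case True
          hence \<gamma>t: "\<gamma> t \<in> K" by (simp add: \<gamma>K)
          have [measurable]: "(\<lambda>Q. poly Q (\<gamma> t)) \<in> borel_measurable \<nu>"
            using measurable_compose[OF measurable_Pair2'[of t lborel \<nu>] pm] by simp
          have "(\<integral>\<^sup>+Q. ennreal (cmod (poly Q (\<gamma> t)) powr \<alpha> * exp (- (\<alpha> * n * U (\<gamma> t)))) \<partial>\<nu>) =
             ennreal (exp (- (\<alpha> * n * U (\<gamma> t)))) * (\<integral>\<^sup>+Q. ennreal (cmod (poly Q (\<gamma> t)) powr \<alpha>) \<partial>\<nu>)"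
            by (subst nn_integral_cmult[symmetric]) (auto simp: ennreal_mult mult.commute)
          also have "\<dots> \<le> ennreal (exp (- (\<alpha> * n * U (\<gamma> t)))) * ennreal (c * exp (\<alpha> * n * U (\<gamma> t)))"
            using mom \<gamma>t by (intro mult_left_mono) (auto simp: pot U_def)
          also have "\<dots> = ennreal (exp (- (\<alpha> * n * U (\<gamma> t))) * (c * exp (\<alpha> * n * U (\<gamma> t))))"
            using c by (intro ennreal_mult[symmetric]) auto
          also have "exp (- (\<alpha> * n * U (\<gamma> t))) * (c * exp (\<alpha> * n * U (\<gamma> t))) = c" by (simp add: exp_minus)
          finally show ?thesis using True by simp
        qed simp
      qed
      also have "\<dots> = ennreal c" by (subst nn_integral_cmult_indicator) auto
      finally show ?thesis .
    qed
    \<comment> \<open>by the Bernstein-Markov inequality, \<open>X\<close> is at least this large whenever the distance is at least \<open>\<delta>\<close>\<close>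
    define y where "y = c\<^sub>1 * real n powr (- 1 / \<kappa>) * exp (\<alpha> * n * \<eta>)"
    have y: "y > 0" using c1 n by (simp add: y_def)
    have sub: "{Q \<in> space \<nu>. ennreal \<delta> \<le> potential_dist (root_measure Q) \<mu>\<^sub>0} \<subseteq> {Q \<in> space \<nu>. ennreal y \<le> X Q}"
    proof safe
      fix Q assume "Q \<in> space \<nu>" and dist: "ennreal \<delta> \<le> potential_dist (root_measure Q) \<mu>\<^sub>0"
      hence Q: "lead_coeff Q = 1" "degree Q = n" "degree Q > 0" using n by (auto simp: sp monic_polys_def)
      have "\<not> (\<forall>z\<in>K. cmod (poly Q z) \<le> exp (degree Q * (rpot \<mu>\<^sub>0 z + \<eta>)))"
      proof
        assume le: "\<forall>z\<in>K. cmod (poly Q z) \<le> exp (degree Q * (rpot \<mu>\<^sub>0 z + \<eta>))"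
        have "potential_dist (root_measure Q) \<mu>\<^sub>0 \<le> ennreal (2 * B * \<eta>)"
          by (rule potential_dist_root_measure_le[OF \<mu> top(1,2) AEK int pot Ucont[unfolded U_def] R R1 less_imp_le[OF B(1)] B(2) Q(1,3)])
             (use \<eta> le in auto)
        also have "2 * B * \<eta> = \<delta> / 2" using B by (simp add: \<eta>_def)
        also have "ennreal (\<delta> / 2) < ennreal \<delta>" using \<delta> by (intro ennreal_lessI) auto
        finally show False using dist by simp
      qed
      then obtain z where z: "z \<in> K" "cmod (poly Q z) > exp (real n * (U z + \<eta>))"
        by (auto simp: Q(2) U_def not_le)
      have n0: "real n > 0" using n by simp
      obtain x M where x: "x \<in> K" and M: "\<eta> < M" "cmod (poly Q x) = exp (real n * (U x + M))"
        "\<And>z. z \<in> K \<Longrightarrow> cmod (poly Q z) \<le> exp (real n * (U z + M))"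
        using poly_max_on_arc[OF top(1) Ucont n0 z] by metis
      obtain t0 where t0: "t0 \<in> {0..1}" "x = \<gamma> t0" using x by (auto simp: \<gamma>K)
      have le: "cmod (poly Q z) \<le> exp (real n * (U z + M))" for z
        using poly_potential_max_principle[OF \<mu> top(1,2) AEK int Ucont[unfolded U_def] Q(1,3), of M z] M(3)
        by (simp add: Q(2) U_def)
      have "ennreal (c\<^sub>1 * real n powr (- 1 / \<kappa>) * exp (\<alpha> * n * M)) \<le> X Q"
        unfolding c\<^sub>1_def X_def
        by (rule bernstein_markov_arc[OF L lip \<kappa>(1) H hol[folded U_def] _ assms(7) t0(1) M(2)[unfolded t0(2)] le])
           (use n in auto)
      moreover have "y \<le> c\<^sub>1 * real n powr (- 1 / \<kappa>) * exp (\<alpha> * n * M)"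
        unfolding y_def using M(1) c1 assms(7) by (intro mult_left_mono) (auto intro!: mult_left_mono)
      ultimately show "ennreal y \<le> X Q" by (meson ennreal_leI order.trans)
    qed
    have "ennreal y * emeasure \<nu> {Q \<in> space \<nu>. ennreal y \<le> X Q} = (\<integral>\<^sup>+Q. ennreal y * indicator {Q \<in> space \<nu>. ennreal y \<le> X Q} Q \<partial>\<nu>)"
      by (subst nn_integral_cmult_indicator) auto
    also have "\<dots> \<le> (\<integral>\<^sup>+Q. X Q \<partial>\<nu>)" by (intro nn_integral_mono) (auto simp: indicator_def)
    also have "\<dots> \<le> ennreal c" by (rule EX)
    finally have "ennreal (y * measure \<nu> {Q \<in> space \<nu>. ennreal y \<le> X Q}) \<le> ennreal c"
      using y by (simp add: \<nu>.emeasure_eq_measure ennreal_mult)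
    hence "y * measure \<nu> {Q \<in> space \<nu>. ennreal y \<le> X Q} \<le> c" using c by (simp add: ennreal_le_iff)
    hence le1: "measure \<nu> {Q \<in> space \<nu>. ennreal y \<le> X Q} \<le> c / y" using y by (simp add: field_simps)
    have "measure \<nu> {Q \<in> space \<nu>. ennreal \<delta> \<le> potential_dist (root_measure Q) \<mu>\<^sub>0} \<le> measure \<nu> {Q \<in> space \<nu>. ennreal y \<le> X Q}"
      by (rule \<nu>.finite_measure_mono[OF sub]) measurable
    also note le1
    also have "c / y = (1 / c\<^sub>1) * real n powr (1 / \<kappa>) * c * exp (- (\<alpha> * n * \<eta>))"
      using c1 n by (simp add: y_def powr_minus exp_minus field_simps)
    also have "\<dots> \<le> A * real n powr A * c * exp (- (\<delta> * real n / A))"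
    proof (intro mult_mono)
      show "1 / c\<^sub>1 \<le> A" by (rule A(2))
      show "real n powr (1 / \<kappa>) \<le> real n powr A" using n A(1) by (intro powr_mono) auto
      have "\<delta> * real n / A \<le> \<delta> * real n / (4 * B / \<alpha>)"
        using A(3) A0 \<delta> B(1) assms(7) by (intro divide_left_mono) (auto intro!: mult_pos_pos divide_pos_pos)
      also have "\<dots> = \<alpha> * n * \<eta>" using B(1) by (simp add: \<eta>_def field_simps)
      finally show "exp (- (\<alpha> * n * \<eta>)) \<le> exp (- (\<delta> * real n / A))" by simp
    qed (use c c1 A0 in auto)
    finally show ?thesis .
  qed
  show ?thesis using A0 main by (intro exI[of _ A] conjI allI impI) auto
qed

end
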